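(* For every $\varepsilon\in(0,1)$ there exists a compact set $E\subset\mathbb{T}$ with $m(E)>1-\varepsilon$ such that: (i) Every nontrivial (i.e. nonzero) complex finite Borel measure $\mu$ on $\mathbb{T}$ with support in $E$ satisfies $$\sum_{n\in\mathbb{Z}}|\widehat{\mu}(n)|^q=\infty\qquad\text{for all } 0<q<2.$$ (ii) There exists a nontrivial (not $m$-a.e. zero) $f\in L^\infty(\mathbb{T},dm)$ supported in $E$ such that for every $M>0$ there exists $C(M)>0$ with $$|\widehat{f}(n)|\le C(M)\,n^{-M},\qquad n=1,2,3,\ldots.$$
   Context: $\mathbb{T}\cong[0,1)$ is the unit circle and $m$ is the Lebesgue measure on $\mathbb{T}$ normalized so that $m(\mathbb{T})=1$. For a complex finite Borel measure $\mu$ on $\mathbb{T}$, $\widehat{\mu}(n)=\int_{\mathbb{T}}\zeta^{-n}\,d\mu(\zeta)$, $n\in\mathbb{Z}$, and for $f\in L^1(\mathbb{T},dm)$, $\widehat{f}(n)=\int_{\mathbb{T}}f(\zeta)\zeta^{-n}\,dm(\zeta)$. A function $f$ is supported in $E$ if $f=0$ $m$-a.e. on $\mathbb{T}\setminus E$. *)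

theory Defs
  imports "HOL-Analysis.Analysis"
begin

abbreviation circle :: "complex set" where
  "circle \<equiv> sphere 0 1"

abbreviation circle_borel :: "complex measure" where
  "circle_borel \<equiv> restrict_space borel circle"

text \<open>The image of Lebesgue measure under the identification of \<open>[0,1)\<close> with the circle.\<close>

definition circle_measure :: "complex measure" where
  "circle_measure =
     distr (restrict_space lborel {0..<1}) circle_borel (\<lambda>t. cis (2 * pi * t))"

text \<open>A complex measure is a set function that is countably additive on the
  \<open>\<sigma>\<close>-algebra of \<open>M\<close>; finiteness is automatic.  Only the \<open>\<sigma>\<close>-algebra of \<open>M\<close> matters,
  and the values of \<open>\<mu>\<close> outside \<open>sets M\<close> are irrelevant in all definitions below.\<close>

definition complex_measure_on :: "'a measure \<Rightarrow> ('a set \<Rightarrow> complex) \<Rightarrow> bool" where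
  "complex_measure_on M \<mu> \<longleftrightarrow>
     \<mu> {} = 0 \<and>
     (\<forall>A. range A \<subseteq> sets M \<longrightarrow> disjoint_family A \<longrightarrow>
        (\<lambda>i::nat. \<mu> (A i)) sums \<mu> (\<Union>i. A i))"

text \<open>The positive part \<open>A \<mapsto> sup {\<nu> B | B \<subseteq> A}\<close> in the Jordan decomposition of a finite
  signed measure \<open>\<nu>\<close>.  Since \<open>ennreal\<close> sends negative reals to \<open>0\<close> and \<open>\<nu> {} = 0\<close>, the
  truncation does not change the supremum.  The negative part is the positive part of \<open>- \<nu>\<close>.\<close>

definition positive_variation :: "'a measure \<Rightarrow> ('a set \<Rightarrow> real) \<Rightarrow> 'a measure" where
  "positive_variation M \<nu> =
     measure_of (space M) (sets M) (\<lambda>A. SUP B\<in>{B \<in> sets M. B \<subseteq> A}. ennreal (\<nu> B))"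

definition complex_measure_integral ::
    "'a measure \<Rightarrow> ('a set \<Rightarrow> complex) \<Rightarrow> ('a \<Rightarrow> complex) \<Rightarrow> complex" where
  "complex_measure_integral M \<mu> f =
     ((LINT x|positive_variation M (\<lambda>A. Re (\<mu> A)). f x)
       - (LINT x|positive_variation M (\<lambda>A. - Re (\<mu> A)). f x))
     + \<i> * ((LINT x|positive_variation M (\<lambda>A. Im (\<mu> A)). f x)
       - (LINT x|positive_variation M (\<lambda>A. - Im (\<mu> A)). f x))"

text \<open>The closed support: the points all of whose open neighbourhoods are non-null for \<open>\<mu>\<close>.
  A set is null for a complex measure (equivalently, for its total variation) if all its
  measurable subsets have measure \<open>0\<close>.\<close>

definition complex_measure_support ::
    "'a::topological_space measure \<Rightarrow> ('a set \<Rightarrow> complex) \<Rightarrow> 'a set" where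
  "complex_measure_support M \<mu> =
     {x \<in> space M. \<forall>U. open U \<longrightarrow> x \<in> U \<longrightarrow> (\<exists>A\<in>sets M. A \<subseteq> U \<and> \<mu> A \<noteq> 0)}"

definition fourier_coeff_measure :: "(complex set \<Rightarrow> complex) \<Rightarrow> int \<Rightarrow> complex" where
  "fourier_coeff_measure \<mu> n = complex_measure_integral circle_borel \<mu> (\<lambda>z. z powi (- n))"

definition fourier_coeff :: "(complex \<Rightarrow> complex) \<Rightarrow> int \<Rightarrow> complex" where
  "fourier_coeff f n = (LINT z|circle_measure. f z * z powi (- n))"

text \<open>Membership in \<open>L\<^sup>\<infinity>\<close>, for functions rather than classes modulo null sets.\<close>

definition L_infinity :: "'a measure \<Rightarrow> ('a \<Rightarrow> complex) set" where
  "L_infinity M = {f \<in> borel_measurable M. \<exists>C::real. AE x in M. norm (f x) \<le> C}"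

end

theory Submission
  imports Defs "HOL-Complex_Analysis.Cauchy_Integral_Formula"
begin

text \<open>Everything is transported to the line: a function on the circle becomes a \<open>1\<close>-periodic function
of \<open>t\<close>, with \<open>turn t = exp (2 \<pi> i t)\<close> the point of the circle. The set \<open>E\<close> and the function \<open>f\<close> come
out of one infinite construction. Stage \<open>k\<close> deletes the open set \<open>comb N J b\<close> of those \<open>t\<close> for which
one of the numbers \<open>(N + j) t\<close>, \<open>j < J\<close>, lies within \<open>b\<close> of an integer; here \<open>J = D ^ k\<close>,
\<open>b = 1 / D ^ (k + 1)\<close>, \<open>N = D ^ (3 k + 2)\<close> for a parameter \<open>D\<close> that is chosen large. Since
\<open>J b = 1 / D\<close>, the deleted set has measure at most \<open>4 / D\<close>, and \<open>E\<close> is what remains in the end.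

\<^emph>\<open>No measure on E has summable coefficients.\<close> Let \<open>\<lambda>\<close> be the tent function of mean one supported
in the \<open>b\<close>-neighbourhood of the integers, and \<open>\<kappa>\<close> the average of the \<open>J\<close> functions
\<open>\<lambda> ((N + j) t)\<close>. It vanishes on \<open>E\<close> and has mean one. Its remaining coefficients are nonnegative
and add up to at most \<open>1 / b\<close>; each is at most \<open>1 / J\<close>, because the frequencies \<open>N + j\<close> are
nearly incommensurable (\<open>comb_multiplicity\<close>). If \<open>\<mu>\<close> lives on \<open>E\<close>, integrating \<open>\<kappa>\<close> against
\<open>\<mu>\<close> writes \<open>\<mu>^(n)\<close> as minus the sum of \<open>\<kappa>^(m) \<mu>^(n - m)\<close> over \<open>m \<noteq> 0\<close>. Splitting according to
whether \<open>|\<mu>^(n - m)|\<close> exceeds a threshold \<open>\<tau>\<close> bounds this by \<open>\<tau> / b + \<tau> powr (1 - q) * A / J\<close> with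
\<open>A\<close> the sum of all \<open>|\<mu>^(m)| powr q\<close> (\<open>fourier_coeff_measure_flat_bound\<close>). With \<open>\<tau> = 1 / D ^ (k + 2)\<close>
this is \<open>O(1 / D)\<close> as soon as \<open>k (2 - q) \<ge> 3\<close>, so all coefficients vanish and \<open>\<mu> = 0\<close>. The argument
is Katznelson's; that \<open>J\<close> outgrows every fixed power of the inverse measure of the deleted set is
what reaches all \<open>q < 2\<close>.

\<^emph>\<open>A bounded function on E with fast decay at positive frequencies.\<close> The function \<open>f\<close> is the limit of
functions \<open>F\<^sub>k\<close> vanishing near everything deleted so far. To pass to the next one, multiply \<open>F\<^sub>k\<close>
by a function \<open>G\<close> with spectrum in the nonpositive integers, \<open>|G| \<le> 1\<close> and \<open>|G| \<le> exp (- L)\<close> on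
the comb of twice the width (\<open>outer_barrier\<close>), replace the product by \<open>0\<close> on that comb, and average
\<open>K = k + 3\<close> times over intervals of half-width \<open>h\<close>. Cutting off changes the coefficients by at
most \<open>exp (- L)\<close>, and averaging multiplies the coefficient at \<open>n\<close> by at most \<open>1 / (n h) ^ K\<close>, so
\<open>exp (- L) = \<tau> h ^ K\<close> leaves an error of size \<open>\<tau> / n ^ k\<close>. The mean of \<open>G\<close> is
\<open>exp (- 300 b J L) = exp (- 300 L / D)\<close>, and \<open>L\<close> is only of order \<open>ln D\<close> because \<open>h\<close> is a power of
\<open>1 / D\<close>. Hence \<open>G\<close> is as close to \<open>1\<close> in mean as desired: \<open>F\<^sub>k G\<close> is close to \<open>F\<^sub>k\<close>, and so are
its positive coefficients, which only see \<open>F\<^sub>k\<close> at larger frequencies, where it decays.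

The two parts pull in opposite directions: the first wants many frequencies, the second wants small
ones. They are compatible because \<open>J\<close> and \<open>N\<close> can be powers of \<open>D\<close>, high enough for the first part,
while the second feels only their logarithm, which is negligible against \<open>D\<close>.\<close>

section \<open>Periodic functions on the line and their Fourier coefficients\<close>

abbreviation unit_leb :: "real measure" where
  "unit_leb \<equiv> restrict_space lborel {0..<1}"

definition turn :: "real \<Rightarrow> complex" where
  "turn x = cis (2 * pi * x)"

text \<open>The bound is carried explicitly because products, differences and averages of such functions are
formed throughout, and the final function has to be bounded uniformly in the stage.\<close>

definition bounded_periodic :: "real \<Rightarrow> (real \<Rightarrow> complex) \<Rightarrow> bool" where
  "bounded_periodic A F \<longleftrightarrow> F \<in> borel_measurable borel \<and> (\<forall>t. F (t + 1) = F t) \<and> (\<forall>t. norm (F t) \<le> A)"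

definition fcoeff :: "(real \<Rightarrow> complex) \<Rightarrow> int \<Rightarrow> complex" where
  "fcoeff F n = (LINT t|unit_leb. F t * turn (- (of_int n * t)))"

lemma turn_add: "turn (x + y) = turn x * turn y"
  by (simp add: turn_def cis_mult algebra_simps)

lemma turn_0 [simp]: "turn 0 = 1"
  by (simp add: turn_def)

lemma turn_of_int [simp]: "turn (of_int n) = 1"
  by (simp add: turn_def cis_multiple_2pi)

lemma turn_1 [simp]: "turn 1 = 1"
  using turn_of_int[of 1] by simp

lemma norm_turn [simp]: "norm (turn x) = 1"
  by (simp add: turn_def)

lemma turn_add_int: "turn (x + of_int n) = turn x"
  by (simp add: turn_add)

lemma turn_power: "turn x ^ n = turn (of_nat n * x)"
  unfolding turn_def Complex.DeMoivre by (simp add: mult_ac)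

lemma turn_powi: "turn x powi n = turn (of_int n * x)"
  by (simp add: turn_def cis_power_int algebra_simps)

lemma continuous_turn [continuous_intros]:
  "continuous_on S f \<Longrightarrow> continuous_on S (\<lambda>x. turn (f x))"
  unfolding turn_def by (intro continuous_intros)

lemma measurable_turn [measurable]: "turn \<in> borel_measurable borel"
  by (intro borel_measurable_continuous_onI continuous_intros)

text \<open>A chord is shorter than its arc.\<close>

lemma norm_turn_diff_le: "norm (turn x - turn y) \<le> 2 * pi * \<bar>x - y\<bar>"
proof -
  have "norm (turn x - turn y) = norm (turn y * (turn (x - y) - 1))"
    by (simp add: algebra_simps flip: turn_add)
  also have "\<dots> = norm (cis (2 * pi * (x - y)) - 1)"
    by (simp add: norm_mult turn_def)
  also have "\<dots> \<le> \<bar>2 * pi * (x - y)\<bar>"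
    using abs_sin_x_le_abs_x[of "pi * (x - y)"] dist_exp_i_1[of "2 * pi * (x - y)"]
    by (simp only: cis_conv_exp) (simp add: abs_mult)
  also have "\<dots> = 2 * pi * \<bar>x - y\<bar>" by (simp add: abs_mult)
  finally show ?thesis .
qed

lemma finite_measure_unit_leb: "finite_measure unit_leb"
  by (rule finite_measureI) (simp add: emeasure_restrict_space space_restrict_space)

lemma measure_unit_leb_space [simp]: "measure unit_leb (space unit_leb) = 1"
  by (simp add: measure_restrict_space space_restrict_space)

lemma measure_unit_leb_whole [simp]: "measure unit_leb {0..<1} = 1"
  by (simp add: measure_restrict_space)

lemma measure_unit_leb: "A \<in> sets borel \<Longrightarrow> A \<subseteq> {0..<1} \<Longrightarrow> measure unit_leb A = measure lborel A"
  by (simp add: measure_restrict_space)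

lemma borel_measurable_unit_leb:
  "F \<in> borel_measurable borel \<Longrightarrow> F \<in> borel_measurable unit_leb"
  by (simp add: measurable_restrict_space1)

lemma integrable_unit_leb:
  fixes F :: "real \<Rightarrow> 'a::{banach,second_countable_topology}"
  assumes "F \<in> borel_measurable borel" "\<And>t. norm (F t) \<le> A"
  shows "integrable unit_leb F"
  using assms
  by (intro finite_measure.integrable_const_bound[OF finite_measure_unit_leb, of _ A]
      borel_measurable_unit_leb) auto

lemma norm_integral_unit_leb_le:
  fixes F :: "real \<Rightarrow> 'a::{banach,second_countable_topology}"
  assumes "F \<in> borel_measurable borel" "\<And>t. norm (F t) \<le> A"
  shows "norm (LINT t|unit_leb. F t) \<le> A"
proof -
  have "norm (LINT t|unit_leb. F t) \<le> (LINT t|unit_leb. norm (F t))"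
    by simp
  also have "\<dots> \<le> (LINT t|unit_leb. A)"
    using assms by (intro integral_mono integrable_norm integrable_unit_leb[of _ A]
      finite_measure.integrable_const[OF finite_measure_unit_leb]) auto
  also have "\<dots> = A" by simp
  finally show ?thesis .
qed

lemma periodic_integrable: "bounded_periodic A F \<Longrightarrow> integrable unit_leb F"
  unfolding bounded_periodic_def by (auto intro: integrable_unit_leb)

lemma periodic_mult:
  assumes "bounded_periodic A F" "bounded_periodic B G"
  shows "bounded_periodic (A * B) (\<lambda>t. F t * G t)"
  using assms unfolding bounded_periodic_def
  by (auto simp: norm_mult intro!: mult_mono order_trans[OF norm_ge_zero, of "F _" A])

lemma periodic_diff:
  assumes "bounded_periodic A F" "bounded_periodic B G"
  shows "bounded_periodic (A + B) (\<lambda>t. F t - G t)"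
  using assms unfolding bounded_periodic_def
  by (auto intro!: order_trans[OF norm_triangle_ineq4] add_mono)

lemma periodic_turn: "bounded_periodic 1 (\<lambda>t. turn (of_int n * t))"
  unfolding bounded_periodic_def
  by (auto simp: ring_distribs turn_add_int)

lemma periodic_turn': "bounded_periodic 1 (\<lambda>t. turn (- (of_int n * t)))"
  using periodic_turn[of "-n"] by simp

lemma periodic_fcoeff_integrand:
  "bounded_periodic A F \<Longrightarrow> bounded_periodic A (\<lambda>t. F t * turn (- (of_int n * t)))"
  using periodic_mult[OF _ periodic_turn'] by fastforce

lemma norm_fcoeff_le: "bounded_periodic A F \<Longrightarrow> norm (fcoeff F n) \<le> A"
  unfolding fcoeff_def using periodic_fcoeff_integrand[of A F n]
  by (intro norm_integral_unit_leb_le) (auto simp: bounded_periodic_def)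

lemma norm_fcoeff_le_integral: "norm (fcoeff F n) \<le> (LINT t|unit_leb. norm (F t))"
proof -
  have "norm (fcoeff F n) \<le> (LINT t|unit_leb. norm (F t * turn (- (of_int n * t))))"
    unfolding fcoeff_def by simp
  then show ?thesis by (simp add: norm_mult)
qed

lemma fcoeff_diff:
  assumes "bounded_periodic A F" "bounded_periodic B G"
  shows "fcoeff (\<lambda>t. F t - G t) n = fcoeff F n - fcoeff G n"
  unfolding fcoeff_def using periodic_integrable[OF periodic_fcoeff_integrand] assms
  by (subst Bochner_Integration.integral_diff[symmetric]) (auto simp: algebra_simps)

text \<open>The window \<open>[s, 1 + s)\<close> is \<open>[s, 1)\<close> followed by \<open>[1, 1 + s)\<close>, and periodicity moves the second piece
back to \<open>[0, s)\<close>.\<close>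

lemma integral_shift_small:
  assumes F: "bounded_periodic A F" and s: "0 \<le> s" "s \<le> 1"
  shows "(LINT t|unit_leb. F (t + s)) = (LINT t|unit_leb. F t)"
proof -
  have [measurable]: "F \<in> borel_measurable borel" and per: "\<And>t. F (t + 1) = F t"
    and bd: "\<And>t. norm (F t) \<le> A"
    using F by (auto simp: bounded_periodic_def)
  have int: "set_integrable lborel {a..<b} F" for a b :: real
  proof -
    have "set_integrable lborel {a..b} F"
      unfolding set_integrable_def
      by (rule integrableI_bounded_set[where A="{a..b}" and B=A]) (auto simp: bd emeasure_lborel_Icc_eq)
    then show ?thesis
      by (rule set_integrable_subset) auto
  qed
  have tr: "(LINT t:{a..<b}|lborel. F (t + s)) = (LINT t:{a+s..<b+s}|lborel. F t)" for a b s
    unfolding set_lebesgue_integral_def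
    by (subst (2) lborel_integral_real_affine[where c=1 and t=s])
       (auto simp: add.commute indicator_def intro!: Bochner_Integration.integral_cong)
  have "(LINT t|unit_leb. F (t + s)) = (LINT t:{0..<1}|lborel. F (t + s))"
    by (simp add: integral_restrict_space set_lebesgue_integral_def)
  also have "\<dots> = (LINT t:{s..<1+s}|lborel. F t)"
    using tr[of 0 1 s] by simp
  also have "{s..<1+s} = {s..<1} \<union> {1..<1+s}" using s by auto
  also have "(LINT t:{s..<1} \<union> {1..<1+s}|lborel. F t)
      = (LINT t:{s..<1}|lborel. F t) + (LINT t:{1..<1+s}|lborel. F t)"
    by (rule set_integral_Un) (auto simp: int)
  also have "(LINT t:{1..<1+s}|lborel. F t) = (LINT t:{0..<s}|lborel. F t)"
    using tr[of 0 s 1] by (simp add: per add.commute)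
  also have "(LINT t:{s..<1}|lborel. F t) + (LINT t:{0..<s}|lborel. F t) = (LINT t:{0..<s} \<union> {s..<1}|lborel. F t)"
    by (subst set_integral_Un) (auto simp: int)
  also have "{0..<s} \<union> {s..<1} = {0..<1}" using s by auto
  also have "(LINT t:{0..<1}|lborel. F t) = (LINT t|unit_leb. F t)"
    by (simp add: integral_restrict_space set_lebesgue_integral_def)
  finally show ?thesis .
qed

lemma periodic_shift: "bounded_periodic A F \<Longrightarrow> bounded_periodic A (\<lambda>t. F (t + s))"
proof -
  assume F: "bounded_periodic A F"
  then have [measurable]: "F \<in> borel_measurable borel" by (simp add: bounded_periodic_def)
  have "F (t + 1 + s) = F (t + s)" for t
  proof -
    have "F ((t + s) + 1) = F (t + s)" using F unfolding bounded_periodic_def by blast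
    then show ?thesis by (simp add: algebra_simps)
  qed
  then show ?thesis using F by (auto simp: bounded_periodic_def)
qed

lemma integral_shift:
  assumes F: "bounded_periodic A F" and s: "\<bar>s\<bar> \<le> 1"
  shows "(LINT t|unit_leb. F (t + s)) = (LINT t|unit_leb. F t)"
proof (cases "0 \<le> s")
  case True
  then show ?thesis using integral_shift_small[OF F] s by simp
next
  case False
  then show ?thesis
    using integral_shift_small[OF periodic_shift[OF F, of s], of "-s"] s by simp
qed

lemma fcoeff_shift:
  assumes F: "bounded_periodic A F" and s: "\<bar>s\<bar> \<le> 1"
  shows "fcoeff (\<lambda>t. F (t + s)) n = turn (of_int n * s) * fcoeff F n"
proof -
  have "fcoeff (\<lambda>t. F (t + s)) n
      = (LINT t|unit_leb. turn (of_int n * s) * (F (t + s) * turn (- (of_int n * (t + s)))))"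
    unfolding fcoeff_def
  proof (rule Bochner_Integration.integral_cong)
    fix t :: real
    have "turn (- (of_int n * t)) = turn (of_int n * s) * turn (- (of_int n * (t + s)))"
      by (simp add: algebra_simps flip: turn_add)
    then show "F (t + s) * turn (- (of_int n * t))
        = turn (of_int n * s) * (F (t + s) * turn (- (of_int n * (t + s))))"
      by simp
  qed simp
  also have "\<dots> = turn (of_int n * s) * (LINT t|unit_leb. (F (t + s) * turn (- (of_int n * (t + s)))))"
    by simp
  also have "(LINT t|unit_leb. (F (t + s) * turn (- (of_int n * (t + s))))) = fcoeff F n"
    unfolding fcoeff_def by (rule integral_shift[OF periodic_fcoeff_integrand[OF F] s])
  finally show ?thesis .
qed

section \<open>Box averages\<close>

definition box_avg :: "real \<Rightarrow> (real \<Rightarrow> complex) \<Rightarrow> real \<Rightarrow> complex" where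
  "box_avg h F t = (LINT s|restrict_space lborel {-h..h}. F (t + s)) /\<^sub>R (2 * h)"

text \<open>The Fourier coefficient of the normalised indicator of \<open>[-h, h]\<close>, that is, the factor by which a
box average multiplies coefficients.\<close>

definition box_sinc :: "real \<Rightarrow> int \<Rightarrow> real" where
  "box_sinc h n = (if n = 0 then 1 else sin (2 * pi * of_int n * h) / (2 * pi * of_int n * h))"

lemma finite_measure_box: "finite_measure (restrict_space lborel {-h..h::real})"
  by (rule finite_measureI) (simp add: emeasure_restrict_space space_restrict_space emeasure_lborel_Icc_eq)

lemma integrable_box:
  fixes F :: "real \<Rightarrow> complex"
  assumes "F \<in> borel_measurable borel" "\<And>t. norm (F t) \<le> A"
  shows "integrable (restrict_space lborel {-h..h}) F"
  using assms
  by (intro finite_measure.integrable_const_bound[OF finite_measure_box, of F A])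
     (auto simp: measurable_restrict_space1)

lemma integral_turn_box:
  assumes "0 < h"
  shows "(LINT s|restrict_space lborel {-h..h}. turn (of_int n * s)) = of_real (2 * h * box_sinc h n)"
proof (cases "n = 0")
  case True
  then show ?thesis using assms
    by (simp add: box_sinc_def measure_restrict_space space_restrict_space scaleR_conv_of_real)
next
  case False
  let ?c = "2 * pi * of_int n :: real"
  have "(LINT s|restrict_space lborel {-h..h}. turn (of_int n * s))
     = (LINT s|lborel. indicator {-h..h} s *\<^sub>R cis (?c * s))"
    by (simp add: integral_restrict_space turn_def algebra_simps)
  also have "\<dots> = cis (?c * h) / (\<i> * of_real ?c) - cis (?c * (-h)) / (\<i> * of_real ?c)"
  proof (rule integral_FTC_Icc)
    show "-h \<le> h" using assms by simp
    fix x :: real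
    show "((\<lambda>x. cis (?c * x) / (\<i> * of_real ?c)) has_vector_derivative cis (?c * x)) (at x within {-h..h})"
      using False unfolding has_vector_derivative_def
      by (auto intro!: derivative_eq_intros ext simp: field_simps scaleR_conv_of_real cis_conv_exp[symmetric])
  qed (intro continuous_intros)
  also have "\<dots> = of_real (2 * sin (?c * h) / ?c)"
  proof -
    have "cis (?c * h) - cis (?c * (- h)) = 2 * \<i> * of_real (sin (?c * h))"
      by (simp add: complex_eq_iff)
    then have "cis (?c * h) / (\<i> * of_real ?c) - cis (?c * (-h)) / (\<i> * of_real ?c)
        = 2 * \<i> * of_real (sin (?c * h)) / (\<i> * of_real ?c)"
      by (metis diff_divide_distrib)
    then show ?thesis by simp
  qed
  also have "\<dots> = of_real (2 * h * box_sinc h n)"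
    using assms False by (simp add: box_sinc_def field_simps)
  finally show ?thesis .
qed

text \<open>By Fubini a box average is an average of translates, and a translate multiplies the coefficient by
a character.\<close>

lemma fcoeff_box_avg:
  assumes F: "bounded_periodic A F" and h: "0 < h" "h \<le> 1"
  shows "fcoeff (box_avg h F) n = of_real (box_sinc h n) * fcoeff F n"
proof -
  have [measurable]: "F \<in> borel_measurable borel" and bd: "\<And>t. norm (F t) \<le> A"
    using F by (auto simp: bounded_periodic_def)
  have A: "A \<ge> 0" using bd norm_ge_zero order_trans by blast
  let ?B = "restrict_space lborel {-h..h}"
  interpret U: finite_measure unit_leb by (rule finite_measure_unit_leb)
  interpret B: finite_measure ?B by (rule finite_measure_box)
  interpret P: pair_sigma_finite unit_leb ?B ..
  interpret PF: finite_measure "unit_leb \<Otimes>\<^sub>M ?B"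
    by (intro finite_measure_pair_measure finite_measure_unit_leb finite_measure_box)
  have m1: "fst \<in> (unit_leb \<Otimes>\<^sub>M ?B) \<rightarrow>\<^sub>M (borel :: real measure)"
           "snd \<in> (unit_leb \<Otimes>\<^sub>M ?B) \<rightarrow>\<^sub>M (borel :: real measure)"
    using measurable_fst[of unit_leb ?B] measurable_snd[of unit_leb ?B] 
     by (auto simp: measurable_restrict_space2_iff)
  have int: "integrable (unit_leb \<Otimes>\<^sub>M ?B) (\<lambda>(t, s). F (t + s) * turn (- (of_int n * t)))"
    using m1 bd
    by (intro PF.integrable_const_bound[of _ A]) (auto simp: split_beta norm_mult)
  have "of_real (2 * h) * fcoeff (box_avg h F) n
      = (LINT t|unit_leb. (LINT s|?B. F (t + s) * turn (- (of_int n * t))))"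
  proof -
    have eq: "box_avg h F t = (LINT s|?B. F (t + s)) / of_real (2 * h)" for t
      unfolding box_avg_def by (simp add: scaleR_conv_of_real divide_simps)
    have "fcoeff (box_avg h F) n
        = (LINT t|unit_leb. (LINT s|?B. F (t + s) * turn (- (of_int n * t))) / of_real (2 * h))"
      unfolding fcoeff_def eq by simp
    also have "\<dots> = (LINT t|unit_leb. (LINT s|?B. F (t + s) * turn (- (of_int n * t)))) / of_real (2 * h)"
      by (rule integral_divide_zero)
    finally show ?thesis using h by simp
  qed
  also have "\<dots> = (LINT s|?B. (LINT t|unit_leb. F (t + s) * turn (- (of_int n * t))))"
    by (rule P.Fubini_integral[symmetric]) (use int in simp)
  also have "\<dots> = (LINT s|?B. turn (of_int n * s) * fcoeff F n)"
    using fcoeff_shift[OF F, of _ n] h unfolding fcoeff_def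
    by (intro Bochner_Integration.integral_cong) (auto simp: space_restrict_space)
  also have "\<dots> = of_real (2 * h * box_sinc h n) * fcoeff F n"
    by (simp add: integral_turn_box[OF h(1)])
  finally have "of_real (2 * h) * fcoeff (box_avg h F) n = of_real (2 * h) * (of_real (box_sinc h n) * fcoeff F n)"
    by simp
  then show ?thesis using h by simp
qed

text \<open>The averages at two points differ only by the integrals over the two end pieces that the windows
do not share. This holds without any regularity of \<open>F\<close>: averaging creates regularity.\<close>

lemma box_avg_lipschitz:
  assumes F: "bounded_periodic A F" and h: "0 < h"
  shows "norm (box_avg h F t - box_avg h F t') \<le> A / h * \<bar>t - t'\<bar>"
proof -
  have [measurable]: "F \<in> borel_measurable borel" and bd: "\<And>t. norm (F t) \<le> A"
    using F by (auto simp: bounded_periodic_def)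
  have A: "A \<ge> 0" using bd norm_ge_zero order_trans by blast
  have intg: "integrable lborel (\<lambda>x. indicator {t-h..t+h} x *\<^sub>R F x)" for t
    by (rule integrableI_bounded_set[where A="{t-h..t+h}" and B=A])
       (auto simp: bd A emeasure_lborel_Icc_eq indicator_def)
  have eq: "of_real (2 * h) * box_avg h F t = (LINT x|lborel. indicator {t-h..t+h} x *\<^sub>R F x)" for t
  proof -
    have "of_real (2 * h) * box_avg h F t = (LINT s|lborel. indicator {-h..h} s *\<^sub>R F (t + s))"
      using h by (simp add: box_avg_def integral_restrict_space scaleR_conv_of_real)
    also have "\<dots> = (LINT x|lborel. indicator {t-h..t+h} x *\<^sub>R F x)"
      by (subst (2) lborel_integral_real_affine[where c=1 and t=t])
         (auto simp: indicator_def intro!: Bochner_Integration.integral_cong)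
    finally show ?thesis .
  qed
  have main: "2 * h * norm (box_avg h F t - box_avg h F t') \<le> A * 2 * (t' - t)" if "t \<le> t'" for t t'
  proof -
    let ?f = "\<lambda>x. indicator {t-h..t+h} x *\<^sub>R F x - indicator {t'-h..t'+h} x *\<^sub>R F x"
    let ?g = "\<lambda>x. A * indicator {t-h..t'-h} x + A * indicator {t+h..t'+h} x :: real"
    have "2 * h * norm (box_avg h F t - box_avg h F t')
        = norm (of_real (2 * h) * box_avg h F t - of_real (2 * h) * box_avg h F t')"
      using h by (simp add: norm_mult flip: right_diff_distrib)
    also have "\<dots> = norm (LINT x|lborel. ?f x)"
      using intg by (simp only: eq Bochner_Integration.integral_diff)
    also have "\<dots> \<le> (LINT x|lborel. norm (?f x))"
      by simp
    also have "\<dots> \<le> (LINT x|lborel. ?g x)"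
    proof (rule integral_mono)
      show "integrable lborel (\<lambda>x. norm (?f x))"
        by (intro integrable_norm Bochner_Integration.integrable_diff intg)
      show "integrable lborel ?g"
        by (intro Bochner_Integration.integrable_add integrable_mult_right integrable_real_indicator)
           (auto simp: emeasure_lborel_Icc_eq)
      show "norm (?f x) \<le> ?g x" for x
        using bd[of x] A that by (auto simp: indicator_def)
    qed
    also have "\<dots> = A * 2 * (t' - t)"
      using that by (subst Bochner_Integration.integral_add)
         (auto simp: emeasure_lborel_Icc_eq algebra_simps)
    finally show ?thesis .
  qed
  have "h * norm (box_avg h F t - box_avg h F t') \<le> A * \<bar>t - t'\<bar>"
    using main[of t t'] main[of t' t] by (cases "t \<le> t'") (auto simp: norm_minus_commute)
  then show ?thesis using h by (simp add: field_simps)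
qed

lemma periodic_box_avg:
  assumes F: "bounded_periodic A F" and h: "0 < h"
  shows "bounded_periodic A (box_avg h F)"
proof -
  have [measurable]: "F \<in> borel_measurable borel" and bd: "\<And>t. norm (F t) \<le> A"
    and per: "\<And>t. F (t + 1) = F t"
    using F by (auto simp: bounded_periodic_def)
  have A: "A \<ge> 0" using bd norm_ge_zero order_trans by blast
  have "continuous_on UNIV (box_avg h F)"
    by (rule lipschitz_on_continuous_on[where L="A / h"], rule lipschitz_onI)
       (use box_avg_lipschitz[OF F h] A h in \<open>auto simp: dist_norm\<close>)
  moreover have "box_avg h F (t + 1) = box_avg h F t" for t
  proof -
    have "F (t + 1 + s) = F (t + s)" for s using per[of "t + s"] by (simp add: algebra_simps)
    then show ?thesis by (simp add: box_avg_def)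
  qed
  moreover have "norm (box_avg h F t) \<le> A" for t
  proof -
    let ?B = "restrict_space lborel {-h..h}"
    have "norm (LINT s|?B. F (t + s)) \<le> (LINT s|?B. norm (F (t + s)))"
      by simp
    also have "\<dots> \<le> (LINT s|?B. A)"
      using bd by (intro integral_mono integrable_norm integrable_box[of _ A]
          finite_measure.integrable_const[OF finite_measure_box]) auto
    also have "\<dots> = 2 * h * A"
      using h by (simp add: measure_restrict_space space_restrict_space)
    finally show ?thesis using h by (simp add: box_avg_def field_simps)
  qed
  ultimately show ?thesis
    by (auto simp: bounded_periodic_def intro: borel_measurable_continuous_onI)
qed

lemma box_avg_eq_0:
  assumes "\<And>s. \<bar>s\<bar> \<le> h \<Longrightarrow> F (t + s) = 0"
  shows "box_avg h F t = 0"
proof -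
  have "(LINT s|restrict_space lborel {-h..h}. F (t + s)) = (LINT s|restrict_space lborel {-h..h}. 0)"
    by (intro Bochner_Integration.integral_cong) (auto simp: assms space_restrict_space abs_le_iff)
  then show ?thesis by (simp add: box_avg_def)
qed

lemma norm_box_avg_le:
  assumes F: "bounded_periodic A F" and h: "0 < h"
  shows "norm (box_avg h F t) \<le> Re (box_avg h (\<lambda>t. of_real (norm (F t))) t)"
proof -
  have "norm (LINT s|restrict_space lborel {-h..h}. F (t + s))
      \<le> (LINT s|restrict_space lborel {-h..h}. norm (F (t + s)))"
    by simp
  then show ?thesis using h by (simp add: box_avg_def divide_simps)
qed

lemma box_avg_diff:
  assumes F: "bounded_periodic A F" and G: "bounded_periodic B G"
  shows "box_avg h (\<lambda>t. F t - G t) t = box_avg h F t - box_avg h G t"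
proof -
  have "integrable (restrict_space lborel {-h..h}) (\<lambda>s. F (t + s))"
       "integrable (restrict_space lborel {-h..h}) (\<lambda>s. G (t + s))"
    using F G by (auto simp: bounded_periodic_def intro!: integrable_box)
  then show ?thesis
    by (simp add: box_avg_def Bochner_Integration.integral_diff scaleR_diff_right)
qed

text \<open>An average is dominated by the average of the absolute value, and averaging preserves the mean,
which is the coefficient at \<open>0\<close>.\<close>

lemma box_avg_L1_contraction:
  assumes F: "bounded_periodic A F" and h: "0 < h" "h \<le> 1"
  shows "(LINT t|unit_leb. norm (box_avg h F t)) \<le> (LINT t|unit_leb. norm (F t))"
proof -
  let ?N = "\<lambda>t. of_real (norm (F t)) :: complex"
  have N: "bounded_periodic A ?N"
    using F by (auto simp: bounded_periodic_def)
  note BN = periodic_box_avg[OF N h(1)]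
  have "(LINT t|unit_leb. norm (box_avg h F t)) \<le> (LINT t|unit_leb. Re (box_avg h ?N t))"
    using norm_box_avg_le[OF F h(1)] periodic_box_avg[OF F h(1)] BN
    by (intro integral_mono integrable_norm integrable_Re periodic_integrable) auto
  also have "\<dots> = Re (fcoeff (box_avg h ?N) 0)"
    using periodic_integrable[OF BN] by (simp add: fcoeff_def)
  also have "\<dots> = Re (fcoeff ?N 0)"
    by (simp add: fcoeff_box_avg[OF N h] box_sinc_def)
  also have "\<dots> = (LINT t|unit_leb. norm (F t))"
    by (simp add: fcoeff_def)
  finally show ?thesis .
qed

lemma norm_box_avg_minus_le:
  assumes F: "bounded_periodic A F" and h: "0 < h"
    and lip: "\<And>s. \<bar>s\<bar> \<le> h \<Longrightarrow> norm (F (t + s) - F t) \<le> e"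
  shows "norm (box_avg h F t - F t) \<le> e"
proof -
  let ?B = "restrict_space lborel {-h..h}"
  have [measurable]: "F \<in> borel_measurable borel" and bd: "\<And>t. norm (F t) \<le> A"
    using F by (auto simp: bounded_periodic_def)
  have i1: "integrable ?B (\<lambda>s. F (t + s))"
    using bd by (intro integrable_box[of _ A]) auto
  have box: "measure ?B {-h..h} = 2 * h"
    using h by (simp add: measure_restrict_space)
  have i2: "integrable ?B (\<lambda>s. F t)" "integrable ?B (\<lambda>s. e)"
    by (rule finite_measure.integrable_const[OF finite_measure_box])+
  have c: "(LINT s|?B. F t) = (2 * h) *\<^sub>R F t" "(LINT s|?B. e) = 2 * h * e"
    using h by (simp_all add: measure_restrict_space space_restrict_space box)
  have eq: "box_avg h F t - F t = (LINT s|?B. F (t + s) - F t) /\<^sub>R (2 * h)"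
    unfolding box_avg_def Bochner_Integration.integral_diff[OF i1 i2(1)] c
    using h by (simp add: scaleR_diff_right)
  have "norm (LINT s|?B. F (t + s) - F t) \<le> (LINT s|?B. norm (F (t + s) - F t))"
    by simp
  also have "\<dots> \<le> (LINT s|?B. e)"
    using lip i1 i2 by (intro integral_mono_AE integrable_norm Bochner_Integration.integrable_diff)
      (auto intro!: AE_I2 simp: space_restrict_space abs_le_iff)
  also have "\<dots> = 2 * h * e" by (rule c(2))
  finally have le: "norm (LINT s|?B. F (t + s) - F t) \<le> 2 * h * e" .
  have "x / (2 * h) \<le> e" if "x \<le> 2 * h * e" for x
    using that h by (simp add: field_simps)
  from this[OF le] have "norm (LINT s|?B. F (t + s) - F t) / (2 * h) \<le> e" .
  moreover have "norm (x /\<^sub>R (2 * h)) = norm x / (2 * h)" for x :: complex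
    using h by (simp add: field_simps)
  ultimately show ?thesis by (simp only: eq)
qed

lemma abs_box_sinc_le_1: "\<bar>box_sinc h n\<bar> \<le> 1"
proof (cases "2 * pi * of_int n * h = 0")
  case True
  then show ?thesis by (auto simp: box_sinc_def)
next
  case False
  then show ?thesis using abs_sin_x_le_abs_x[of "2 * pi * of_int n * h"]
    by (simp add: box_sinc_def divide_le_eq_1 abs_divide)
qed

lemma abs_box_sinc_le:
  assumes "n \<noteq> 0" "0 < h"
  shows "\<bar>box_sinc h n\<bar> \<le> 1 / (2 * \<bar>of_int n\<bar> * h)"
proof -
  have "2 * \<bar>of_int n\<bar> * h \<le> \<bar>2 * pi * of_int n * h\<bar>"
    using assms pi_gt3 by (simp add: abs_mult)
  moreover have "2 * \<bar>of_int n\<bar> * h > 0" using assms by simp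
  ultimately have "\<bar>sin (2 * pi * of_int n * h)\<bar> / \<bar>2 * pi * of_int n * h\<bar> \<le> 1 / (2 * \<bar>of_int n\<bar> * h)"
    by (intro frac_le) auto
  then show ?thesis using assms by (simp add: box_sinc_def abs_divide)
qed

text \<open>The multiplier at \<open>n\<close> is the box average of a character at the origin, where the character has the
value one.\<close>

lemma abs_box_sinc_minus_1_le:
  assumes h: "0 < h"
  shows "\<bar>box_sinc h n - 1\<bar> \<le> 2 * pi * \<bar>of_int n\<bar> * h"
proof -
  let ?F = "\<lambda>s. turn (of_int n * s)"
  have eq: "box_avg h ?F 0 = of_real (box_sinc h n)"
    using h unfolding box_avg_def by (simp add: integral_turn_box scaleR_conv_of_real)
  have "norm (box_avg h ?F 0 - ?F 0) \<le> 2 * pi * \<bar>of_int n\<bar> * h"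
  proof (rule norm_box_avg_minus_le[OF periodic_turn h])
    fix s :: real assume "\<bar>s\<bar> \<le> h"
    then have "2 * pi * \<bar>of_int n * s\<bar> \<le> 2 * pi * \<bar>of_int n\<bar> * h"
      by (simp add: abs_mult mult_left_mono)
    with norm_turn_diff_le[of "of_int n * s" 0]
    have "norm (turn (of_int n * s) - turn 0) \<le> 2 * pi * \<bar>of_int n\<bar> * h"
      unfolding diff_zero by (rule order_trans)
    then show "norm (?F (0 + s) - ?F 0) \<le> 2 * pi * \<bar>of_int n\<bar> * h"
      by simp
  qed
  then have "norm (of_real (box_sinc h n - 1) :: complex) \<le> 2 * pi * \<bar>of_int n\<bar> * h"
    unfolding eq by simp
  then show ?thesis unfolding norm_of_real .
qed

section \<open>Density of trigonometric polynomials and Fourier inversion\<close>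

inductive trig_poly :: "(complex \<Rightarrow> complex) \<Rightarrow> bool" where
  monomial: "trig_poly (\<lambda>z. c * z powi n)"
| add: "trig_poly f \<Longrightarrow> trig_poly g \<Longrightarrow> trig_poly (\<lambda>z. f z + g z)"

lemma trig_poly_const: "trig_poly (\<lambda>z. c)"
  using trig_poly.monomial[of c 0] by simp

lemma trig_poly_mult:
  assumes "trig_poly f" "trig_poly g"
  shows "\<exists>h. trig_poly h \<and> (\<forall>z\<in>circle. f z * g z = h z)"
  using assms(1)
proof induction
  case f: (monomial c n)
  show ?case using assms(2)
  proof induction
    case (monomial d m)
    have "c * z powi n * (d * z powi m) = (c * d) * z powi (n + m)" if "z \<in> circle" for z
    proof -
      have "z \<noteq> 0" using that by auto
      then show ?thesis by (simp add: power_int_add)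
    qed
    then show ?case using trig_poly.monomial[of "c * d" "n + m"] by blast
  next
    case (add g1 g2)
    then obtain h1 h2 where "trig_poly h1" "trig_poly h2"
      "\<forall>z\<in>circle. c * z powi n * g1 z = h1 z" "\<forall>z\<in>circle. c * z powi n * g2 z = h2 z" by blast
    then show ?case
      by (intro exI[of _ "\<lambda>z. h1 z + h2 z"]) (auto simp: distrib_left intro: trig_poly.add)
  qed
next
  case (add f1 f2)
  then obtain h1 h2 where "trig_poly h1" "trig_poly h2"
    "\<forall>z\<in>circle. f1 z * g z = h1 z" "\<forall>z\<in>circle. f2 z * g z = h2 z" by blast
  then show ?case
    by (intro exI[of _ "\<lambda>z. h1 z + h2 z"]) (auto simp: distrib_right intro: trig_poly.add)
qed

text \<open>On the circle \<open>inverse z = cnj z\<close>, so a real-linear form in \<open>z\<close> is a combination of \<open>z\<close> and \<open>inverse z\<close>.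
This lets the Stone-Weierstrass theorem for real polynomials speak about trigonometric ones.\<close>

lemma real_polynomial_trig_poly:
  assumes "real_polynomial_function (f :: complex \<Rightarrow> real)"
  shows "\<exists>h. trig_poly h \<and> (\<forall>z\<in>circle. of_real (f z) = h z)"
  using assms
proof induction
  case (linear f)
  then interpret bounded_linear f .
  let ?h = "\<lambda>z. (of_real (f 1) - \<i> * of_real (f \<i>)) / 2 * z powi 1 + (of_real (f 1) + \<i> * of_real (f \<i>)) / 2 * z powi (-1)"
  have "of_real (f z) = ?h z" if z: "z \<in> circle" for z
  proof -
    have "z = Re z *\<^sub>R 1 + Im z *\<^sub>R \<i>"
      by (simp add: complex_eq_iff)
    then have "f z = f (Re z *\<^sub>R 1 + Im z *\<^sub>R \<i>)" by (rule arg_cong)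
    also have "\<dots> = Re z * f 1 + Im z * f \<i>"
      by (simp only: add scaleR) simp
    finally have fz: "f z = Re z * f 1 + Im z * f \<i>" .
    have "z * cnj z = 1"
      using z by (simp add: complex_norm_square[symmetric])
    then have "inverse z = cnj z"
      using inverse_unique by blast
    then have cz: "z powi (-1) = cnj z" by (simp add: power_int_minus)
    show ?thesis
      unfolding fz cz by (simp add: complex_eq_iff field_simps)
  qed
  moreover have "trig_poly ?h" by (intro trig_poly.intros)
  ultimately show ?case by blast
next
  case (const c)
  then show ?case using trig_poly_const by blast
next
  case (add f g)
  then obtain h1 h2 where "trig_poly h1" "trig_poly h2"
    "\<forall>z\<in>circle. of_real (f z) = h1 z" "\<forall>z\<in>circle. of_real (g z) = h2 z" by blast
  then show ?case
    by (intro exI[of _ "\<lambda>z. h1 z + h2 z"]) (auto intro: trig_poly.add)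
next
  case (mult f g)
  then obtain h1 h2 where h: "trig_poly h1" "trig_poly h2"
    "\<forall>z\<in>circle. of_real (f z) = h1 z" "\<forall>z\<in>circle. of_real (g z) = h2 z" by blast
  then show ?case
    using trig_poly_mult[OF h(1,2)] by auto
qed

lemma trig_poly_dense:
  fixes f :: "complex \<Rightarrow> real"
  assumes "continuous_on circle f" "0 < e"
  obtains p where "trig_poly p" "\<And>z. z \<in> circle \<Longrightarrow> norm (of_real (f z) - p z) < e"
proof -
  obtain g where g: "real_polynomial_function g" "\<And>x. x \<in> circle \<Longrightarrow> \<bar>f x - g x\<bar> < e"
    using Stone_Weierstrass_real_polynomial_function[OF compact_sphere assms] by blast
  obtain p where p: "trig_poly p" "\<forall>z\<in>circle. of_real (g z) = p z"
    using real_polynomial_trig_poly[OF g(1)] by blast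
  have "norm (of_real (f z) - p z) < e" if "z \<in> circle" for z
  proof -
    have "norm (of_real (f z) - p z) = norm (of_real (f z - g z) :: complex)"
      using p(2) that by simp
    then show ?thesis using g(2)[OF that] by (simp only: norm_of_real)
  qed
  with p(1) that show ?thesis by blast
qed

lemma periodic_add_int:
  assumes "\<And>t. F (t + 1) = F (t::real)"
  shows "F (t + of_int n) = F t"
proof (induction n)
  case (nonneg m)
  show ?case
  proof (induction m)
    case (Suc m)
    then show ?case using assms[of "t + real m"] by (simp add: algebra_simps)
  qed simp
next
  case (neg m)
  have "F (t - real m) = F t" for m
  proof (induction m)
    case (Suc m)
    then show ?case using assms[of "t - 1 - real m"] by (simp add: algebra_simps)
  qed simp
  from this[of "Suc m"] show ?case by (simp add: algebra_simps)
qed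

lemma periodic_frac:
  assumes "\<And>t. F (t + 1) = F (t::real)"
  shows "F (frac t) = F t"
  using periodic_add_int[of F "frac t" "\<lfloor>t\<rfloor>", OF assms] by (simp add: frac_def)

lemma periodic_Arg:
  assumes "\<And>t. F (t + 1) = F (t::real)"
  shows "F (Arg (turn t) / (2 * pi)) = F t"
proof -
  have "cis (Arg (turn t)) = cis (2 * pi * t)"
    using cis_Arg[of "turn t"] by (simp add: sgn_eq turn_def)
  then obtain n where "\<i> * of_real (Arg (turn t)) = \<i> * of_real (2 * pi * t) + (of_int (2 * n) * pi) * \<i>"
    unfolding cis_conv_exp exp_eq by blast
  then have "Im (\<i> * of_real (Arg (turn t))) = Im (\<i> * of_real (2 * pi * t) + (of_int (2 * n) * pi) * \<i>)"
    by (rule arg_cong)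
  then have "Arg (turn t) = 2 * pi * t + 2 * pi * of_int n"
    by simp
  then have "Arg (turn t) / (2 * pi) = t + of_int n"
    by (simp add: field_simps)
  then show ?thesis using periodic_add_int[of F, OF assms] by simp
qed

lemma turn_Arg: "z \<in> circle \<Longrightarrow> turn (Arg z / (2 * pi)) = z"
  using cis_Arg[of z] by (cases "z = 0") (auto simp: turn_def sgn_eq)

text \<open>The branch cut of \<open>Arg\<close> is harmless for a periodic function: near it \<open>Arg\<close> may be replaced by
\<open>Arg2pi\<close>, which differs by a multiple of \<open>2 \<pi>\<close> and is continuous there.\<close>

lemma continuous_periodic_on_circle:
  fixes F :: "real \<Rightarrow> 'a::topological_space"
  assumes F: "continuous_on UNIV F" and per: "\<And>t. F (t + 1) = F t"
  shows "continuous_on circle (\<lambda>z. F (Arg z / (2 * pi)))"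
proof -
  have cF: "isCont F t" for t
    using F by (simp add: continuous_on_eq_continuous_at)
  have eq: "F (Arg2pi z / (2 * pi)) = F (Arg z / (2 * pi))" for z
  proof (cases "z = 0")
    case False
    have "cis (Arg2pi z) = sgn z"
      using Arg2pi_eq[of z] False by (simp add: sgn_eq cis_conv_exp field_simps)
    then have "turn (Arg2pi z / (2 * pi)) = turn (Arg z / (2*pi))"
      using cis_Arg[of z] False by (simp add: turn_def)
    then show ?thesis
      using periodic_Arg[of F "Arg2pi z / (2 * pi)", OF per] periodic_Arg[of F "Arg z / (2*pi)", OF per] by simp
  qed (simp add: Arg_zero)
  have "isCont (\<lambda>z. F (Arg z / (2 * pi))) z" if z: "z \<in> circle" for z
  proof (cases "z \<in> \<real>\<^sub>\<le>\<^sub>0")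
    case False
    then show ?thesis
      by (intro isCont_o2[OF _ cF] continuous_intros continuous_at_Arg) auto
  next
    case True
    then have "z \<notin> \<real>\<^sub>\<ge>\<^sub>0"
      using z by (auto simp: complex_nonpos_Reals_iff complex_nonneg_Reals_iff complex_eq_iff)
        (use complex_eq_iff in \<open>force simp: norm_complex_def\<close>)
    then have "isCont (\<lambda>z. F (Arg2pi z / (2 * pi))) z"
      by (intro isCont_o2[OF _ cF] continuous_intros continuous_at_Arg2pi) auto
    then show ?thesis by (simp add: eq)
  qed
  then show ?thesis by (simp add: continuous_at_imp_continuous_on)
qed

lemma integral_trig_poly_eq_0:
  assumes F: "bounded_periodic A F" and z: "\<And>n. fcoeff F n = 0" and p: "trig_poly p"
  shows "integrable unit_leb (\<lambda>t. F t * p (turn t)) \<and> (LINT t|unit_leb. F t * p (turn t)) = 0"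
  using p
proof induction
  case (monomial c n)
  have "(\<lambda>t. F t * (c * turn t powi n)) = (\<lambda>t. c * (F t * turn (- (of_int (-n) * t))))"
    by (auto simp: turn_powi)
  then show ?case
    using z[of "-n"] periodic_integrable[OF periodic_fcoeff_integrand[OF F, of "-n"]] 
    by (simp add: fcoeff_def)
next
  case (add f g)
  then show ?case by (simp add: distrib_left)
qed

text \<open>If all coefficients vanish, \<open>F\<close> is orthogonal to trigonometric polynomials, hence by density to its
own real and imaginary parts; so the integral of \<open>(norm (F t))\<^sup>2\<close> is zero.\<close>

lemma fourier_uniqueness:
  assumes F: "bounded_periodic A F" and cont: "continuous_on UNIV F" and z: "\<And>n. fcoeff F n = 0"
  shows "F t = 0"
proof -
  have [measurable]: "F \<in> borel_measurable borel" and bd: "\<And>t. norm (F t) \<le> A"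
    and per: "\<And>t. F (t + 1) = F t"
    using F by (auto simp: bounded_periodic_def)
  have A: "A \<ge> 0" using bd norm_ge_zero order_trans by blast
  have key: "(LINT t|unit_leb. F t * of_real (u t)) = 0"
    if u: "continuous_on UNIV u" and uper: "\<And>t. u (t + 1) = u t" and ubd: "\<And>t. \<bar>u t\<bar> \<le> A"
    for u :: "real \<Rightarrow> real"
  proof -
    have [measurable]: "u \<in> borel_measurable borel" by (rule borel_measurable_continuous_onI[OF u])
    have I: "integrable unit_leb (\<lambda>t. F t * of_real (u t))"
      by (rule integrable_unit_leb[of _ "A * A"])
         (use bd ubd A in \<open>auto simp: norm_mult intro!: mult_mono\<close>)
    have "norm (LINT t|unit_leb. F t * of_real (u t)) \<le> 0 + A * e" if e: "e > 0" for e
    proof -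
      obtain p where p: "trig_poly p"
        "\<And>z. z \<in> circle \<Longrightarrow> norm (of_real (u (Arg z / (2 * pi))) - p z) < e"
        using trig_poly_dense[OF continuous_periodic_on_circle[OF u uper] e] by blast
      have up: "norm (of_real (u t) - p (turn t)) < e" for t
        using p(2)[of "turn t"] by (simp add: periodic_Arg[of u, OF uper])
      note P = integral_trig_poly_eq_0[OF F z p(1)]
      have "(LINT t|unit_leb. F t * of_real (u t))
         = (LINT t|unit_leb. F t * of_real (u t)) - (LINT t|unit_leb. F t * p (turn t))"
        using P by simp
      also have "\<dots> = (LINT t|unit_leb. F t * of_real (u t) - F t * p (turn t))"
        using P I by simp
      also have "norm \<dots> \<le> (LINT t|unit_leb. norm (F t * of_real (u t) - F t * p (turn t)))"
        by simp
      also have "\<dots> \<le> (LINT t|unit_leb. A * e)"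
      proof (rule integral_mono)
        show "integrable unit_leb (\<lambda>t. norm (F t * of_real (u t) - F t * p (turn t)))"
          using P I by simp
        show "integrable unit_leb (\<lambda>t. A * e)"
          by (rule finite_measure.integrable_const[OF finite_measure_unit_leb])
        show "norm (F t * of_real (u t) - F t * p (turn t)) \<le> A * e" for t
          using bd[of t] up[of t] A
          by (auto simp: norm_mult intro!: mult_mono simp flip: right_diff_distrib)
      qed
      also have "\<dots> = A * e" by simp
      finally show ?thesis by simp
    qed
    then have bound: "norm (LINT t|unit_leb. F t * of_real (u t)) \<le> A * e" if "e > 0" for e
      using that by simp
    have "norm (LINT t|unit_leb. F t * of_real (u t)) \<le> 0 + e" if e: "e > 0" for e
    proof -
      have "A * (e / (A + 1)) \<le> e" using A e by (simp add: field_simps)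
      with bound[of "e / (A + 1)"] show ?thesis using A e by simp
    qed
    from field_le_epsilon[OF this] show ?thesis by simp
  qed
  have "(LINT t|unit_leb. (norm (F t))\<^sup>2) = Re (LINT t|unit_leb. F t * of_real (Re (F t))) + Im (LINT t|unit_leb. F t * of_real (Im (F t)))"
  proof -
    have I: "integrable unit_leb (\<lambda>t. F t * of_real (Re (F t)))" "integrable unit_leb (\<lambda>t. F t * of_real (Im (F t)))"
      using bd A order_trans[OF abs_Re_le_cmod bd] order_trans[OF abs_Im_le_cmod bd]
      by (auto intro!: integrable_unit_leb[of _ "A * A"] mult_mono simp: norm_mult)
    have "(LINT t|unit_leb. (norm (F t))\<^sup>2) = (LINT t|unit_leb. Re (F t * of_real (Re (F t))) + Im (F t * of_real (Im (F t))))"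
      unfolding cmod_power2 by (simp add: power2_eq_square)
    also have "\<dots> = (LINT t|unit_leb. Re (F t * of_real (Re (F t)))) + (LINT t|unit_leb. Im (F t * of_real (Im (F t))))"
      using I by (intro Bochner_Integration.integral_add integrable_Re integrable_Im)
    also have "\<dots> = Re (LINT t|unit_leb. F t * of_real (Re (F t))) + Im (LINT t|unit_leb. F t * of_real (Im (F t)))"
      by (simp only: integral_Re[OF I(1)] integral_Im[OF I(2)])
    finally show ?thesis .
  qed
  also have "\<dots> = 0"
  proof -
    have "(LINT t|unit_leb. F t * of_real (Re (F t))) = 0"
      by (rule key) (use cont per order_trans[OF abs_Re_le_cmod bd] in \<open>auto intro!: continuous_intros\<close>)
    moreover have "(LINT t|unit_leb. F t * of_real (Im (F t))) = 0"
      by (rule key) (use cont per order_trans[OF abs_Im_le_cmod bd] in \<open>auto intro!: continuous_intros\<close>)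
    ultimately show ?thesis by simp
  qed
  finally have int0: "(LINT t|unit_leb. (norm (F t))\<^sup>2) = 0" .
  have I2: "integrable unit_leb (\<lambda>t. (norm (F t))\<^sup>2)"
  proof (rule integrable_unit_leb)
    show "norm ((norm (F t))\<^sup>2) \<le> A\<^sup>2" for t
      using power_mono[OF bd[of t], of 2] by simp
  qed measurable
  have "AE t in unit_leb. (norm (F t))\<^sup>2 = 0"
    using int0 by (subst integral_nonneg_eq_0_iff_AE[OF I2, symmetric]) auto
  then have "AE t in lborel. t \<in> {0<..<1} \<longrightarrow> t \<in> {t. F t = 0}"
    by (auto simp: AE_restrict_space_iff)
  then have "AE t\<in>{0<..<1} in lebesgue. t \<in> {t. F t = 0}"
    using AE_completion by blast
  moreover have closed: "closed {t. F t = 0}"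
    using cont by (intro closed_Collect_eq) auto
  ultimately have "t \<in> {t. F t = 0}" if "t \<in> {0<..<1}" for t
    using mem_closed_if_AE_lebesgue_open[of "{0<..<1}" "{t. F t = 0}" t] that by auto
  then have "closure {0<..<1::real} \<subseteq> {t. F t = 0}"
    using closed by (intro closure_minimal) auto
  then have "F (frac t) = 0"
    using frac_ge_0[of t] less_imp_le[OF frac_lt_1[of t]]
    by (auto simp del: frac_ge_0 simp: subset_iff)
  then show ?thesis using periodic_frac[of F t, OF per] by simp
qed

lemma fcoeff_trig_sum:
  fixes c :: "int \<Rightarrow> complex"
  assumes "finite I"
  shows "fcoeff (\<lambda>t. \<Sum>l\<in>I. c l * turn (of_int l * t)) n = (if n \<in> I then c n else 0)"
proof -
  have "fcoeff (\<lambda>t. \<Sum>l\<in>I. c l * turn (of_int l * t)) n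
      = (LINT t|unit_leb. (\<Sum>l\<in>I. c l * turn (of_int (l - n) * t)))"
  proof -
    have "(\<Sum>l\<in>I. c l * turn (of_int l * t)) * turn (- (of_int n * t)) = (\<Sum>l\<in>I. c l * turn (of_int (l - n) * t))" for t
      by (simp add: sum_distrib_right mult.assoc left_diff_distrib flip: turn_add)
    then show ?thesis by (simp add: fcoeff_def)
  qed
  also have "\<dots> = (\<Sum>l\<in>I. (LINT t|unit_leb. c l * turn (of_int (l - n) * t)))"
    by (intro Bochner_Integration.integral_sum integrable_mult_right periodic_integrable[OF periodic_turn])
  also have "\<dots> = (\<Sum>l\<in>I. if l = n then c l else 0)"
  proof (rule sum.cong)
    fix l :: int
    have "(LINT t|unit_leb. turn (of_int m * t)) = 0" if m: "m \<noteq> 0" for m :: int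
    proof -
      define s :: real where "s = 1 / (2 * of_int m)"
      have "\<bar>s\<bar> \<le> 1"
      proof -
        have "1 \<le> \<bar>real_of_int m\<bar>" using m by linarith
        then show ?thesis by (simp add: s_def abs_divide abs_mult divide_le_eq_1)
      qed
      from integral_shift[OF periodic_turn[of m] this]
      have "(LINT t|unit_leb. turn (of_int m * t + of_int m * s)) = (LINT t|unit_leb. turn (of_int m * t))"
        by (simp add: distrib_left)
      moreover have "turn (of_int m * s) = -1"
        using m by (simp add: s_def turn_def)
      ultimately have "- (LINT t|unit_leb. turn (of_int m * t)) = (LINT t|unit_leb. turn (of_int m * t))"
        by (simp add: turn_add)
      then show ?thesis by (simp add: complex_eq_iff)
    qed
    from this[of "l - n"] show "(LINT t|unit_leb. c l * turn (of_int (l - n) * t)) = (if l = n then c l else 0)"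
      by auto
  qed simp
  also have "\<dots> = (if n \<in> I then c n else 0)" using assms by simp
  finally show ?thesis .
qed

text \<open>The series converges uniformly to a continuous function with the same coefficients as \<open>F\<close>, and
uniqueness applies to the difference.\<close>

lemma fourier_series_has_sum:
  assumes F: "bounded_periodic A F" and cont: "continuous_on UNIV F"
    and summ: "(\<lambda>n. norm (fcoeff F n)) summable_on UNIV"
  shows "((\<lambda>n. fcoeff F n * turn (of_int n * t)) has_sum F t) UNIV"
proof -
  let ?S = "\<lambda>t. \<Sum>\<^sub>\<infinity>n. fcoeff F n * turn (of_int n * t)"
  have ul: "uniform_limit UNIV (\<lambda>I t. \<Sum>n\<in>I. fcoeff F n * turn (of_int n * t)) ?S (finite_subsets_at_top UNIV)"
    by (rule Weierstrass_m_test_general[OF _ summ]) (simp add: norm_mult)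
  have contS: "continuous_on UNIV ?S"
    by (rule uniform_limit_theorem[OF _ ul])
       (auto intro!: always_eventually continuous_intros)
  have summ': "(\<lambda>n. fcoeff F n * turn (of_int n * t)) summable_on UNIV" for t
    by (rule abs_summable_summable) (simp add: norm_mult summ)
  define B where "B = (\<Sum>\<^sub>\<infinity>n. norm (fcoeff F n))"
  have S: "bounded_periodic B ?S"
    unfolding bounded_periodic_def
  proof (intro conjI allI)
    show "?S \<in> borel_measurable borel" by (rule borel_measurable_continuous_onI[OF contS])
    show "?S (t + 1) = ?S t" for t
      by (simp add: distrib_left turn_add)
    show "norm (?S t) \<le> B" for t
      using norm_infsum_bound[of "\<lambda>n. fcoeff F n * turn (of_int n * t)" UNIV] summ
      by (simp add: norm_mult B_def)
  qed
  have fcS: "fcoeff ?S n = fcoeff F n" for n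
  proof -
    have "norm (fcoeff ?S n - fcoeff F n) \<le> 0 + e" if e: "e > 0" for e
    proof -
      from uniform_limitD[OF ul e] obtain X where X: "finite X"
        "\<And>Y. finite Y \<Longrightarrow> X \<subseteq> Y \<Longrightarrow> \<forall>t. dist (\<Sum>n\<in>Y. fcoeff F n * turn (of_int n * t)) (?S t) < e"
        unfolding eventually_finite_subsets_at_top by auto
      define I where "I = insert n X"
      let ?P = "\<lambda>t. \<Sum>n\<in>I. fcoeff F n * turn (of_int n * t)"
      have I: "finite I" "X \<subseteq> I" using X by (auto simp: I_def)
      have P: "bounded_periodic (\<Sum>n\<in>I. norm (fcoeff F n)) ?P"
        unfolding bounded_periodic_def
        by (auto simp: distrib_left turn_add norm_mult intro!: sum_norm_le)
      have "bounded_periodic e (\<lambda>t. ?S t - ?P t)"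
        using periodic_diff[OF S P] X(2)[OF I]
        by (auto simp: bounded_periodic_def dist_norm norm_minus_commute less_imp_le)
      from norm_fcoeff_le[OF this, of n] have "norm (fcoeff ?S n - fcoeff ?P n) \<le> e"
        by (simp only: fcoeff_diff[OF S P])
      then show ?thesis
        using fcoeff_trig_sum[OF I(1), of "fcoeff F" n] by (simp add: I_def)
    qed
    from field_le_epsilon[OF this] show ?thesis by simp
  qed
  have "F t - ?S t = 0"
    by (rule fourier_uniqueness[OF periodic_diff[OF F S]])
       (use cont contS in \<open>auto intro!: continuous_intros simp: fcoeff_diff[OF F S] fcS\<close>)
  then have "F t = ?S t" by simp
  then show ?thesis using has_sum_infsum[OF summ'] by simp
qed

section \<open>Neighbourhoods of the integers and the tent kernel\<close>

definition near_int :: "real \<Rightarrow> real set" where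
  "near_int b = {t. \<exists>i::int. \<bar>t - of_int i\<bar> < b}"

lemma open_near_int: "open (near_int b)"
proof -
  have "near_int b = (\<Union>i::int. ball (of_int i) b)"
    unfolding near_int_def by (auto simp: dist_real_def abs_minus_commute)
  then show ?thesis by auto
qed

lemma near_int_add_int: "t + of_int m \<in> near_int b \<longleftrightarrow> t \<in> near_int b"
proof -
  have "t + of_int m \<in> near_int b" if "t \<in> near_int b" for t m
  proof -
    from that obtain i :: int where "\<bar>t - of_int i\<bar> < b" by (auto simp: near_int_def)
    then have "\<bar>t + of_int m - of_int (i + m)\<bar> < b" by simp
    then show ?thesis unfolding near_int_def by blast
  qed
  from this[of t m] this[of "t + of_int m" "- m"] show ?thesis by auto
qed

lemma summable_on_int_inverse_square: "(\<lambda>l::int. 1 / (of_int l)\<^sup>2 :: real) summable_on UNIV"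
proof -
  have s: "summable (\<lambda>n. norm (1 / (real n)\<^sup>2))" "summable (\<lambda>n. norm (1 / (real (Suc n))\<^sup>2))"
    using inverse_power_summable[of 2, where 'a = real]
    by (simp_all add: divide_inverse summable_Suc_iff[of "\<lambda>n. inverse ((real n)\<^sup>2)"] del: of_nat_Suc)
  have 1: "(\<lambda>l::int. 1 / (of_int l)\<^sup>2 :: real) summable_on range int"
    using norm_summable_imp_summable_on[OF s(1)]
    by (subst summable_on_reindex) (auto simp: o_def)
  have 2: "(\<lambda>l::int. 1 / (of_int l)\<^sup>2 :: real) summable_on range (\<lambda>n. - int (Suc n))"
    using norm_summable_imp_summable_on[OF s(2)]
    by (subst summable_on_reindex) (auto simp: o_def inj_def power2_eq_square algebra_simps)
  have "(UNIV :: int set) = range int \<union> range (\<lambda>n. - int (Suc n))"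
  proof -
    have "l \<in> range int \<union> range (\<lambda>n. - int (Suc n))" for l
      by (cases l) auto
    then show ?thesis by blast
  qed
  then show ?thesis using summable_on_union[OF 1 2] by simp
qed

text \<open>The coefficients of the tent of height \<open>1 / b\<close> and half-width \<open>b\<close> around the integers: it is the
convolution square of a normalised box of half-width \<open>b / 2\<close>, which makes them squares.\<close>

definition tent_coeff :: "real \<Rightarrow> int \<Rightarrow> real" where
  "tent_coeff b l = (box_sinc (b / 2) l)\<^sup>2"

lemma tent_coeff_nonneg: "0 \<le> tent_coeff b l"
  by (simp add: tent_coeff_def)

lemma tent_coeff_le_1: "tent_coeff b l \<le> 1"
  using abs_box_sinc_le_1[of "b/2" l] by (simp add: tent_coeff_def abs_square_le_1)

lemma tent_coeff_0: "tent_coeff b 0 = 1"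
  by (simp add: tent_coeff_def box_sinc_def)

lemma tent_coeff_le:
  assumes "0 < b" "l \<noteq> 0"
  shows "tent_coeff b l \<le> 1 / (of_int l * b)\<^sup>2"
proof -
  have "\<bar>box_sinc (b/2) l\<bar> \<le> 1 / (\<bar>of_int l\<bar> * b)"
    using abs_box_sinc_le[of l "b/2"] assms by simp
  then have "\<bar>box_sinc (b/2) l\<bar>\<^sup>2 \<le> (1 / (\<bar>of_int l\<bar> * b))\<^sup>2"
    by (intro power_mono) auto
  then show ?thesis by (simp add: tent_coeff_def power_divide power_mult_distrib)
qed

lemma tent_coeff_summable:
  assumes "0 < b"
  shows "tent_coeff b summable_on UNIV"
proof -
  have "(\<lambda>l. 1 / b\<^sup>2 * (1 / (of_int l)\<^sup>2)) summable_on (UNIV - {0::int})"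
    by (intro summable_on_cmult_right summable_on_subset_banach[OF summable_on_int_inverse_square]) auto
  then have "tent_coeff b summable_on (UNIV - {0})"
    by (rule summable_on_comparison_test)
       (use tent_coeff_le[OF assms] tent_coeff_nonneg in \<open>auto simp: power_mult_distrib mult.commute\<close>)
  then have "tent_coeff b summable_on ((UNIV - {0}) \<union> {0})"
    by (rule summable_on_union) simp
  then show ?thesis by simp
qed

text \<open>The tent itself appears only inside this proof, as a box average of a normalised indicator. Its
Fourier series converges absolutely; the value at \<open>0\<close> gives the first claim, and the second says
that the tent vanishes away from the integers.\<close>

lemma tent_kernel:
  assumes b: "0 < b" "b \<le> 1/2"
  shows "\<And>I. finite I \<Longrightarrow> (\<Sum>l\<in>I. tent_coeff b l) \<le> 1 / b"
    and "\<And>t. t \<notin> near_int b \<Longrightarrow> ((\<lambda>l. of_real (tent_coeff b l) * turn (of_int l * t)) has_sum 0) UNIV"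
proof -
  define N where "N = near_int (b / 2)"
  define Q :: "real \<Rightarrow> complex" where "Q t = indicator N t / of_real b" for t
  have [measurable]: "N \<in> sets borel" by (simp add: N_def open_near_int)
  have Nper: "t + 1 \<in> N \<longleftrightarrow> t \<in> N" for t
    using near_int_add_int[of t 1 "b/2"] by (simp add: N_def)
  have [measurable]: "Q \<in> borel_measurable borel"
    unfolding Q_def by measurable
  have Q: "bounded_periodic (1 / b) Q"
    using b Nper by (auto simp: bounded_periodic_def Q_def indicator_def norm_divide)
  have fcQ: "fcoeff Q n = of_real (box_sinc (b/2) n)" for n
  proof -
    let ?G = "\<lambda>t. Q t * turn (- (of_int n * t))"
    \<comment> \<open>The normalised indicator is integrated over the period centred at an integer, where only that
      integer is near.\<close>
    have "fcoeff Q n = (LINT t|unit_leb. ?G (t + (-1/2)))"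
      unfolding fcoeff_def by (rule integral_shift[OF periodic_fcoeff_integrand[OF Q], symmetric]) simp
    also have "\<dots> = (LINT t|lborel. indicator {0..<1} t *\<^sub>R ?G (t + (-1/2)))"
      by (simp add: integral_restrict_space)
    also have "\<dots> = (LINT t|lborel. indicator {0..<1} (1/2 + 1 * t) *\<^sub>R ?G ((1/2 + 1 * t) + (-1/2)))"
      by (subst lborel_integral_real_affine[where c=1 and t="1/2"]) simp_all
    also have "\<dots> = (LINT t|lborel. (indicator {-(b/2)<..<b/2} t *\<^sub>R turn (of_int (-n) * t)) / of_real b)"
    proof (rule Bochner_Integration.integral_cong[OF refl])
      fix t :: real
      have "indicator {0..<1} (1/2 + t) * (indicator N t :: real) = indicator {-(b/2)<..<b/2} t"
      proof (cases "t \<in> {-1/2..<1/2}")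
        case True
        have "t \<in> N \<longleftrightarrow> t \<in> {-(b/2)<..<b/2}"
        proof
          assume "t \<in> N"
          then obtain i :: int where i: "\<bar>t - of_int i\<bar> < b/2" by (auto simp: N_def near_int_def)
          have "i = 0"
          proof (rule ccontr)
            assume "i \<noteq> 0"
            then have "\<bar>of_int i\<bar> \<ge> (1::real)" by linarith
            then show False using i True b by (auto simp: abs_if split: if_splits)
          qed
          then show "t \<in> {-(b/2)<..<b/2}" using i by auto
        next
          assume "t \<in> {-(b/2)<..<b/2}"
          then show "t \<in> N" unfolding N_def near_int_def by (intro CollectI exI[of _ 0]) (auto simp: abs_less_iff)
        qed
        then show ?thesis using True by (auto simp: indicator_def)
      next
        case False
        then show ?thesis using b by (auto simp: indicator_def)
      qed
      then have "of_real (indicator {0..<1} (1/2 + t)) * (indicator N t :: complex) = of_real (indicator {-(b/2)<..<b/2} t)"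
        by (metis of_real_indicator of_real_mult)
      then show "indicator {0..<1} (1/2 + 1 * t) *\<^sub>R ?G ((1/2 + 1 * t) + (-1/2))
          = (indicator {-(b/2)<..<b/2} t *\<^sub>R turn (of_int (-n) * t)) / of_real b"
        by (simp add: Q_def scaleR_conv_of_real mult.assoc[symmetric])
    qed
    also have "\<dots> = (LINT t|lborel. (indicator {-(b/2)..b/2} t *\<^sub>R turn (of_int (-n) * t)) / of_real b)"
    proof (rule integral_cong_AE)
      show "AE t in lborel. (indicator {-(b/2)<..<b/2} t *\<^sub>R turn (of_int (-n) * t)) / of_real b
          = (indicator {-(b/2)..b/2} t *\<^sub>R turn (of_int (-n) * t)) / of_real b"
        using AE_lborel_singleton[of "-(b/2)"] AE_lborel_singleton[of "b/2"]
        by eventually_elim (auto simp: indicator_def)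
    qed simp_all
    also have "\<dots> = (LINT t|restrict_space lborel {-(b/2)..b/2}. turn (of_int (-n) * t)) / of_real b"
      by (simp add: integral_restrict_space)
    also have "\<dots> = of_real (2 * (b/2) * box_sinc (b/2) (-n)) / of_real b"
      using integral_turn_box[of "b/2" "-n"] b by simp
    also have "\<dots> = of_real (box_sinc (b/2) n)" using b by (simp add: box_sinc_def)
    finally show ?thesis .
  qed
  define T where "T = box_avg (b/2) Q"
  have T: "bounded_periodic (1 / b) T"
    unfolding T_def using b by (intro periodic_box_avg[OF Q]) simp
  have contT: "continuous_on UNIV T"
    by (rule lipschitz_on_continuous_on[where L="(1 / b) / (b/2)"], rule lipschitz_onI)
       (use box_avg_lipschitz[OF Q, of "b/2"] b in \<open>auto simp: dist_norm T_def\<close>)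
  have fcT: "fcoeff T n = of_real (tent_coeff b n)" for n
    unfolding T_def using b fcQ[of n]
    by (simp add: fcoeff_box_avg[OF Q] tent_coeff_def power2_eq_square)
  have summ: "(\<lambda>n. norm (fcoeff T n)) summable_on UNIV"
    using tent_coeff_summable[OF b(1)] by (simp add: fcT tent_coeff_nonneg)
  note ser = fourier_series_has_sum[OF T contT summ]
  show "(\<Sum>l\<in>I. tent_coeff b l) \<le> 1 / b" if "finite I" for I
  proof -
    have "(tent_coeff b has_sum (Re (T 0))) UNIV"
      using has_sum_Re[OF ser[of 0]] by (simp add: fcT)
    then have "(\<Sum>l\<in>I. tent_coeff b l) \<le> Re (T 0)"
      using that by (rule finite_sum_le_has_sum) (auto simp: tent_coeff_nonneg)
    also have "\<dots> \<le> norm (T 0)" by (rule complex_Re_le_cmod)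
    also have "\<dots> \<le> 1 / b" using T by (simp add: bounded_periodic_def)
    finally show ?thesis .
  qed
  show "((\<lambda>l. of_real (tent_coeff b l) * turn (of_int l * t)) has_sum 0) UNIV" if t: "t \<notin> near_int b" for t
  proof -
    have "T t = 0"
      unfolding T_def
    proof (rule box_avg_eq_0)
      fix s assume s: "\<bar>s\<bar> \<le> b / 2"
      have "t + s \<notin> N"
      proof
        assume "t + s \<in> N"
        then obtain i :: int where i: "\<bar>t + s - of_int i\<bar> < b/2" by (auto simp: N_def near_int_def)
        have "\<bar>t - of_int i\<bar> \<ge> b" using t by (force simp: near_int_def not_less)
        with i s show False by (auto simp: abs_if split: if_splits)
      qed
      then show "Q (t + s) = 0" by (simp add: Q_def)
    qed
    then show ?thesis using ser[of t] by (simp add: fcT)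
  qed
qed

section \<open>Combs\<close>

definition comb :: "nat \<Rightarrow> nat \<Rightarrow> real \<Rightarrow> real set" where
  "comb N J b = {t. \<exists>j<J. real (N + j) * t \<in> near_int b}"

lemma open_comb: "open (comb N J b)"
proof -
  have "comb N J b = (\<Union>j\<in>{..<J}. (\<lambda>t. real (N + j) * t) -` near_int b)"
    by (auto simp: comb_def)
  moreover have "open ((\<lambda>t. real (N + j) * t) -` near_int b)" for j
    by (intro open_vimage open_near_int continuous_intros)
  ultimately show ?thesis by auto
qed

lemma comb_add_1: "t + 1 \<in> comb N J b \<longleftrightarrow> t \<in> comb N J b"
proof -
  have "real (N + j) * (t + 1) = real (N + j) * t + of_int (int (N + j))" for j
    by (simp add: algebra_simps)
  then show ?thesis unfolding comb_def by (simp only: near_int_add_int mem_Collect_eq)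
qed

text \<open>For a single \<open>j\<close> put \<open>M = N + j\<close>. The number \<open>M t\<close> with \<open>0 \<le> t < 1\<close> can be close only to the \<open>M + 1\<close> integers \<open>0, \<dots>, M\<close>, which
accounts for \<open>M + 1\<close> intervals of length \<open>2 b / M\<close>.\<close>

lemma measure_comb_le:
  assumes N: "N \<ge> 1" and b: "0 < b" "b \<le> 1"
  shows "measure unit_leb (comb N J b \<inter> {0..<1}) \<le> 4 * b * J"
proof -
  define S where "S j i = {(real i - b) / real (N + j) .. (real i + b) / real (N + j)}" for j i :: nat
  have sub: "comb N J b \<inter> {0..<1} \<subseteq> (\<Union>j\<in>{..<J}. \<Union>i\<in>{..N+j}. S j i)"
  proof
    fix t assume "t \<in> comb N J b \<inter> {0..<1}"
    then obtain j i where j: "j < J" and i: "\<bar>real (N + j) * t - of_int i\<bar> < b" and t: "0 \<le> t" "t < 1"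
      by (auto simp: comb_def near_int_def)
    have M: "real (N + j) > 0" using N by simp
    have "0 \<le> real (N + j) * t" "real (N + j) * t < real (N + j)"
      using M t by simp_all
    then have "-1 < real_of_int i" "real_of_int i < real (N + j) + 1"
      using i b by (auto simp: abs_if split: if_splits)
    then have i0: "0 \<le> i" "i \<le> int (N + j)" by linarith+
    have "t \<in> S j (nat i)"
      using i M i0 by (auto simp: S_def field_simps abs_if split: if_splits)
    moreover have "nat i \<in> {..N + j}" using i0 by simp
    ultimately show "t \<in> (\<Union>j\<in>{..<J}. \<Union>i\<in>{..N+j}. S j i)" using j by blast
  qed
  have mS: "measure lborel (S j i) = 2 * b / real (N + j)" for j i
    using N b by (simp add: S_def diff_divide_distrib add_divide_distrib divide_right_mono measure_lborel_Icc)
  have "measure unit_leb (comb N J b \<inter> {0..<1}) = measure lborel (comb N J b \<inter> {0..<1})"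
    by (intro measure_unit_leb) (auto simp: open_comb)
  also have "\<dots> \<le> measure lborel (\<Union>j\<in>{..<J}. \<Union>i\<in>{..N+j}. S j i)"
  proof (rule measure_mono_fmeasurable[OF sub])
    show "(\<Union>j\<in>{..<J}. \<Union>i\<in>{..N+j}. S j i) \<in> fmeasurable lborel"
      by (intro fmeasurable.finite_UN) (auto simp: S_def fmeasurable_def emeasure_lborel_Icc_eq)
  qed (auto simp: open_comb)
  also have "\<dots> \<le> (\<Sum>j<J. measure lborel (\<Union>i\<in>{..N+j}. S j i))"
    by (rule measure_UNION_le) (auto simp: S_def)
  also have "\<dots> \<le> (\<Sum>j<J. \<Sum>i\<le>N+j. measure lborel (S j i))"
    by (intro sum_mono measure_UNION_le) (auto simp: S_def)
  also have "\<dots> = (\<Sum>j<J. (real (N + j) + 1) * (2 * b / real (N + j)))"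
    by (simp add: mS add.commute)
  also have "\<dots> \<le> (\<Sum>j<J. 4 * b)"
  proof (rule sum_mono)
    fix j
    have M: "real (N + j) \<ge> 1" using N by simp
    then have "(real (N + j) + 1) * (2 * b) \<le> (2 * real (N + j)) * (2 * b)"
      using b by (intro mult_right_mono) auto
    then show "(real (N + j) + 1) * (2 * b / real (N + j)) \<le> 4 * b"
      using M by (simp add: field_simps)
  qed
  also have "\<dots> = 4 * b * J" by simp
  finally show ?thesis .
qed

section \<open>A one-sided multiplier that is small on a comb\<close>

lemma Re_cayley: "Re ((1 + w) / (1 - w)) = (1 - (norm w)\<^sup>2) / (norm (1 - w))\<^sup>2"
  unfolding cmod_power2 by (simp add: Re_divide power2_eq_square algebra_simps)

text \<open>The barrier is \<open>exp (- c \<Sum> g (z ^ (N + j)))\<close> on the unit circle, where \<open>g w = (1 + r w) / (1 - r w)\<close> and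
\<open>r = 1 - b\<close>. The real part of \<open>g\<close> is the Poisson kernel: it is positive, and of size \<open>1 / b\<close> when \<open>w\<close>
is within a multiple of \<open>b\<close> from \<open>1\<close>, while \<open>g 0 = 1\<close>. So \<open>c\<close> proportional to \<open>b L\<close> produces the drop
to \<open>exp (- L)\<close> on the comb at the price of a mean of only \<open>exp (- c J)\<close>. Holomorphy in a disc larger
than the unit disc makes the spectrum one-sided; the substitution \<open>z = turn (- t)\<close> puts it at the
nonpositive frequencies.\<close>

lemma outer_barrier:
  fixes N J :: nat and b L :: real
  assumes N: "N \<ge> 1" and b: "0 < b" "b \<le> 1/2" and L: "0 \<le> L"
  obtains G :: "real \<Rightarrow> complex" and a :: "nat \<Rightarrow> complex" where
    "bounded_periodic 1 G"
    "\<And>t. t \<in> comb N J (2 * b) \<Longrightarrow> norm (G t) \<le> exp (- L)"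
    "summable (\<lambda>l. norm (a l))"
    "\<And>t. (\<lambda>l. a l * turn (- (of_nat l * t))) sums G t"
    "a 0 = of_real (exp (- (300 * b * L * J)))"
proof -
  define r where "r = 1 - b"
  define c where "c = 300 * b * L"
  define g where "g w = (1 + of_real r * w) / (1 - of_real r * w)" for w :: complex
  define \<Phi> where "\<Phi> z = exp (- of_real c * (\<Sum>j<J. g (z ^ (N + j))))" for z :: complex
  have r: "0 < r" "r < 1" using b by (auto simp: r_def)
  have c: "c \<ge> 0" using b L by (simp add: c_def)
  define R where "R = root (N + J) (1 / r)"
  have NJ: "N + J > 0" using N by simp
  have R1: "R > 1" using r NJ by (simp add: R_def real_root_gt_1_iff)
  have RN: "r * R ^ (N + J) = 1" using r NJ by (simp add: R_def real_root_pow_pos2)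
  \<comment> \<open>The radius is chosen such that no pole enters the larger disc.\<close>
  have small: "norm (of_real r * z ^ (N + j)) < 1" if z: "norm z < R" and j: "j < J" for z :: complex and j
  proof (cases "norm z \<le> 1")
    case True
    then have "norm z ^ (N + j) \<le> 1" by (simp add: power_le_one)
    then have "r * norm z ^ (N + j) \<le> r * 1" using r by (intro mult_left_mono) auto
    then have "r * norm z ^ (N + j) < 1" using r by linarith
    then show ?thesis using r by (simp add: norm_mult norm_power)
  next
    case False
    then have "norm z ^ (N + j) \<le> norm z ^ (N + J)" using j by (intro power_increasing) auto
    also have "\<dots> < R ^ (N + J)" using z NJ by (intro power_strict_mono) auto
    finally have "r * norm z ^ (N + j) < r * R ^ (N + J)" using r by simp
    then show ?thesis using r RN by (simp add: norm_mult norm_power)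
  qed
  have holo: "\<Phi> holomorphic_on ball 0 R"
  proof -
    have "1 - of_real r * z ^ (N + j) \<noteq> 0" if "z \<in> ball 0 R" "j < J" for z :: complex and j
      using small[of z j] that by auto
    then show ?thesis unfolding \<Phi>_def g_def by (intro holomorphic_intros) auto
  qed
  define a where "a l = (deriv ^^ l) \<Phi> 0 / fact l" for l
  have ps: "(\<lambda>l. a l * z ^ l) sums \<Phi> z" if "norm z < R" for z
    using holomorphic_power_series[OF holo, of z] that by (simp add: a_def)
  have "summable (\<lambda>l. a l * of_real ((1 + R) / 2) ^ l)"
    using ps[of "of_real ((1 + R) / 2)"] R1 by (intro sums_summable) (auto simp: norm_divide simp flip: of_real_add)
  then have summ: "summable (\<lambda>l. norm (a l))"
    using powser_insidea[of a "of_real ((1 + R) / 2)" 1] R1 by (simp flip: of_real_add)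
  define G where "G t = \<Phi> (turn (- t))" for t
  have sums: "(\<lambda>l. a l * turn (- (of_nat l * t))) sums G t" for t
    using ps[of "turn (-t)"] R1 by (simp add: G_def turn_power)
  have Re_g: "Re (g w) = (1 - r\<^sup>2) / (norm (1 - of_real r * w))\<^sup>2" if "norm w = 1" for w
    using Re_cayley[of "of_real r * w"] that by (simp add: g_def norm_mult)
  have Re_g_nonneg: "Re (g w) \<ge> 0" if "norm w = 1" for w
    using Re_g[OF that] r by (simp add: power_le_one)
  have tp: "turn (- t) ^ (N + j) = turn (- (real (N + j) * t))" for t j
    by (simp add: turn_power)
  have normG: "norm (G t) = exp (- c * (\<Sum>j<J. Re (g (turn (- (real (N + j) * t))))))" for t
    by (simp add: G_def \<Phi>_def tp Re_sum)
  have "continuous_on UNIV G"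
  proof -
    have "continuous_on (ball 0 R) \<Phi>" by (rule holomorphic_on_imp_continuous_on[OF holo])
    then have "continuous_on UNIV (\<Phi> \<circ> (\<lambda>t. turn (- t)))"
      using R1 by (intro continuous_on_compose continuous_intros) (auto intro: continuous_on_subset)
    then show ?thesis by (simp add: G_def[abs_def] o_def)
  qed
  then have meas: "G \<in> borel_measurable borel" by (rule borel_measurable_continuous_onI)
  have P: "bounded_periodic 1 G"
    unfolding bounded_periodic_def
  proof (intro conjI allI meas)
    show "G (t + 1) = G t" for t
      using turn_add_int[of "- t" "-1"] by (simp add: G_def algebra_simps)
    show "norm (G t) \<le> 1" for t
      unfolding normG using c by (auto intro!: mult_nonneg_nonneg sum_nonneg Re_g_nonneg)
  qed
  have low: "norm (G t) \<le> exp (- L)" if t: "t \<in> comb N J (2 * b)" for t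
  proof -
    from t obtain j i where j: "j < J" and i: "\<bar>real (N + j) * t - of_int i\<bar> < 2 * b"
      by (auto simp: comb_def near_int_def)
    define w where "w = turn (- (real (N + j) * t))"
    have "norm (w - 1) = norm (turn (- (real (N + j) * t)) - turn (- of_int i))"
      using turn_of_int[of "-i"] by (simp add: w_def)
    also have "\<dots> \<le> 2 * pi * \<bar>- (real (N + j) * t) - - of_int i\<bar>"
      by (rule norm_turn_diff_le)
    also have "\<dots> \<le> 2 * pi * (2 * b)"
      using i by (intro mult_left_mono) auto
    also have "\<dots> \<le> 16 * b" using pi_less_4 b by simp
    finally have w1: "norm (w - 1) \<le> 16 * b" .
    have "norm (1 - of_real r * w) = norm (of_real b - of_real r * (w - 1))"
      by (simp add: r_def algebra_simps)
    also have "\<dots> \<le> b + r * norm (w - 1)"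
      using norm_triangle_ineq4[of "of_real b" "of_real r * (w - 1)"] b r by (simp add: norm_mult)
    also have "\<dots> \<le> b + 1 * (16 * b)"
      using w1 r b by (intro add_left_mono mult_mono) auto
    finally have up: "norm (1 - of_real r * w) \<le> 17 * b" by simp
    have nz: "0 < norm (1 - of_real r * w)"
    proof -
      have "norm (of_real r * w) < 1" using r by (simp add: w_def norm_mult)
      then show ?thesis by auto
    qed
    \<comment> \<open>The constant 300 in the exponent is there to exceed the square of 17, the loss in the distance bound.\<close>
    have "L \<le> 300 * b * L * (b / (17 * b)\<^sup>2)"
      using b L by (simp add: power2_eq_square field_simps)
    also have "\<dots> \<le> 300 * b * L * ((1 - r\<^sup>2) / (norm (1 - of_real r * w))\<^sup>2)"
    proof -
      have "b \<le> 1 - r\<^sup>2" using b by (simp add: r_def power2_eq_square algebra_simps)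
      then have "b / (17 * b)\<^sup>2 \<le> (1 - r\<^sup>2) / (norm (1 - of_real r * w))\<^sup>2"
        using nz up b by (intro frac_le power_mono) auto
      then show ?thesis using b L by (intro mult_left_mono) auto
    qed
    also have "\<dots> = c * Re (g w)"
      using Re_g[of w] by (simp add: c_def w_def)
    also have "\<dots> \<le> c * (\<Sum>j<J. Re (g (turn (- (real (N + j) * t)))))"
      unfolding w_def using j c by (intro mult_left_mono member_le_sum Re_g_nonneg) auto
    finally show ?thesis unfolding normG by simp
  qed
  have a0: "a 0 = of_real (exp (- (300 * b * L * J)))"
  proof -
    have "a 0 = \<Phi> 0" by (simp add: a_def)
    also have "\<dots> = exp (of_real (- (c * J)))" using N by (simp add: \<Phi>_def g_def power_0_left)
    also have "\<dots> = of_real (exp (- (300 * b * L * J)))" by (simp only: exp_of_real c_def)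
    finally show ?thesis .
  qed
  show thesis by (rule that[OF P low summ sums a0])
qed

text \<open>Multiplication by a series in nonpositive frequencies expresses the coefficient at \<open>n\<close> through the
coefficients of \<open>F\<close> at frequencies \<open>n\<close> and above. This is what keeps decay at positive frequencies
intact, however slowly \<open>d\<close> decays.\<close>

lemma fcoeff_mult_series:
  fixes d :: "nat \<Rightarrow> complex"
  assumes F: "bounded_periodic A F"
    and summ: "summable (\<lambda>l. norm (d l))"
    and G: "\<And>t. (\<lambda>l. d l * turn (- (of_nat l * t))) sums G t"
  shows "(\<lambda>l. d l * fcoeff F (n + int l)) sums fcoeff (\<lambda>t. F t * G t) n"
proof -
  let ?f = "\<lambda>l t. d l * (F t * turn (- (of_int (n + int l) * t)))"
  note P = periodic_fcoeff_integrand[OF F]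
  have A: "A \<ge> 0" using F norm_ge_zero order_trans unfolding bounded_periodic_def by blast
  have int: "integrable unit_leb (?f l)" for l
    by (intro integrable_mult_right periodic_integrable[OF P])
  have nf: "norm (?f l t) \<le> norm (d l) * A" for l t
    using P[of "n + int l"] by (auto simp: norm_mult bounded_periodic_def intro!: mult_left_mono)
  have "(\<lambda>l. LINT t|unit_leb. ?f l t) sums (LINT t|unit_leb. (\<Sum>l. ?f l t))"
  proof (rule sums_integral[OF int])
    show "AE t in unit_leb. summable (\<lambda>l. norm (?f l t))"
      by (intro AE_I2 summable_comparison_test'[OF summable_mult2[OF summ, of A], of 0]) (use nf in auto)
    have "norm (LINT t|unit_leb. norm (?f l t)) \<le> norm (d l) * A" for l
      by (rule norm_integral_unit_leb_le)
         (use F nf in \<open>auto simp: bounded_periodic_def\<close>)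
    then show "summable (\<lambda>l. LINT t|unit_leb. norm (?f l t))"
      by (intro summable_comparison_test'[OF summable_mult2[OF summ, of A], of 0]) auto
  qed
  moreover have "(LINT t|unit_leb. ?f l t) = d l * fcoeff F (n + int l)" for l
    by (simp add: fcoeff_def)
  moreover have "(\<Sum>l. ?f l t) = F t * G t * turn (- (of_int n * t))" for t
  proof (rule sums_unique[symmetric])
    have "(\<lambda>l. (F t * turn (- (of_int n * t))) * (d l * turn (- (of_nat l * t)))) sums
        ((F t * turn (- (of_int n * t))) * G t)"
      by (rule sums_mult[OF G])
    moreover have "(F t * turn (- (of_int n * t))) * (d l * turn (- (of_nat l * t))) = ?f l t" for l
    proof -
      have "turn (- (of_int (n + int l) * t)) = turn (- (of_int n * t)) * turn (- (of_nat l * t))"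
        by (simp add: algebra_simps flip: turn_add)
      then show ?thesis by simp
    qed
    ultimately have "(\<lambda>l. ?f l t) sums ((F t * turn (- (of_int n * t))) * G t)"
      by (simp only:)
    moreover have "(F t * turn (- (of_int n * t))) * G t = F t * G t * turn (- (of_int n * t))"
      by simp
    ultimately show "(\<lambda>l. ?f l t) sums (F t * G t * turn (- (of_int n * t)))"
      by (simp only:)
  qed
  ultimately show ?thesis by (simp add: fcoeff_def)
qed

lemma fcoeff_const_1: "fcoeff (\<lambda>_. 1) n = (if n = 0 then 1 else 0)"
  using fcoeff_trig_sum[of "{0}" "\<lambda>_. 1" n] by simp

lemma series_coeff_le_integral:
  fixes d :: "nat \<Rightarrow> complex"
  assumes summ: "summable (\<lambda>l. norm (d l))"
    and G: "\<And>t. (\<lambda>l. d l * turn (- (of_nat l * t))) sums G t"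
  shows "norm (d m) \<le> (LINT t|unit_leb. norm (G t))"
proof -
  have one: "bounded_periodic 1 (\<lambda>_. 1)" by (simp add: bounded_periodic_def)
  have "(\<lambda>l. d l * fcoeff (\<lambda>_. 1) (- int m + int l)) sums fcoeff (\<lambda>t. 1 * G t) (- int m)"
    by (rule fcoeff_mult_series[OF one summ G])
  moreover have "(\<lambda>l. d l * fcoeff (\<lambda>_. 1) (- int m + int l)) = (\<lambda>l. if l = m then d l else 0)"
    by (auto simp: fcoeff_const_1)
  ultimately have "(\<lambda>l. if l = m then d l else 0) sums fcoeff G (- int m)" by simp
  then have "d m = fcoeff G (- int m)"
    using sums_unique2 sums_single by blast
  then show ?thesis using norm_fcoeff_le_integral[of G] by simp
qed

section \<open>One stage of the construction\<close>

abbreviation box_iter :: "nat \<Rightarrow> real \<Rightarrow> (real \<Rightarrow> complex) \<Rightarrow> real \<Rightarrow> complex" where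
  "box_iter K h \<equiv> box_avg h ^^ K"

lemma periodic_box_iter:
  "bounded_periodic A F \<Longrightarrow> 0 < h \<Longrightarrow> bounded_periodic A (box_iter K h F)"
  by (induction K) (auto intro: periodic_box_avg)

lemma fcoeff_box_iter:
  "bounded_periodic A F \<Longrightarrow> 0 < h \<Longrightarrow> h \<le> 1 \<Longrightarrow> fcoeff (box_iter K h F) n = of_real (box_sinc h n ^ K) * fcoeff F n"
  by (induction K) (auto simp: fcoeff_box_avg[OF periodic_box_iter])

lemma box_iter_L1_contraction:
  assumes "bounded_periodic A F" "0 < h" "h \<le> 1"
  shows "(LINT t|unit_leb. norm (box_iter K h F t)) \<le> (LINT t|unit_leb. norm (F t))"
proof (induction K)
  case (Suc K)
  then show ?case
    using box_avg_L1_contraction[OF periodic_box_iter[OF assms(1,2)] assms(2,3), of K] by simp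
qed simp

lemma box_iter_diff:
  assumes F: "bounded_periodic A F" and G: "bounded_periodic B G" and h: "0 < h"
  shows "box_iter K h (\<lambda>t. F t - G t) t = box_iter K h F t - box_iter K h G t"
proof (induction K arbitrary: t)
  case (Suc K)
  have "box_iter K h (\<lambda>t. F t - G t) = (\<lambda>t. box_iter K h F t - box_iter K h G t)"
    using Suc by blast
  then show ?case
    using box_avg_diff[OF periodic_box_iter[OF F h] periodic_box_iter[OF G h]] by simp
qed simp

lemma box_iter_eq_0:
  assumes "\<And>s. \<bar>s\<bar> \<le> real K * h \<Longrightarrow> F (t + s) = 0"
  shows "box_iter K h F t = 0"
  using assms
proof (induction K arbitrary: t)
  case (Suc K)
  have "box_iter K h F (t + s) = 0" if s: "\<bar>s\<bar> \<le> h" for s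
  proof (rule Suc.IH)
    fix u assume "\<bar>u\<bar> \<le> real K * h"
    then have "\<bar>s + u\<bar> \<le> real (Suc K) * h" using s by (simp add: algebra_simps)
    from Suc.prems[OF this] show "F (t + s + u) = 0" by (simp add: add.assoc)
  qed
  then show ?case by (auto intro: box_avg_eq_0)
qed simp

lemma norm_box_iter_minus_le:
  assumes F: "bounded_periodic A F" and h: "0 < h" and L: "0 \<le> L"
    and lip: "\<And>s t. norm (F s - F t) \<le> L * \<bar>s - t\<bar>"
  shows "norm (box_iter K h F t - F t) \<le> real K * (h * L)"
proof (induction K arbitrary: t)
  case (Suc K)
  have P: "bounded_periodic (real K * (h * L)) (\<lambda>t. box_iter K h F t - F t)"
    using periodic_diff[OF periodic_box_iter[OF F h, of K] F] Suc by (auto simp: bounded_periodic_def)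
  have "box_iter (Suc K) h F t - F t = box_avg h (\<lambda>t. box_iter K h F t - F t) t + (box_avg h F t - F t)"
    using box_avg_diff[OF periodic_box_iter[OF F h, of K] F] by simp
  also have "norm \<dots> \<le> real K * (h * L) + h * L"
  proof (rule norm_triangle_mono)
    show "norm (box_avg h (\<lambda>t. box_iter K h F t - F t) t) \<le> real K * (h * L)"
      using periodic_box_avg[OF P h] by (auto simp: bounded_periodic_def)
    show "norm (box_avg h F t - F t) \<le> h * L"
    proof (rule norm_box_avg_minus_le[OF F h])
      fix s assume "\<bar>s\<bar> \<le> h"
      then have "L * \<bar>s\<bar> \<le> L * h" using L by (rule mult_left_mono)
      then show "norm (F (t + s) - F t) \<le> h * L"
        using lip[of "t + s" t] by (simp add: mult.commute)
    qed
  qed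
  finally show ?case by (simp add: algebra_simps)
qed simp

text \<open>Two of the \<open>k + 2\<close> powers pay for summation over \<open>l\<close>; the other \<open>k\<close> survive as decay in \<open>n\<close>.\<close>

lemma power_pair_bound:
  fixes n l k :: nat
  assumes "n \<ge> 1"
  shows "1 / real (n + l) ^ (k + 2) \<le> (1 / real n ^ k) * (1 / real (Suc l) ^ 2)"
proof -
  have "real n ^ k * real (Suc l) ^ 2 \<le> real (n + l) ^ k * real (n + l) ^ 2"
    using assms by (intro mult_mono power_mono) auto
  moreover have "0 < real n ^ k * real (Suc l) ^ 2" using assms by simp
  ultimately have "1 / (real (n + l) ^ k * real (n + l) ^ 2) \<le> 1 / (real n ^ k * real (Suc l) ^ 2)"
    by (intro divide_left_mono) auto
  then show ?thesis unfolding power_add by (simp only: times_divide_times_eq mult_1)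
qed

definition zeta2 :: real where "zeta2 = (\<Sum>l. 1 / real (Suc l) ^ 2)"

lemma zeta2_summable: "summable (\<lambda>l. 1 / real (Suc l) ^ 2)"
  using inverse_power_summable[of 2, where 'a = real]
  by (subst summable_Suc_iff[of "\<lambda>n. 1 / (real n)\<^sup>2"]) (simp add: field_simps)

lemma zeta2_nonneg: "0 \<le> zeta2"
  unfolding zeta2_def by (intro suminf_nonneg zeta2_summable) auto

text \<open>The single step with all parameters explicit; \<open>s\<close> is the distance up to which \<open>F\<close> is known to vanish
around \<open>U\<close>. With \<open>W\<close> the comb of width \<open>2 b\<close>, the new function is the \<open>K\<close>-fold average of
\<open>F G\<close> cut off on \<open>W\<close>. The total averaging radius \<open>K h = b / (4 N)\<close> is small enough that zeros
survive near \<open>U\<close> and near the comb of width \<open>b\<close>.\<close>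

lemma product_step:
  fixes N J k :: nat
  assumes F: "bounded_periodic 1 F" and L: "0 \<le> Lp" "\<And>s t. norm (F s - F t) \<le> Lp * \<bar>s - t\<bar>"
    and C: "0 \<le> C" "\<And>n::int. n \<noteq> 0 \<Longrightarrow> norm (fcoeff F n) \<le> C / \<bar>of_int n\<bar> ^ (k + 2)"
    and U: "\<And>t u. u \<in> U \<Longrightarrow> \<bar>t - u\<bar> < s \<Longrightarrow> F t = 0"
    and K: "K = k + 3"
    and NJ: "1 \<le> N" "J \<le> N" and b: "0 < b" "b \<le> 1/2"
    and h: "0 < h" "4 * real N * real K * h = b" "real K * h \<le> s / 2"
    and \<delta>: "0 < \<delta>" and \<tau>: "0 < \<tau>" "\<tau> * h ^ K \<le> 1"
    and small: "300 * b * (- ln (\<tau> * h ^ K)) * real J \<le> \<delta>\<^sup>2 / 2"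
  obtains F' where
    "bounded_periodic 1 F'"
    "\<And>s t. norm (F' s - F' t) \<le> 1 / h * \<bar>s - t\<bar>"
    "\<And>n::int. n \<noteq> 0 \<Longrightarrow> norm (fcoeff F' n) \<le> (1 / h ^ K) / \<bar>of_int n\<bar> ^ K"
    "\<And>t u. u \<in> U \<Longrightarrow> \<bar>t - u\<bar> < s / 2 \<Longrightarrow> F' t = 0"
    "\<And>t u. u \<in> comb N J b \<Longrightarrow> \<bar>t - u\<bar> < b / (4 * real N) \<Longrightarrow> F' t = 0"
    "(LINT t|unit_leb. norm (F' t - F t)) \<le> \<delta> + 8 * b * J + real K * (h * Lp)"
    "\<And>n::nat. n \<ge> 1 \<Longrightarrow> norm (fcoeff F' (int n) - fcoeff F (int n))
        \<le> (\<delta> * C * zeta2 + \<tau> + C * K * 2 * pi * h) / real n ^ k"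
proof -
  define E where "E = - ln (\<tau> * h ^ K)"
  define W where "W = comb N J (2 * b)"
  have E: "0 \<le> E" "exp (- E) = \<tau> * h ^ K"
    using \<tau> h by (simp_all add: E_def)
  obtain G a where G: "bounded_periodic 1 G" "\<And>t. t \<in> W \<Longrightarrow> norm (G t) \<le> exp (- E)"
    and a: "summable (\<lambda>l. norm (a l))" "\<And>t. (\<lambda>l. a l * turn (- (of_nat l * t))) sums G t"
      "a 0 = of_real (exp (- (300 * b * E * J)))"
    using outer_barrier[OF NJ(1) b E(1), of J] unfolding W_def by blast
  have K1: "K \<ge> 1" using K by simp
  have h1: "h \<le> 1"
  proof -
    have "h * 1 \<le> h * (4 * real N * real K)" using NJ K1 h(1)
      by (intro mult_left_mono) (auto intro: order_trans[of 1 "real K"] simp: mult_ge1_I)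
    then show ?thesis using h(2) b by (simp add: mult_ac)
  qed
  define d where "d l = a l - (if l = 0 then 1 else 0)" for l
  define D where "D t = G t - 1" for t
  have one: "bounded_periodic 1 (\<lambda>_. 1)" by (simp add: bounded_periodic_def)
  have D: "bounded_periodic 2 D"
    unfolding D_def using periodic_diff[OF G(1) one] by simp
  have dsum: "(\<lambda>l. d l * turn (- (of_nat l * t))) sums D t" for t
  proof -
    have "(\<lambda>l. if l = 0 then 1 else 0) sums (1::complex)"
      using sums_single[of 0 "\<lambda>_. 1::complex"] by simp
    from sums_diff[OF a(2)[of t] this]
    have "(\<lambda>l. a l * turn (- (real l * t)) - (if l = 0 then 1 else 0)) sums D t"
      by (simp only: D_def)
    moreover have "(\<lambda>l. a l * turn (- (real l * t)) - (if l = 0 then 1 else 0)) = (\<lambda>l. d l * turn (- (real l * t)))"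
      by (auto simp: d_def algebra_simps)
    ultimately show ?thesis by simp
  qed
  have dsummable: "summable (\<lambda>l. norm (d l))"
    using summable_ignore_initial_segment[OF a(1), of 1]
    by (subst summable_Suc_iff[symmetric]) (simp add: d_def)
  have intD: "(LINT t|unit_leb. norm (D t)) \<le> \<delta>"
  proof -
    have fcG: "fcoeff G 0 = a 0"
    proof -
      have "(\<lambda>l. a l * fcoeff (\<lambda>_. 1) (0 + int l)) sums fcoeff (\<lambda>t. 1 * G t) 0"
        by (rule fcoeff_mult_series[OF one a(1,2)])
      moreover have "(\<lambda>l. a l * fcoeff (\<lambda>_. 1) (0 + int l)) = (\<lambda>l. if l = 0 then a l else 0)"
        by (auto simp: fcoeff_const_1)
      ultimately show ?thesis using sums_unique2 sums_single[of 0 a] by fastforce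
    qed
    have IG: "integrable unit_leb G" by (rule periodic_integrable[OF G(1)])
    have intReG: "(LINT t|unit_leb. Re (G t)) = exp (- (300 * b * E * J))"
      using fcG a(3) by (simp add: fcoeff_def integral_Re[OF IG])
    \<comment> \<open>Since norm (G t) is at most one, the square of norm (G t - 1) is at most 2 - 2 Re (G t);
      the inequality of arithmetic and geometric means then replaces Cauchy-Schwarz.\<close>
    have pt: "norm (D t) \<le> \<delta> / 2 + (1 - Re (G t)) / \<delta>" for t
    proof -
      have "(norm (G t))\<^sup>2 \<le> 1" using G(1) by (auto simp: bounded_periodic_def abs_square_le_1)
      then have sq: "(norm (D t))\<^sup>2 \<le> 2 - 2 * Re (G t)"
        unfolding D_def cmod_power2 by (simp add: power2_eq_square algebra_simps)
      have "0 \<le> (norm (D t) - \<delta>)\<^sup>2" by simp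
      then have "2 * \<delta> * norm (D t) \<le> \<delta>\<^sup>2 + (2 - 2 * Re (G t))"
        using sq by (simp add: power2_diff algebra_simps)
      then show ?thesis using \<delta> by (simp add: field_simps power2_eq_square)
    qed
    have cst: "integrable unit_leb (\<lambda>t. c)" for c :: real
      by (rule finite_measure.integrable_const[OF finite_measure_unit_leb])
    have IR: "integrable unit_leb (\<lambda>t. Re (G t) / \<delta>)"
      by (intro integrable_divide_zero impI integrable_Re IG)
    have "(LINT t|unit_leb. norm (D t)) \<le> (LINT t|unit_leb. (\<delta> / 2 + 1 / \<delta>) - Re (G t) / \<delta>)"
    proof (rule integral_mono)
      show "integrable unit_leb (\<lambda>t. norm (D t))" by (intro integrable_norm periodic_integrable[OF D])
      show "integrable unit_leb (\<lambda>t. (\<delta> / 2 + 1 / \<delta>) - Re (G t) / \<delta>)"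
        by (intro Bochner_Integration.integrable_diff cst IR)
      show "norm (D t) \<le> (\<delta> / 2 + 1 / \<delta>) - Re (G t) / \<delta>" for t
        using pt[of t] by (simp add: diff_divide_distrib)
    qed
    also have "\<dots> = (\<delta> / 2 + 1 / \<delta>) - exp (- (300 * b * E * J)) / \<delta>"
      by (subst Bochner_Integration.integral_diff[OF cst IR]) (simp add: intReG)
    also have "\<dots> = \<delta> / 2 + (1 - exp (- (300 * b * E * J))) / \<delta>"
      by (simp add: diff_divide_distrib)
    also have "\<dots> \<le> \<delta> / 2 + (\<delta>\<^sup>2 / 2) / \<delta>"
    proof -
      have "1 - exp (- (300 * b * E * J)) \<le> 300 * b * E * J"
        using exp_ge_add_one_self[of "- (300 * b * E * J)"] by simp
      also have "\<dots> \<le> \<delta>\<^sup>2 / 2" using small by (simp add: E_def)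
      finally show ?thesis using \<delta> by (intro add_left_mono divide_right_mono) auto
    qed
    also have "\<dots> = \<delta>" using \<delta> by (simp add: power2_eq_square)
    finally show ?thesis .
  qed
  have d_le: "norm (d l) \<le> \<delta>" for l
    using series_coeff_le_integral[OF dsummable dsum, of l] intD by linarith
  have Wm [measurable]: "W \<in> sets borel" by (simp add: W_def open_comb)
  define V where "V t = (if t \<in> W then F t * G t else 0)" for t
  define G0 where "G0 t = (if t \<in> W then 0 else F t * G t)" for t
  note FG = periodic_mult[OF F G(1)]
  have V: "bounded_periodic (exp (- E)) V"
    unfolding bounded_periodic_def
  proof (intro conjI allI)
    show "V \<in> borel_measurable borel"
      using FG unfolding V_def bounded_periodic_def by (auto intro!: measurable_If_set)
    show "V (t + 1) = V t" for t
      using FG by (simp add: V_def W_def comb_add_1 bounded_periodic_def)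
    show "norm (V t) \<le> exp (- E)" for t
    proof (cases "t \<in> W")
      case True
      have "norm (F t) * norm (G t) \<le> 1 * exp (- E)"
        using F G(2)[OF True] by (intro mult_mono) (auto simp: bounded_periodic_def)
      then show ?thesis using True by (simp add: V_def norm_mult)
    qed (simp add: V_def)
  qed
  have G0: "bounded_periodic 1 G0"
    unfolding bounded_periodic_def
  proof (intro conjI allI)
    show "G0 \<in> borel_measurable borel"
      using FG unfolding G0_def bounded_periodic_def by (auto intro!: measurable_If_set)
    show "G0 (t + 1) = G0 t" for t
      using FG by (simp add: G0_def W_def comb_add_1 bounded_periodic_def)
    show "norm (G0 t) \<le> 1" for t
      using FG by (simp add: G0_def bounded_periodic_def)
  qed
  define F' where "F' = box_iter K h G0"
  have P': "bounded_periodic 1 F'"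
    unfolding F'_def by (rule periodic_box_iter[OF G0 h(1)])
  have lip': "norm (F' s - F' t) \<le> 1 / h * \<bar>s - t\<bar>" for s t
  proof -
    obtain K' where "K = Suc K'" using K1 by (cases K) auto
    then show ?thesis
      using box_avg_lipschitz[OF periodic_box_iter[OF G0 h(1), of K'] h(1)] by (simp add: F'_def)
  qed
  have fcF': "fcoeff F' n = of_real (box_sinc h n ^ K) * fcoeff G0 n" for n
    unfolding F'_def by (rule fcoeff_box_iter[OF G0 h(1) h1])
  have sgK: "\<bar>box_sinc h n\<bar> ^ K \<le> (1 / h ^ K) / \<bar>of_int n\<bar> ^ K" if "n \<noteq> 0" for n
  proof -
    have "\<bar>box_sinc h n\<bar> \<le> 1 / (2 * \<bar>of_int n\<bar> * h)" by (rule abs_box_sinc_le[OF that h(1)])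
    also have "\<dots> \<le> 1 / (\<bar>of_int n\<bar> * h)" using that h(1) by (intro divide_left_mono) auto
    finally have "\<bar>box_sinc h n\<bar> ^ K \<le> (1 / (\<bar>of_int n\<bar> * h)) ^ K" by (intro power_mono) auto
    then show ?thesis by (simp add: power_divide power_mult_distrib mult.commute)
  qed
  have decay': "norm (fcoeff F' n) \<le> (1 / h ^ K) / \<bar>of_int n\<bar> ^ K" if "n \<noteq> 0" for n
  proof -
    have "norm (fcoeff F' n) = \<bar>box_sinc h n\<bar> ^ K * norm (fcoeff G0 n)"
      by (simp add: fcF' norm_mult norm_power)
    also have "\<dots> \<le> \<bar>box_sinc h n\<bar> ^ K * 1"
      using norm_fcoeff_le[OF G0, of n] by (intro mult_left_mono) auto
    finally show ?thesis using sgK[OF that] by simp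
  qed
  have vanU: "F' t = 0" if "u \<in> U" "\<bar>t - u\<bar> < s / 2" for t u
    unfolding F'_def
  proof (rule box_iter_eq_0)
    fix v assume "\<bar>v\<bar> \<le> real K * h"
    then have "\<bar>t + v - u\<bar> < s" using that(2) h(3) by linarith
    then show "G0 (t + v) = 0" using U[OF that(1)] by (simp add: G0_def)
  qed
  have vanC: "F' t = 0" if uC: "u \<in> comb N J b" and tu: "\<bar>t - u\<bar> < b / (4 * real N)" for t u
    unfolding F'_def
  proof (rule box_iter_eq_0)
    fix v assume v: "\<bar>v\<bar> \<le> real K * h"
    obtain j i where j: "j < J" and i: "\<bar>real (N + j) * u - of_int i\<bar> < b"
      using uC by (auto simp: comb_def near_int_def)
    have Kh: "real K * h = b / (4 * real N)" using h(2) NJ by (simp add: field_simps)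
    have "\<bar>t + v - u\<bar> \<le> b / (2 * real N)"
      using v tu Kh by (simp add: field_simps)
    then have "real (N + j) * \<bar>t + v - u\<bar> \<le> (2 * real N) * (b / (2 * real N))"
      using j NJ b by (intro mult_mono) auto
    also have "\<dots> = b" using NJ by simp
    finally have "\<bar>real (N + j) * (t + v - u)\<bar> \<le> b" by (simp add: abs_mult)
    then have "\<bar>real (N + j) * (t + v) - of_int i\<bar> < 2 * b"
      using i by (simp add: right_diff_distrib)
    then have "t + v \<in> W" using j by (auto simp: W_def comb_def near_int_def)
    then show "G0 (t + v) = 0" by (simp add: G0_def)
  qed
  have L1: "(LINT t|unit_leb. norm (F' t - F t)) \<le> \<delta> + 8 * b * J + real K * (h * Lp)"
  proof -
    note P1 = periodic_diff[OF G0 F]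
    note P2 = periodic_diff[OF periodic_box_iter[OF F h(1), of K] F]
    have i1: "integrable unit_leb (\<lambda>t. norm (box_iter K h (\<lambda>t. G0 t - F t) t))"
      by (intro integrable_norm periodic_integrable[OF periodic_box_iter[OF P1 h(1)]])
    have cst: "integrable unit_leb (\<lambda>t. c)" for c :: real
      by (rule finite_measure.integrable_const[OF finite_measure_unit_leb])
    have "(LINT t|unit_leb. norm (F' t - F t))
        \<le> (LINT t|unit_leb. norm (box_iter K h (\<lambda>t. G0 t - F t) t) + real K * (h * Lp))"
    proof (rule integral_mono)
      show "integrable unit_leb (\<lambda>t. norm (F' t - F t))"
        by (intro integrable_norm periodic_integrable[OF periodic_diff[OF P' F]])
      show "integrable unit_leb (\<lambda>t. norm (box_iter K h (\<lambda>t. G0 t - F t) t) + real K * (h * Lp))"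
        by (intro Bochner_Integration.integrable_add i1 cst)
      fix t
      have "F' t - F t = box_iter K h (\<lambda>t. G0 t - F t) t + (box_iter K h F t - F t)"
        by (simp add: box_iter_diff[OF G0 F h(1)] F'_def)
      then have "norm (F' t - F t) \<le> norm (box_iter K h (\<lambda>t. G0 t - F t) t) + norm (box_iter K h F t - F t)"
        by (simp only: norm_triangle_ineq)
      also have "norm (box_iter K h F t - F t) \<le> real K * (h * Lp)"
        by (rule norm_box_iter_minus_le[OF F h(1) L])
      finally show "norm (F' t - F t) \<le> norm (box_iter K h (\<lambda>t. G0 t - F t) t) + real K * (h * Lp)" by simp
    qed
    also have "\<dots> = (LINT t|unit_leb. norm (box_iter K h (\<lambda>t. G0 t - F t) t)) + real K * (h * Lp)"
      using i1 cst by (subst Bochner_Integration.integral_add) simp_all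
    also have "(LINT t|unit_leb. norm (box_iter K h (\<lambda>t. G0 t - F t) t)) \<le> (LINT t|unit_leb. norm (G0 t - F t))"
      by (rule box_iter_L1_contraction[OF P1 h(1) h1])
    also have "(LINT t|unit_leb. norm (G0 t - F t)) \<le> (LINT t|unit_leb. norm (D t) + indicator W t)"
    proof (rule integral_mono)
      show "integrable unit_leb (\<lambda>t. norm (G0 t - F t))"
        by (intro integrable_norm periodic_integrable[OF P1])
      show "integrable unit_leb (\<lambda>t. norm (D t) + indicator W t)"
        by (intro Bochner_Integration.integrable_add integrable_norm periodic_integrable[OF D] integrable_unit_leb[of _ 1])
           (auto simp: indicator_def)
      fix t
      have F1: "norm (F t) \<le> 1" using F by (simp add: bounded_periodic_def)
      show "norm (G0 t - F t) \<le> norm (D t) + indicator W t"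
      proof (cases "t \<in> W")
        case True
        then show ?thesis using F1 by (simp add: G0_def add_increasing)
      next
        case False
        have "norm (F t * D t) \<le> 1 * norm (D t)"
          unfolding norm_mult using F1 by (intro mult_right_mono) auto
        then show ?thesis using False by (simp add: G0_def D_def algebra_simps)
      qed
    qed
    also have "\<dots> = (LINT t|unit_leb. norm (D t)) + (LINT t|unit_leb. indicator W t)"
      by (intro Bochner_Integration.integral_add integrable_norm periodic_integrable[OF D] integrable_unit_leb[of _ 1])
         (auto simp: indicator_def)
    also have "(LINT t|unit_leb. indicator W t) = measure unit_leb (W \<inter> {0..<1})"
      by (simp add: space_restrict_space)
    also have "\<dots> \<le> 4 * (2 * b) * J"
      unfolding W_def by (rule measure_comb_le) (use NJ b in auto)
    finally show ?thesis using intD by simp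
  qed
  have pos: "norm (fcoeff F' (int n) - fcoeff F (int n))
        \<le> (\<delta> * C * zeta2 + \<tau> + C * K * 2 * pi * h) / real n ^ k" if n: "n \<ge> 1" for n :: nat
  proof -
    let ?n = "int n"
    define x where "x = box_sinc h ?n ^ K"
    define S where "S = fcoeff (\<lambda>t. F t * D t) ?n"
    have FD: "bounded_periodic (1 * 2) (\<lambda>t. F t * D t)" by (rule periodic_mult[OF F D])
    \<comment> \<open>The increment splits into the effect of G - 1 on F, the part of F G cut off, and the effect of
      averaging on F itself.\<close>
    have "G0 = (\<lambda>t. (F t * D t - V t) - (- F t))"
      by (auto simp: G0_def V_def D_def algebra_simps)
    moreover have mF: "bounded_periodic 1 (\<lambda>t. - F t)" using F by (auto simp: bounded_periodic_def)
    moreover have "fcoeff (\<lambda>t. - F t) ?n = - fcoeff F ?n" by (simp add: fcoeff_def)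
    ultimately have fcG0: "fcoeff G0 ?n = S - fcoeff V ?n + fcoeff F ?n"
      using fcoeff_diff[OF periodic_diff[OF FD V] mF] fcoeff_diff[OF FD V] by (simp add: S_def)
    have x1: "\<bar>x\<bar> \<le> 1"
      unfolding x_def power_abs using abs_box_sinc_le_1[of h ?n] by (intro power_le_one) auto
    have xK: "\<bar>x\<bar> \<le> (1 / h ^ K) / real n ^ K"
      using sgK[of ?n] n by (simp add: x_def power_abs)
    have xm1: "\<bar>x - 1\<bar> \<le> K * (2 * pi * real n * h)"
    proof -
      have "\<bar>box_sinc h ?n ^ K - 1 ^ K\<bar> \<le> K * \<bar>box_sinc h ?n - 1\<bar>"
        using norm_power_diff[of "box_sinc h ?n" 1 K] abs_box_sinc_le_1[of h ?n] by simp
      also have "\<dots> \<le> K * (2 * pi * real n * h)"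
        using abs_box_sinc_minus_1_le[OF h(1), of ?n] by (intro mult_left_mono) auto
      finally show ?thesis by (simp add: x_def)
    qed
    have Cn: "norm (fcoeff F (?n + int l)) \<le> C * ((1 / real n ^ k) * (1 / real (Suc l) ^ 2))" for l
    proof -
      have "norm (fcoeff F (?n + int l)) \<le> C / real (n + l) ^ (k + 2)"
        using C(2)[of "?n + int l"] n by simp
      also have "\<dots> = C * (1 / real (n + l) ^ (k + 2))" by simp
      also have "\<dots> \<le> C * ((1 / real n ^ k) * (1 / real (Suc l) ^ 2))"
        using C(1) power_pair_bound[OF n] by (intro mult_left_mono) auto
      finally show ?thesis .
    qed
    have S: "norm S \<le> \<delta> * C * zeta2 / real n ^ k"
    proof -
      have sums: "(\<lambda>l. d l * fcoeff F (?n + int l)) sums S"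
        unfolding S_def by (rule fcoeff_mult_series[OF F dsummable dsum])
      let ?m = "\<lambda>l. \<delta> * C * (1 / real n ^ k) * (1 / real (Suc l) ^ 2)"
      have le: "norm (d l * fcoeff F (?n + int l)) \<le> ?m l" for l
      proof -
        have "norm (d l) * norm (fcoeff F (?n + int l)) \<le> \<delta> * (C * ((1 / real n ^ k) * (1 / real (Suc l) ^ 2)))"
          using d_le Cn \<delta> by (intro mult_mono) auto
        then show ?thesis by (simp add: norm_mult mult.assoc)
      qed
      have "norm S = norm (\<Sum>l. d l * fcoeff F (?n + int l))" using sums_unique[OF sums] by simp
      also have "\<dots> \<le> (\<Sum>l. ?m l)"
        by (rule norm_suminf_le[OF le]) (intro summable_mult zeta2_summable)
      also have "\<dots> = \<delta> * C * (1 / real n ^ k) * zeta2"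
        unfolding zeta2_def by (rule suminf_mult[OF zeta2_summable])
      finally show ?thesis by simp
    qed
    have xV: "\<bar>x\<bar> * norm (fcoeff V ?n) \<le> \<tau> / real n ^ k"
    proof -
      have "\<bar>x\<bar> * norm (fcoeff V ?n) \<le> ((1 / h ^ K) / real n ^ K) * (\<tau> * h ^ K)"
        using xK norm_fcoeff_le[OF V, of ?n] E(2) h(1) by (intro mult_mono) auto
      also have "\<dots> = \<tau> / real n ^ K" using h(1) by simp
      also have "\<dots> \<le> \<tau> / real n ^ k"
        using n \<tau> K by (intro divide_left_mono power_increasing mult_pos_pos) auto
      finally show ?thesis .
    qed
    have xF: "\<bar>x - 1\<bar> * norm (fcoeff F ?n) \<le> C * K * 2 * pi * h / real n ^ k"
    proof -
      have "\<bar>x - 1\<bar> * norm (fcoeff F ?n) \<le> (K * (2 * pi * real n * h)) * (C / real n ^ (k + 2))"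
        using xm1 C(2)[of ?n] n h(1) by (intro mult_mono) auto
      also have "\<dots> = (C * K * 2 * pi * h) * (real n / real n ^ (k + 2))" by simp
      also have "\<dots> \<le> (C * K * 2 * pi * h) * (1 / real n ^ k)"
      proof (rule mult_left_mono)
        have "real n ^ k * real n \<le> real n ^ k * real n ^ 2"
          using n by (intro mult_left_mono) (auto simp: power2_eq_square)
        then show "real n / real n ^ (k + 2) \<le> 1 / real n ^ k"
          using n by (simp add: divide_simps power_add mult_ac)
      qed (use C h in auto)
      finally show ?thesis by simp
    qed
    have "fcoeff F' ?n - fcoeff F ?n = of_real x * S - of_real x * fcoeff V ?n + of_real (x - 1) * fcoeff F ?n"
      by (simp add: fcF' fcG0 x_def algebra_simps)
    also have "norm \<dots> \<le> \<bar>x\<bar> * norm S + \<bar>x\<bar> * norm (fcoeff V ?n) + \<bar>x - 1\<bar> * norm (fcoeff F ?n)"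
      by (intro order_trans[OF norm_triangle_ineq] add_mono order_trans[OF norm_triangle_ineq4])
         (simp_all add: norm_mult del: of_real_diff)
    also have "\<bar>x\<bar> * norm S \<le> 1 * norm S" using x1 by (intro mult_right_mono) auto
    finally show ?thesis using S xV xF by (simp add: add_divide_distrib)
  qed
  show thesis by (rule that[OF P' lip' decay' vanU vanC L1 pos])
qed

text \<open>The exponents realise \<open>J = D ^ k\<close>, \<open>J b = 1 / D\<close> and \<open>N b\<close> larger than \<open>J powr (3 / 2)\<close>, the last being the
separation of frequencies used in \<open>comb_multiplicity\<close>.\<close>

definition stage_comb :: "nat \<Rightarrow> nat \<Rightarrow> real set" where
  "stage_comb k D = comb (D ^ (3 * k + 2)) (D ^ k) (1 / real D ^ (k + 1))"

text \<open>The data that one stage hands to the next: a Lipschitz bound, decay two orders better than the stage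
number, and vanishing on a whole neighbourhood of \<open>U\<close>, since averaging erodes the zero set.\<close>

definition stage_invariant :: "nat \<Rightarrow> (real \<Rightarrow> complex) \<Rightarrow> real set \<Rightarrow> bool" where
  "stage_invariant k F U \<longleftrightarrow> bounded_periodic 1 F \<and>
     (\<exists>L\<ge>0. \<forall>s t. norm (F s - F t) \<le> L * \<bar>s - t\<bar>) \<and>
     (\<exists>C\<ge>0. \<forall>n::int. n \<noteq> 0 \<longrightarrow> norm (fcoeff F n) \<le> C / \<bar>of_int n\<bar> ^ (k + 2)) \<and>
     (\<exists>s>0. \<forall>u\<in>U. \<forall>t. \<bar>t - u\<bar> < s \<longrightarrow> F t = 0)"

lemma log_over_linear_tendsto:
  "(\<lambda>D. (c1 + c2 * ln (real D)) / real D) \<longlonglongrightarrow> 0"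
proof -
  have "(\<lambda>D. c1 / real D) \<longlonglongrightarrow> 0" by (rule lim_const_over_n)
  moreover have "(\<lambda>D. c2 * (ln (real D) / real D)) \<longlonglongrightarrow> c2 * 0"
    by (intro tendsto_mult_left lim_ln_over_n)
  ultimately have "(\<lambda>D. c1 / real D + c2 * (ln (real D) / real D)) \<longlonglongrightarrow> 0 + c2 * 0"
    by (rule tendsto_add)
  then show ?thesis by (simp add: add_divide_distrib)
qed

text \<open>The tolerances \<open>\<delta>\<close> and \<open>\<tau>\<close> are fixed before \<open>D\<close>. What is then required of \<open>D\<close> is that finitely many
quantities of order \<open>1 / D\<close> or \<open>ln D / D\<close> be small. The logarithm enters through
\<open>- ln (\<tau> * h ^ K)\<close>, the depth of the barrier, where \<open>h\<close> is a power of \<open>1 / D\<close> up to a constant.\<close>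

lemma stage_step:
  assumes st: "stage_invariant k F U" and \<eta>: "0 < \<eta>"
  obtains D F' where "k + 2 \<le> D" "stage_invariant (k + 1) F' (U \<union> stage_comb k D)"
    "4 / real D \<le> \<eta>" "(LINT t|unit_leb. norm (F' t - F t)) \<le> \<eta>"
    "\<And>n::nat. n \<ge> 1 \<Longrightarrow> norm (fcoeff F' (int n) - fcoeff F (int n)) \<le> \<eta> / real n ^ k"
proof -
  have F: "bounded_periodic 1 F"
    and exL: "\<exists>L\<ge>0. \<forall>s t. norm (F s - F t) \<le> L * \<bar>s - t\<bar>"
    and exC: "\<exists>C\<ge>0. \<forall>n::int. n \<noteq> 0 \<longrightarrow> norm (fcoeff F n) \<le> C / \<bar>of_int n\<bar> ^ (k + 2)"
    and exs: "\<exists>s>0. \<forall>u\<in>U. \<forall>t. \<bar>t - u\<bar> < s \<longrightarrow> F t = 0"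
    using st unfolding stage_invariant_def by iprover+
  obtain Lp where L: "0 \<le> Lp" "\<And>s t. norm (F s - F t) \<le> Lp * \<bar>s - t\<bar>"
    using exL by iprover
  obtain C where C: "0 \<le> C" "\<And>n::int. n \<noteq> 0 \<Longrightarrow> norm (fcoeff F n) \<le> C / \<bar>of_int n\<bar> ^ (k + 2)"
    using exC by iprover
  obtain s where s: "s > 0" and U: "\<And>t u. u \<in> U \<Longrightarrow> \<bar>t - u\<bar> < s \<Longrightarrow> F t = 0"
    using exs by blast
  define K where "K = k + 3"
  \<comment> \<open>Both estimates have three contributions, each to be kept below a third of the target.\<close>
  define \<delta> where "\<delta> = \<eta> / (3 * (1 + C * zeta2))"
  define \<tau> where "\<tau> = min 1 (\<eta> / 3)"
  have CZ: "0 \<le> C * zeta2" using C(1) zeta2_nonneg by simp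
  have \<delta>: "0 < \<delta>" "\<delta> \<le> \<eta> / 3" "\<delta> * C * zeta2 \<le> \<eta> / 3"
  proof -
    have e: "\<delta> * (1 + C * zeta2) = \<eta> / 3"
      using CZ by (simp add: \<delta>_def field_simps)
    show "0 < \<delta>" using \<eta> CZ by (simp add: \<delta>_def)
    then have "0 \<le> \<delta> * (C * zeta2)" using CZ by simp
    then show "\<delta> \<le> \<eta> / 3" "\<delta> * C * zeta2 \<le> \<eta> / 3" using e \<open>0 < \<delta>\<close>
      by (simp_all add: distrib_left mult.assoc)
  qed
  have \<tau>: "0 < \<tau>" "\<tau> \<le> 1" "\<tau> \<le> \<eta> / 3" using \<eta> by (auto simp: \<tau>_def)
  define hh where "hh D = 1 / (4 * real K * real D ^ (4 * k + 3))" for D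
  define c1 where "c1 = - ln \<tau> + K * ln (4 * K)"
  define c2 where "c2 = real K * (4 * k + 3)"
  have "eventually (\<lambda>D. 300 * ((c1 + c2 * ln (real D)) / real D) < \<delta>\<^sup>2 / 2) sequentially"
    by (rule order_tendstoD(2)[OF tendsto_mult_left[OF log_over_linear_tendsto]]) (use \<delta>(1) in simp)
  moreover have "eventually (\<lambda>D. c / real D < e) sequentially" if "e > 0" for c e :: real
    using order_tendstoD(2)[OF lim_const_over_n[of c] that] .
  from this[of "\<eta>/3" 8] this[of "\<eta>/3" "K * Lp"] this[of "\<eta>/3" "C * K * 2 * pi"] this[of "s/2" K] \<eta> s
  have "eventually (\<lambda>D. 8 / real D < \<eta>/3) sequentially" "eventually (\<lambda>D. K * Lp / real D < \<eta>/3) sequentially"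
    "eventually (\<lambda>D. C * K * 2 * pi / real D < \<eta>/3) sequentially" "eventually (\<lambda>D. K / real D < s/2) sequentially"
    by auto
  moreover have "eventually (\<lambda>D. D \<ge> k + 2) sequentially" by (rule eventually_ge_at_top)
  ultimately have "eventually (\<lambda>D. 300 * ((c1 + c2 * ln (real D)) / real D) < \<delta>\<^sup>2 / 2 \<and>
     8 / real D < \<eta>/3 \<and> K * Lp / real D < \<eta>/3 \<and> C * K * 2 * pi / real D < \<eta>/3 \<and> K / real D < s/2 \<and> D \<ge> k + 2) sequentially"
    by eventually_elim blast
  then obtain D where D: "300 * ((c1 + c2 * ln (real D)) / real D) < \<delta>\<^sup>2 / 2"
     "8 / real D < \<eta>/3" "K * Lp / real D < \<eta>/3" "C * K * 2 * pi / real D < \<eta>/3" "K / real D < s/2" "D \<ge> k + 2"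
    by (auto simp: eventually_sequentially)
  define N J b h where "N = D ^ (3 * k + 2)" and "J = D ^ k" and "b = 1 / real D ^ (k + 1)" and "h = hh D"
  have D2: "real D \<ge> 2" using D(6) by simp
  have N1: "1 \<le> N" using D(6) by (simp add: N_def)
  have JN: "J \<le> N" unfolding J_def N_def using D(6) by (intro power_increasing) auto
  have b: "0 < b" "b \<le> 1/2"
  proof -
    have "2 * 1 \<le> real D * real D ^ k" using D2 by (intro mult_mono) auto
    then show "0 < b" "b \<le> 1/2" using D2 by (simp_all add: b_def field_simps)
  qed
  have K3: "real K \<ge> 3" by (simp add: K_def)
  have h: "0 < h" using D2 K3 by (simp add: h_def hh_def)
  have hD: "h \<le> 1 / real D"
  proof -
    have "1 * real D ^ 1 \<le> (4 * real K) * real D ^ (4 * k + 3)"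
      using D2 K3 by (intro mult_mono power_increasing) auto
    then show ?thesis using D2 unfolding h_def hh_def by (intro divide_left_mono) auto
  qed
  have hb: "4 * real N * real K * h = b"
  proof -
    have "real D ^ (4 * k + 3) = real D ^ (3 * k + 2) * real D ^ (k + 1)"
      unfolding power_add[symmetric] by (rule arg_cong[of _ _ "power (real D)"]) simp
    moreover have "real D ^ (3 * k + 2) \<noteq> 0" "real D ^ (k + 1) \<noteq> 0" using D2 by simp_all
    ultimately show ?thesis using K3
      unfolding h_def hh_def N_def b_def of_nat_power by (simp del: power_Suc power_add add: divide_simps)
  qed
  have bJ: "b * J = 1 / real D" using D2 by (simp add: b_def J_def)
  have hs: "real K * h \<le> s / 2"
  proof -
    have "real K * h \<le> real K * (1 / real D)" using hD by (intro mult_left_mono) auto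
    also have "\<dots> = K / real D" by simp
    finally show ?thesis using D(5) by linarith
  qed
  have \<tau>h: "\<tau> * h ^ K \<le> 1"
  proof -
    have "1 / real D \<le> 1" using D2 by simp
    then have "h \<le> 1" using hD by linarith
    then have "h ^ K \<le> 1" using h by (intro power_le_one) auto
    then show ?thesis using \<tau> h by (intro mult_le_one) auto
  qed
  have lnt: "- ln (\<tau> * h ^ K) = c1 + c2 * ln (real D)"
  proof -
    have "ln h = - ln (4 * real K * real D ^ (4 * k + 3))"
      using D2 K3 by (simp add: h_def hh_def ln_div)
    also have "\<dots> = - (ln (4 * real K) + real (4 * k + 3) * ln (real D))"
      using D2 K3 by (simp add: ln_mult ln_realpow)
    finally have lh: "ln h = - (ln (4 * real K) + real (4 * k + 3) * ln (real D))" .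
    have "ln (\<tau> * h ^ K) = ln \<tau> + K * ln h"
      using \<tau> h by (simp add: ln_mult ln_realpow)
    then show ?thesis unfolding lh by (simp add: c1_def c2_def algebra_simps)
  qed
  have "300 * b * X * real J = 300 * (X / real D)" for X
  proof -
    have "300 * b * X * real J = 300 * (X * (b * real J))" by (simp only: mult_ac)
    then show ?thesis by (simp add: bJ)
  qed
  from this[of "- ln (\<tau> * h ^ K)"]
  have "300 * b * (- ln (\<tau> * h ^ K)) * real J = 300 * ((c1 + c2 * ln (real D)) / real D)"
    by (simp only: lnt)
  then have small: "300 * b * (- ln (\<tau> * h ^ K)) * real J \<le> \<delta>\<^sup>2 / 2" using D(1) by simp
  obtain F' where F': "bounded_periodic 1 F'"
    "\<And>s t. norm (F' s - F' t) \<le> 1 / h * \<bar>s - t\<bar>"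
    "\<And>n::int. n \<noteq> 0 \<Longrightarrow> norm (fcoeff F' n) \<le> (1 / h ^ K) / \<bar>of_int n\<bar> ^ K"
    "\<And>t u. u \<in> U \<Longrightarrow> \<bar>t - u\<bar> < s / 2 \<Longrightarrow> F' t = 0"
    "\<And>t u. u \<in> comb N J b \<Longrightarrow> \<bar>t - u\<bar> < b / (4 * real N) \<Longrightarrow> F' t = 0"
    "(LINT t|unit_leb. norm (F' t - F t)) \<le> \<delta> + 8 * b * J + real K * (h * Lp)"
    "\<And>n::nat. n \<ge> 1 \<Longrightarrow> norm (fcoeff F' (int n) - fcoeff F (int n))
        \<le> (\<delta> * C * zeta2 + \<tau> + C * K * 2 * pi * h) / real n ^ k"
  proof (rule product_step)
    show "bounded_periodic 1 F" "0 \<le> Lp" "0 \<le> C" by fact+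
    show "norm (F s - F t) \<le> Lp * \<bar>s - t\<bar>" for s t by (rule L(2))
    show "norm (fcoeff F n) \<le> C / \<bar>of_int n\<bar> ^ (k + 2)" if "n \<noteq> 0" for n :: int by (rule C(2)[OF that])
    show "F t = 0" if "u \<in> U" "\<bar>t - u\<bar> < s" for t u by (rule U[OF that])
    show "K = k + 3" by (rule K_def)
    show "1 \<le> N" "J \<le> N" "0 < b" "b \<le> 1/2" "0 < h" "4 * real N * real K * h = b" "real K * h \<le> s / 2"
      "0 < \<delta>" "0 < \<tau>" "\<tau> * h ^ K \<le> 1" "300 * b * (- ln (\<tau> * h ^ K)) * real J \<le> \<delta>\<^sup>2 / 2"
      by (fact N1 JN b h hb hs \<delta>(1) \<tau>(1) \<tau>h small)+
  qed (rule that)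
  have st': "stage_invariant (k + 1) F' (U \<union> stage_comb k D)"
    unfolding stage_invariant_def
  proof (intro conjI F'(1))
    show "\<exists>L\<ge>0. \<forall>s t. norm (F' s - F' t) \<le> L * \<bar>s - t\<bar>"
      using F'(2) h by (intro exI[of _ "1/h"]) auto
    have "K = k + 1 + 2" by (simp add: K_def)
    then show "\<exists>C\<ge>0. \<forall>n::int. n \<noteq> 0 \<longrightarrow> norm (fcoeff F' n) \<le> C / \<bar>of_int n\<bar> ^ (k + 1 + 2)"
      using F'(3) h by (intro exI[of _ "1/h^K"]) auto
    have "b / (4 * real N) > 0" using b N1 by simp
    then show "\<exists>s>0. \<forall>u\<in>U \<union> stage_comb k D. \<forall>t. \<bar>t - u\<bar> < s \<longrightarrow> F' t = 0"
      using F'(4,5) s by (intro exI[of _ "min (s/2) (b / (4 * real N))"]) (auto simp: stage_comb_def N_def J_def b_def)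
  qed
  show thesis
  proof (rule that[OF D(6) st'])
    show "4 / real D \<le> \<eta>" using D(2) D2 \<eta> by (simp add: field_simps)
    have "real K * (h * Lp) \<le> real K * ((1 / real D) * Lp)"
      using hD L(1) by (intro mult_left_mono mult_right_mono) auto
    also have "\<dots> < \<eta> / 3" using D(3) by simp
    finally have "real K * (h * Lp) \<le> \<eta> / 3" by simp
    moreover have "8 * b * J \<le> \<eta> / 3" using D(2) bJ by (simp add: mult.assoc)
    ultimately show "(LINT t|unit_leb. norm (F' t - F t)) \<le> \<eta>" using F'(6) \<delta>(2) by linarith
    fix n :: nat assume n: "n \<ge> 1"
    have "C * K * 2 * pi * h \<le> C * K * 2 * pi * (1 / real D)"
      using hD C(1) by (intro mult_left_mono) auto
    also have "\<dots> < \<eta> / 3" using D(4) by simp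
    finally have "\<delta> * C * zeta2 + \<tau> + C * K * 2 * pi * h \<le> \<eta>" using \<delta>(3) \<tau>(3) by linarith
    then have "(\<delta> * C * zeta2 + \<tau> + C * K * 2 * pi * h) / real n ^ k \<le> \<eta> / real n ^ k"
      by (intro divide_right_mono) auto
    then show "norm (fcoeff F' (int n) - fcoeff F (int n)) \<le> \<eta> / real n ^ k"
      using F'(7)[OF n] by linarith
  qed
qed

section \<open>The limit function\<close>

lemma measure_stage_comb_le:
  assumes "D \<ge> 1"
  shows "measure unit_leb (stage_comb k D \<inter> {0..<1}) \<le> 4 / D"
proof -
  have "1 \<le> real D ^ (k + 1)" using assms by (intro one_le_power) simp
  then have "1 / real D ^ (k + 1) \<le> 1" by (subst divide_le_eq_1) auto
  then have "measure unit_leb (stage_comb k D \<inter> {0..<1}) \<le> 4 * (1 / real D ^ (k + 1)) * real (D ^ k)"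
    unfolding stage_comb_def using assms by (intro measure_comb_le) (auto simp del: power_Suc)
  also have "\<dots> = 4 / D" using assms by simp
  finally show ?thesis .
qed

lemma stage_invariant_0: "stage_invariant 0 (\<lambda>_. 1) {}"
  unfolding stage_invariant_def
  by (auto simp: bounded_periodic_def fcoeff_const_1 intro!: exI[of _ 0] exI[of _ 1])

lemma exists_stage_sequence:
  assumes \<eta>: "\<And>k::nat. 0 < \<eta> k"
  obtains F :: "nat \<Rightarrow> real \<Rightarrow> complex" and U :: "nat \<Rightarrow> real set" and D :: "nat \<Rightarrow> nat" where
    "F 0 = (\<lambda>_. 1)" "\<And>k. stage_invariant k (F k) (U k)" "\<And>k. k + 2 \<le> D k" "\<And>k. U (Suc k) = U k \<union> stage_comb k (D k)"
    "\<And>k. 4 / real (D k) \<le> \<eta> k" "\<And>k. (LINT t|unit_leb. norm (F (Suc k) t - F k t)) \<le> \<eta> k"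
    "\<And>k n::nat. n \<ge> 1 \<Longrightarrow> norm (fcoeff (F (Suc k)) (int n) - fcoeff (F k) (int n)) \<le> \<eta> k / real n ^ k"
proof -
  let ?P = "\<lambda>k (x :: (real \<Rightarrow> complex) \<times> real set).
      stage_invariant k (fst x) (snd x) \<and> (k = 0 \<longrightarrow> fst x = (\<lambda>_. 1))"
  let ?R = "\<lambda>k F U F' U' D. k + 2 \<le> D \<and> U' = U \<union> stage_comb k D \<and> 4 / real D \<le> \<eta> k \<and>
      (LINT t|unit_leb. norm (F' t - F t)) \<le> \<eta> k \<and>
      (\<forall>n::nat. n \<ge> 1 \<longrightarrow> norm (fcoeff F' (int n) - fcoeff F (int n)) \<le> \<eta> k / real n ^ k)"
  let ?Q = "\<lambda>k x y. \<exists>D. ?R k (fst x) (snd x) (fst y) (snd y) D"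
  have "\<exists>X. \<forall>k. ?P k (X k) \<and> ?Q k (X k) (X (Suc k))"
  proof (rule dependent_nat_choice)
    show "\<exists>x. ?P 0 x" using stage_invariant_0 by (intro exI[of _ "(\<lambda>_. 1, {})"]) simp
  next
    fix x k assume "?P k x"
    then have "stage_invariant k (fst x) (snd x)" by simp
    then show "\<exists>y. ?P (Suc k) y \<and> ?Q k x y"
    proof (rule stage_step[OF _ \<eta>[of k]])
      fix D F' assume *: "k + 2 \<le> D" "stage_invariant (k + 1) F' (snd x \<union> stage_comb k D)"
        "4 / real D \<le> \<eta> k" "(LINT t|unit_leb. norm (F' t - fst x t)) \<le> \<eta> k"
        "\<And>n::nat. n \<ge> 1 \<Longrightarrow> norm (fcoeff F' (int n) - fcoeff (fst x) (int n)) \<le> \<eta> k / real n ^ k"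
      then show ?thesis
        by (intro exI[of _ "(F', snd x \<union> stage_comb k D)"]) auto
    qed
  qed
  then obtain X where X: "\<forall>k. ?P k (X k) \<and> ?Q k (X k) (X (Suc k))" by (rule exE)
  then have "\<forall>k. ?Q k (X k) (X (Suc k))" by simp
  from choice[OF this] obtain D
    where D: "\<forall>k. ?R k (fst (X k)) (snd (X k)) (fst (X (Suc k))) (snd (X (Suc k))) (D k)" by (rule exE)
  show thesis
    by (rule that[of "\<lambda>k. fst (X k)" "\<lambda>k. snd (X k)" D]) (use X D in auto)
qed

lemma sum_geometric_le:
  fixes \<epsilon> :: real
  assumes "0 < \<epsilon>"
  shows "(\<Sum>i=k..<m. \<epsilon> / 4 * (1/2) ^ i) \<le> \<epsilon> / 2"
proof -
  have "(\<Sum>i=k..<m. \<epsilon> / 4 * (1/2) ^ i) \<le> (\<Sum>i<m. \<epsilon> / 4 * (1/2) ^ i)"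
    using assms by (intro sum_mono2) auto
  also have "\<dots> = \<epsilon> / 4 * (\<Sum>i<m. (1/2) ^ i)" by (simp add: sum_distrib_left)
  also have "(\<Sum>i<m. (1/2::real) ^ i) \<le> 2"
    by (subst sum_gp_strict) (auto simp: field_simps)
  finally show ?thesis using assms by simp
qed

text \<open>The increments are summable in \<open>L\<^sup>1\<close>, hence the functions converge almost everywhere; on the
exceptional set they are replaced by zero. For decay of order \<open>k\<close> start from the \<open>k\<close>-th function,
whose coefficients decay fast enough, and add the later increments, each of which is of order at
least \<open>k\<close> with a summable constant.\<close>

lemma limit_function:
  fixes \<epsilon> :: real
  assumes \<epsilon>: "0 < \<epsilon>" "\<epsilon> < 1"
  obtains D :: "nat \<Rightarrow> nat" and f :: "real \<Rightarrow> complex" where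
    "\<And>k. k + 2 \<le> D k" "measure unit_leb ((\<Union>k. stage_comb k (D k)) \<inter> {0..<1}) < \<epsilon>"
    "bounded_periodic 1 f" "\<And>k t. t \<in> stage_comb k (D k) \<Longrightarrow> f t = 0" "fcoeff f 0 \<noteq> 0"
    "\<And>k. \<exists>C>0. \<forall>n::nat. n \<ge> 1 \<longrightarrow> norm (fcoeff f (int n)) \<le> C / real n ^ k"
proof -
  define \<eta> where "\<eta> k = \<epsilon> / 4 * (1/2) ^ k" for k :: nat
  have \<eta>0: "0 < \<eta> k" for k using \<epsilon> by (simp add: \<eta>_def)
  have \<eta>sum: "(\<Sum>i=k..<m. \<eta> i) \<le> \<epsilon> / 2" for k m
    unfolding \<eta>_def by (rule sum_geometric_le[OF \<epsilon>(1)])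
  have \<eta>summable: "summable \<eta>" unfolding \<eta>_def by (intro summable_mult summable_geometric) simp
  have \<eta>suminf: "suminf \<eta> \<le> \<epsilon> / 2"
    using \<eta>sum[of 0] by (intro suminf_le_const[OF \<eta>summable]) (simp add: lessThan_atLeast0)
  obtain F U D where F0: "F 0 = (\<lambda>_. 1)" and st: "\<And>k. stage_invariant k (F k) (U k)" and D: "\<And>k. k + 2 \<le> D k"
    and U: "\<And>k. U (Suc k) = U k \<union> stage_comb k (D k)"
    and D4: "\<And>k. 4 / real (D k) \<le> \<eta> k" and L1: "\<And>k. (LINT t|unit_leb. norm (F (Suc k) t - F k t)) \<le> \<eta> k"
    and fcd: "\<And>k n::nat. n \<ge> 1 \<Longrightarrow> norm (fcoeff (F (Suc k)) (int n) - fcoeff (F k) (int n)) \<le> \<eta> k / real n ^ k"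
    by (rule exists_stage_sequence[of \<eta>, OF \<eta>0]) (rule that)
  have P: "bounded_periodic 1 (F k)" for k using st[of k] by (simp add: stage_invariant_def)
  have meas [measurable]: "F k \<in> borel_measurable borel" for k using P[of k] by (simp add: bounded_periodic_def)
  define S where "S = {t. Cauchy (\<lambda>k. F k t)}"
  define g where "g k t = (if t \<in> S then F k t else 0)" for k t
  define f where "f t = lim (\<lambda>k. g k t)" for t
  have Sm [measurable]: "S \<in> sets borel"
    using sets_Collect_Cauchy[of F borel] by (simp add: S_def)
  have gm [measurable]: "g k \<in> borel_measurable borel" for k
    unfolding g_def by measurable
  have glim: "(\<lambda>k. g k t) \<longlonglongrightarrow> f t" for t
  proof -
    have "convergent (\<lambda>k. g k t)"
    proof (cases "t \<in> S")
      case True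
      then have "convergent (\<lambda>k. F k t)" by (simp add: S_def Cauchy_convergent_iff)
      then show ?thesis using True by (simp add: g_def)
    qed (simp add: g_def convergent_const)
    then show ?thesis by (simp add: f_def convergent_LIMSEQ_iff)
  qed
  have fm [measurable]: "f \<in> borel_measurable borel"
    by (rule borel_measurable_LIMSEQ_metric[OF gm glim])
  have Sper: "t + 1 \<in> S \<longleftrightarrow> t \<in> S" for t
    using P by (simp add: S_def bounded_periodic_def)
  have fP: "bounded_periodic 1 f"
    unfolding bounded_periodic_def
  proof (intro conjI allI fm)
    show "f (t + 1) = f t" for t
    proof -
      have "F k (t + 1) = F k t" for k using P[of k] by (simp add: bounded_periodic_def)
      then have "g k (t + 1) = g k t" for k using Sper[of t] by (cases "t \<in> S") (simp_all add: g_def)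
      then show ?thesis by (simp add: f_def)
    qed
    show "norm (f t) \<le> 1" for t
    proof (rule LIMSEQ_le_const2[OF tendsto_norm[OF glim]])
      show "\<exists>N. \<forall>n\<ge>N. norm (g n t) \<le> 1"
        using P by (auto simp: g_def bounded_periodic_def)
    qed
  qed
  have Umono: "stage_comb k (D k) \<subseteq> U m" if "k < m" for k m
    using that by (induction m) (auto simp: U less_Suc_eq)
  \<comment> \<open>On a comb the functions are zero from some stage on, so no exceptional null set arises here.\<close>
  have van: "f t = 0" if t: "t \<in> stage_comb k (D k)" for k t
  proof -
    have "g m t = 0" if "m > k" for m
    proof -
      have "t \<in> U m" using Umono[OF that] t by blast
      then have "F m t = 0" using st[of m] unfolding stage_invariant_def by fastforce
      then show ?thesis by (simp add: g_def)
    qed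
    then have "eventually (\<lambda>m. g m t = 0) sequentially"
      unfolding eventually_sequentially by (intro exI[of _ "Suc k"]) auto
    then have "(\<lambda>m. g m t) \<longlonglongrightarrow> 0" by (rule tendsto_eventually)
    then show ?thesis using glim[of t] LIMSEQ_unique by blast
  qed
  have AES: "AE t in unit_leb. t \<in> S"
  proof -
    let ?d = "\<lambda>k t. norm (F (Suc k) t - F k t)"
    have dm [measurable]: "(\<lambda>t. ?d k t) \<in> borel_measurable unit_leb" for k
      by (intro borel_measurable_unit_leb) measurable
    have int: "integrable unit_leb (?d k)" for k
      by (intro integrable_norm periodic_integrable[OF periodic_diff[OF P P]])
    have "(\<integral>\<^sup>+t. (\<Sum>k. ennreal (?d k t)) \<partial>unit_leb) = (\<Sum>k. \<integral>\<^sup>+t. ennreal (?d k t) \<partial>unit_leb)"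
      by (rule nn_integral_suminf) measurable
    also have "\<dots> = (\<Sum>k. ennreal (LINT t|unit_leb. ?d k t))"
      by (subst nn_integral_eq_integral[OF int]) auto
    also have "\<dots> \<le> (\<Sum>k. ennreal (\<eta> k))"
      by (intro suminf_le ennreal_leI L1) auto
    also have "\<dots> = ennreal (suminf \<eta>)"
      using \<eta>0 \<eta>summable by (intro suminf_ennreal2) (auto intro: less_imp_le)
    also have "\<dots> < \<infinity>" by simp
    finally have "(\<integral>\<^sup>+t. (\<Sum>k. ennreal (?d k t)) \<partial>unit_leb) \<noteq> \<infinity>" by simp
    then have "AE t in unit_leb. (\<Sum>k. ennreal (?d k t)) \<noteq> \<infinity>"
      by (intro nn_integral_noteq_infinite) auto
    then show ?thesis
    proof eventually_elim
      case (elim t)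
      then have "summable (\<lambda>k. ?d k t)" by (intro summable_suminf_not_top) auto
      then have "summable (\<lambda>k. F (Suc k) t - F k t)" by (rule summable_norm_cancel)
      then have "convergent (\<lambda>n. \<Sum>k<n. F (Suc k) t - F k t)" by (simp add: summable_iff_convergent)
      then have "convergent (\<lambda>n. F n t - F 0 t)"
        by (simp only: sum_lessThan_telescope[of "\<lambda>k. F k t"])
      then have "convergent (\<lambda>n. F n t - F 0 t + F 0 t)" by (intro convergent_add convergent_const)
      then show "t \<in> S" by (simp add: S_def Cauchy_convergent_iff)
    qed
  qed
  have fclim: "(\<lambda>k. fcoeff (F k) n) \<longlonglongrightarrow> fcoeff f n" for n
    unfolding fcoeff_def
  proof (rule integral_dominated_convergence[where w="\<lambda>_. 1"])
    show "AE t in unit_leb. (\<lambda>k. F k t * turn (- (of_int n * t))) \<longlonglongrightarrow> f t * turn (- (of_int n * t))"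
      using AES
    proof eventually_elim
      case (elim t)
      then show ?case using glim[of t] by (intro tendsto_mult_right) (simp add: g_def)
    qed
    show "integrable unit_leb (\<lambda>_. 1::real)"
      by (rule finite_measure.integrable_const[OF finite_measure_unit_leb])
    show "AE t in unit_leb. norm (F k t * turn (- (of_int n * t))) \<le> 1" for k
      using P[of k] by (auto simp: norm_mult bounded_periodic_def)
  qed (auto intro!: borel_measurable_unit_leb)
  have fc0: "fcoeff f 0 \<noteq> 0"
  proof -
    have step: "norm (fcoeff (F m) 0 - 1) \<le> (\<Sum>i=0..<m. \<eta> i)" for m
    proof (induction m)
      case 0
      then show ?case by (simp add: F0 fcoeff_const_1)
    next
      case (Suc m)
      have "norm (fcoeff (F (Suc m)) 0 - fcoeff (F m) 0) \<le> \<eta> m"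
        using norm_fcoeff_le_integral[of "\<lambda>t. F (Suc m) t - F m t" 0] L1[of m] fcoeff_diff[OF P[of "Suc m"] P[of m], of 0]
        by simp
      then show ?case
        using Suc norm_triangle_ineq[of "fcoeff (F (Suc m)) 0 - fcoeff (F m) 0" "fcoeff (F m) 0 - 1"] by simp
    qed
    have "norm (fcoeff f 0 - 1) \<le> \<epsilon> / 2"
      by (rule LIMSEQ_le_const2[OF tendsto_norm[OF tendsto_diff[OF fclim tendsto_const]]])
         (use order_trans[OF step \<eta>sum] in auto)
    then show ?thesis using \<epsilon> by auto
  qed
  have decay: "\<exists>C>0. \<forall>n::nat. n \<ge> 1 \<longrightarrow> norm (fcoeff f (int n)) \<le> C / real n ^ k" for k
  proof -
    have "\<exists>C\<ge>0. \<forall>n::int. n \<noteq> 0 \<longrightarrow> norm (fcoeff (F k) n) \<le> C / \<bar>of_int n\<bar> ^ (k + 2)"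
      using st[of k] unfolding stage_invariant_def by blast
    then obtain C where C: "C \<ge> 0" "\<And>n::int. n \<noteq> 0 \<Longrightarrow> norm (fcoeff (F k) n) \<le> C / \<bar>of_int n\<bar> ^ (k + 2)"
      by blast
    have "norm (fcoeff f (int n)) \<le> (C + 1) / real n ^ k" if n: "n \<ge> 1" for n
    proof -
      have step: "norm (fcoeff (F m) (int n) - fcoeff (F k) (int n)) \<le> (\<Sum>i=k..<m. \<eta> i) / real n ^ k" if "m \<ge> k" for m
        using that
      proof (induction m rule: dec_induct)
        case base
        then show ?case by simp
      next
        case (step m)
        have "norm (fcoeff (F (Suc m)) (int n) - fcoeff (F m) (int n)) \<le> \<eta> m / real n ^ m"
          by (rule fcd[OF n])
        also have "\<dots> \<le> \<eta> m / real n ^ k"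
          using n step(1) \<eta>0[of m] by (intro divide_left_mono power_increasing mult_pos_pos) auto
        finally show ?case
          using step norm_triangle_ineq[of "fcoeff (F (Suc m)) (int n) - fcoeff (F m) (int n)" "fcoeff (F m) (int n) - fcoeff (F k) (int n)"]
          by (simp add: add_divide_distrib)
      qed
      have "norm (fcoeff f (int n) - fcoeff (F k) (int n)) \<le> 1 / real n ^ k"
      proof (rule LIMSEQ_le_const2[OF tendsto_norm[OF tendsto_diff[OF fclim tendsto_const]]])
        have "(\<Sum>i=k..<m. \<eta> i) / real n ^ k \<le> 1 / real n ^ k" for m
          using \<eta>sum[of k m] \<epsilon> by (intro divide_right_mono) auto
        then show "\<exists>N. \<forall>m\<ge>N. norm (fcoeff (F m) (int n) - fcoeff (F k) (int n)) \<le> 1 / real n ^ k"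
          using step order_trans by blast
      qed
      moreover have "norm (fcoeff (F k) (int n)) \<le> C / real n ^ k"
      proof -
        have "norm (fcoeff (F k) (int n)) \<le> C / real n ^ (k + 2)" using C(2)[of "int n"] n by simp
        also have "\<dots> \<le> C / real n ^ k"
          using n C(1) by (intro divide_left_mono power_increasing mult_pos_pos) auto
        finally show ?thesis .
      qed
      ultimately show ?thesis
        using norm_triangle_ineq[of "fcoeff f (int n) - fcoeff (F k) (int n)" "fcoeff (F k) (int n)"]
        by (simp add: add_divide_distrib)
    qed
    then show ?thesis using C(1) by (intro exI[of _ "C + 1"]) auto
  qed
  have small: "measure unit_leb ((\<Union>k. stage_comb k (D k)) \<inter> {0..<1}) < \<epsilon>"
  proof -
    let ?A = "\<lambda>k. stage_comb k (D k) \<inter> {0..<1}"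
    have le: "measure unit_leb (?A k) \<le> \<eta> k" for k
      using measure_stage_comb_le[of "D k" k] D[of k] D4[of k] by simp
    have sm: "summable (\<lambda>k. measure unit_leb (?A k))"
      by (rule summable_comparison_test'[OF \<eta>summable, of 0]) (use le in auto)
    have sets: "?A k \<in> sets unit_leb" for k
      by (auto simp: sets_restrict_space stage_comb_def open_comb intro!: image_eqI[of _ _ "stage_comb k (D k)"])
    have "measure unit_leb ((\<Union>k. stage_comb k (D k)) \<inter> {0..<1}) = measure unit_leb (\<Union>k. ?A k)"
      by (simp only: Int_UN_distrib2 UN_extend_simps)
    also have "\<dots> \<le> (\<Sum>k. measure unit_leb (?A k))"
      using sets by (intro finite_measure.finite_measure_subadditive_countably[OF finite_measure_unit_leb] sm) auto
    also have "\<dots> \<le> suminf \<eta>" by (rule suminf_le[OF le sm \<eta>summable])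
    finally show ?thesis using \<eta>suminf \<epsilon> by simp
  qed
  show thesis by (rule that[OF D small fP van fc0 decay])
qed

text \<open>The real counterpart of \<open>complex_measure_on\<close>, satisfied by real and imaginary parts.\<close>

section \<open>Jordan decomposition of a signed measure\<close>

definition signed_measure_on :: "'a measure \<Rightarrow> ('a set \<Rightarrow> real) \<Rightarrow> bool" where
  "signed_measure_on M \<nu> \<longleftrightarrow> \<nu> {} = 0 \<and>
     (\<forall>A. range A \<subseteq> sets M \<longrightarrow> disjoint_family A \<longrightarrow> (\<lambda>i::nat. \<nu> (A i)) sums \<nu> (\<Union>i. A i))"

context
  fixes M :: "'a measure" and \<nu> :: "'a set \<Rightarrow> real"
  assumes \<nu>: "signed_measure_on M \<nu>"
begin

lemma signed_empty: "\<nu> {} = 0"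
  using \<nu> by (simp add: signed_measure_on_def)

lemma signed_sums:
  "range A \<subseteq> sets M \<Longrightarrow> disjoint_family A \<Longrightarrow> (\<lambda>i::nat. \<nu> (A i)) sums \<nu> (\<Union>i. A i)"
  using \<nu> by (simp add: signed_measure_on_def)

lemma signed_Un:
  assumes "A \<in> sets M" "B \<in> sets M" "A \<inter> B = {}"
  shows "\<nu> (A \<union> B) = \<nu> A + \<nu> B"
proof -
  have "(\<lambda>i. \<nu> (binaryset A B i)) sums \<nu> (\<Union>i. binaryset A B i)"
    using assms by (intro signed_sums) (auto simp: range_binaryset_eq disjoint_family_on_def binaryset_def)
  moreover have "(\<lambda>i. \<nu> (binaryset A B i)) sums (\<nu> A + \<nu> B)"
    by (rule binaryset_sums) (simp add: signed_empty)
  ultimately show ?thesis using sums_unique2 by (metis UN_binaryset_eq)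
qed

lemma signed_Diff:
  assumes "A \<in> sets M" "B \<in> sets M" "B \<subseteq> A"
  shows "\<nu> (A - B) = \<nu> A - \<nu> B"
proof -
  have "\<nu> (B \<union> (A - B)) = \<nu> B + \<nu> (A - B)" using assms by (intro signed_Un) auto
  then show ?thesis using assms(3) by (simp add: Un_absorb1)
qed

definition unbounded_on :: "'a set \<Rightarrow> bool" where
  "unbounded_on A \<longleftrightarrow> A \<in> sets M \<and> (\<forall>C. \<exists>B\<in>sets M. B \<subseteq> A \<and> \<bar>\<nu> B\<bar> > C)"

text \<open>If \<open>\<nu>\<close> is unbounded on subsets of \<open>A\<close>, a subset \<open>B\<close> with \<open>|\<nu> B|\<close> much larger than \<open>|\<nu> A|\<close> makes both
\<open>\<nu> B\<close> and \<open>\<nu> (A - B)\<close> large, and \<open>\<nu>\<close> stays unbounded on one of the two pieces.\<close>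

lemma unbounded_on_split:
  assumes A: "unbounded_on A"
  shows "\<exists>B. unbounded_on B \<and> B \<subseteq> A \<and> \<bar>\<nu> (A - B)\<bar> > 1"
proof -
  have As: "A \<in> sets M" using A by (simp add: unbounded_on_def)
  obtain B where B: "B \<in> sets M" "B \<subseteq> A" "\<bar>\<nu> B\<bar> > 1 + \<bar>\<nu> A\<bar>"
    using A unfolding unbounded_on_def by blast
  have d: "\<nu> (A - B) = \<nu> A - \<nu> B" by (rule signed_Diff[OF As B(1,2)])
  have "unbounded_on B \<or> unbounded_on (A - B)"
  proof (rule ccontr)
    assume "\<not> ?thesis"
    then obtain C1 C2 where C: "\<And>X. X \<in> sets M \<Longrightarrow> X \<subseteq> B \<Longrightarrow> \<bar>\<nu> X\<bar> \<le> C1"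
        "\<And>X. X \<in> sets M \<Longrightarrow> X \<subseteq> A - B \<Longrightarrow> \<bar>\<nu> X\<bar> \<le> C2"
      using As B unfolding unbounded_on_def by (meson linorder_not_less sets.Diff)
    obtain X where X: "X \<in> sets M" "X \<subseteq> A" "\<bar>\<nu> X\<bar> > C1 + C2"
      using A unfolding unbounded_on_def by blast
    have "\<nu> ((X \<inter> B) \<union> (X - B)) = \<nu> (X \<inter> B) + \<nu> (X - B)"
      using X B by (intro signed_Un) auto
    moreover have "(X \<inter> B) \<union> (X - B) = X" by blast
    ultimately have "\<nu> X = \<nu> (X \<inter> B) + \<nu> (X - B)" by simp
    moreover have "\<bar>\<nu> (X \<inter> B)\<bar> \<le> C1" using X B by (intro C) auto
    moreover have "\<bar>\<nu> (X - B)\<bar> \<le> C2" using X B by (intro C) auto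
    ultimately show False using X(3) by linarith
  qed
  then show ?thesis
  proof
    assume "unbounded_on B"
    then show ?thesis using B d by (intro exI[of _ B]) auto
  next
    assume "unbounded_on (A - B)"
    moreover have "A - (A - B) = B" using B by blast
    ultimately show ?thesis using B by (intro exI[of _ "A - B"]) auto
  qed
qed

text \<open>Iterating the split would give disjoint sets whose measures stay away from zero although their
series converges.\<close>

lemma signed_bounded: "\<exists>C. \<forall>B\<in>sets M. \<bar>\<nu> B\<bar> \<le> C"
proof (rule ccontr)
  assume no: "\<not> ?thesis"
  have "unbounded_on (space M)"
    unfolding unbounded_on_def
  proof (intro conjI allI)
    fix C
    from no obtain B where "B \<in> sets M" "\<bar>\<nu> B\<bar> > C" by (auto simp: not_le)
    then show "\<exists>B\<in>sets M. B \<subseteq> space M \<and> \<bar>\<nu> B\<bar> > C" using sets.sets_into_space by blast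
  qed simp
  then have "\<exists>A. \<forall>n. unbounded_on (A n) \<and> (A (Suc n) \<subseteq> A n \<and> \<bar>\<nu> (A n - A (Suc n))\<bar> > 1)"
    by (intro dependent_nat_choice) (use unbounded_on_split in blast)+
  then obtain A where A: "\<And>n. unbounded_on (A n)" "\<And>n. A (Suc n) \<subseteq> A n"
      "\<And>n. \<bar>\<nu> (A n - A (Suc n))\<bar> > 1" by blast
  have dec: "A m \<subseteq> A n" if "n \<le> m" for m n
    using that A(2) by (induction m rule: dec_induct) auto
  have As: "A n \<in> sets M" for n using A(1)[of n] by (simp add: unbounded_on_def)
  have "disjoint_family (\<lambda>n. A n - A (Suc n))"
    unfolding disjoint_family_on_def
  proof (intro ballI impI)
    fix m n :: nat assume "m \<noteq> n"
    then show "(A m - A (Suc m)) \<inter> (A n - A (Suc n)) = {}"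
      using dec[of "Suc m" n] dec[of "Suc n" m] by (cases "m < n") auto
  qed
  then have "(\<lambda>n. \<nu> (A n - A (Suc n))) sums \<nu> (\<Union>n. A n - A (Suc n))"
    using As by (intro signed_sums) auto
  then have "(\<lambda>n. \<nu> (A n - A (Suc n))) \<longlonglongrightarrow> 0"
    by (intro summable_LIMSEQ_zero sums_summable)
  then obtain n where "\<bar>\<nu> (A n - A (Suc n))\<bar> < 1"
    by (auto simp: lim_sequentially dist_real_def) (metis dual_order.refl zero_less_one)
  then show False using A(3)[of n] by linarith
qed

definition pos_var :: "'a set \<Rightarrow> ennreal" where
  "pos_var A = (SUP B\<in>{B \<in> sets M. B \<subseteq> A}. ennreal (\<nu> B))"

lemma pos_var_upper: "B \<in> sets M \<Longrightarrow> B \<subseteq> A \<Longrightarrow> ennreal (\<nu> B) \<le> pos_var A"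
  unfolding pos_var_def by (rule SUP_upper) simp

lemma pos_var_mono: "A \<subseteq> A' \<Longrightarrow> pos_var A \<le> pos_var A'"
  unfolding pos_var_def by (rule SUP_subset_mono) auto

lemma pos_var_superadditive:
  assumes "A \<inter> A' = {}"
  shows "pos_var A + pos_var A' \<le> pos_var (A \<union> A')"
proof -
  let ?S = "\<lambda>A. {B \<in> sets M. B \<subseteq> A}"
  have ne: "?S A \<noteq> {}" for A :: "'a set" by auto
  have key: "ennreal (\<nu> B) + ennreal (\<nu> B') \<le> pos_var (A \<union> A')" if B: "B \<in> ?S A" "B' \<in> ?S A'" for B B'
  proof -
    consider "\<nu> B \<le> 0" | "\<nu> B' \<le> 0" | "\<nu> B > 0" "\<nu> B' > 0" by linarith
    then show ?thesis
    proof cases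
      case 1
      then show ?thesis using B pos_var_upper[of B' "A \<union> A'"] by (auto simp: ennreal_neg)
    next
      case 2
      then show ?thesis using B pos_var_upper[of B "A \<union> A'"] by (auto simp: ennreal_neg)
    next
      case 3
      have "\<nu> (B \<union> B') = \<nu> B + \<nu> B'" using B assms by (intro signed_Un) auto
      then have "ennreal (\<nu> B) + ennreal (\<nu> B') = ennreal (\<nu> (B \<union> B'))"
        using 3 by (simp add: ennreal_plus)
      also have "\<dots> \<le> pos_var (A \<union> A')" using B by (intro pos_var_upper) auto
      finally show ?thesis .
    qed
  qed
  have "pos_var A + pos_var A' = (SUP B\<in>?S A. ennreal (\<nu> B) + pos_var A')"
    unfolding pos_var_def[of A] by (rule ennreal_SUP_add_left[OF ne, symmetric])
  also have "\<dots> = (SUP B\<in>?S A. SUP B'\<in>?S A'. ennreal (\<nu> B) + ennreal (\<nu> B'))"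
    unfolding pos_var_def[of A'] by (subst ennreal_SUP_add_right[OF ne]) simp
  also have "\<dots> \<le> pos_var (A \<union> A')"
    by (intro SUP_least key)
  finally show ?thesis .
qed

lemma sums_ennreal_le:
  assumes "x sums (s::real)"
  shows "ennreal s \<le> (\<Sum>i. ennreal (x i))"
proof (rule LIMSEQ_le_const2)
  show "(\<lambda>n. ennreal (\<Sum>i<n. x i)) \<longlonglongrightarrow> ennreal s"
    using assms by (intro tendsto_ennrealI) (simp add: sums_def)
  have "ennreal (\<Sum>i<n. x i) \<le> (\<Sum>i<n. ennreal (x i))" for n
  proof (induction n)
    case (Suc n)
    have "ennreal ((\<Sum>i<n. x i) + x n) \<le> ennreal (\<Sum>i<n. x i) + ennreal (x n)"
      by (cases "(\<Sum>i<n. x i) \<ge> 0"; cases "x n \<ge> 0")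
         (auto simp: ennreal_plus ennreal_neg intro!: ennreal_leI)
    then show ?case using Suc by (auto intro: order_trans add_mono)
  qed simp
  then show "\<exists>N. \<forall>n\<ge>N. ennreal (\<Sum>i<n. x i) \<le> (\<Sum>i. ennreal (x i))"
    using sum_le_suminf[of "\<lambda>i. ennreal (x i)"] by (meson finite_lessThan order_trans summableI zero_le)
qed

text \<open>Subadditivity comes from cutting a subset of the union along the pieces, superadditivity from
uniting subsets of the pieces.\<close>

lemma pos_var_countably_additive: "countably_additive (sets M) pos_var"
  unfolding countably_additive_def
proof (intro allI impI)
  fix A :: "nat \<Rightarrow> 'a set"
  assume A: "range A \<subseteq> sets M" "disjoint_family A" "(\<Union>i. A i) \<in> sets M"
  show "(\<Sum>i. pos_var (A i)) = pos_var (\<Union>i. A i)"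
  proof (rule antisym)
    show "pos_var (\<Union>i. A i) \<le> (\<Sum>i. pos_var (A i))"
      unfolding pos_var_def[of "\<Union>i. A i"]
    proof (rule SUP_least)
      fix B assume B: "B \<in> {B \<in> sets M. B \<subseteq> (\<Union>i. A i)}"
      have "(\<lambda>i. \<nu> (B \<inter> A i)) sums \<nu> (\<Union>i. B \<inter> A i)"
        using A B by (intro signed_sums) (auto simp: disjoint_family_on_def)
      also have "(\<Union>i. B \<inter> A i) = B" using B by blast
      finally have "ennreal (\<nu> B) \<le> (\<Sum>i. ennreal (\<nu> (B \<inter> A i)))" by (rule sums_ennreal_le)
      also have "\<dots> \<le> (\<Sum>i. pos_var (A i))"
        using A B by (intro suminf_le pos_var_upper) auto
      finally show "ennreal (\<nu> B) \<le> (\<Sum>i. pos_var (A i))" .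
    qed
    have "(\<Sum>i<n. pos_var (A i)) \<le> pos_var (\<Union>i<n. A i)" for n
    proof (induction n)
      case (Suc n)
      have "(\<Union>i<n. A i) \<inter> A n = {}"
      proof -
        have "A i \<inter> A n = {}" if "i < n" for i
          using A(2) that by (simp add: disjoint_family_on_def)
        then show ?thesis by blast
      qed
      from pos_var_superadditive[OF this] Suc show ?case
        by (auto simp: lessThan_Suc Un_commute add.commute intro: order_trans add_mono)
    qed simp
    then have "(\<Sum>i<n. pos_var (A i)) \<le> pos_var (\<Union>i. A i)" for n
      by (rule order_trans) (auto intro: pos_var_mono)
    then show "(\<Sum>i. pos_var (A i)) \<le> pos_var (\<Union>i. A i)"
      by (intro suminf_le_const) auto
  qed
qed

lemma emeasure_positive_variation:
  assumes "A \<in> sets M"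
  shows "emeasure (positive_variation M \<nu>) A = pos_var A"
proof (rule emeasure_measure_of[of _ "space M" "sets M"])
  show "positive_variation M \<nu> = measure_of (space M) (sets M) pos_var"
    unfolding positive_variation_def pos_var_def ..
  show "positive (sets (positive_variation M \<nu>)) pos_var"
  proof -
    have "pos_var {} = 0"
      unfolding pos_var_def by (rule SUP_eq_const) (auto simp: signed_empty)
    then show ?thesis by (simp add: positive_def)
  qed
  show "countably_additive (sets (positive_variation M \<nu>)) pos_var"
    using pos_var_countably_additive by (simp add: positive_variation_def sets.sigma_sets_eq)
qed (use assms sets.space_closed in \<open>auto simp: positive_variation_def\<close>)

lemma sets_positive_variation: "sets (positive_variation M \<nu>) = sets M"
  by (simp add: positive_variation_def sets.sigma_sets_eq sets.space_closed)

lemma space_positive_variation: "space (positive_variation M \<nu>) = space M"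
  using sets_eq_imp_space_eq[OF sets_positive_variation] .

lemma finite_positive_variation: "finite_measure (positive_variation M \<nu>)"
proof (rule finite_measureI)
  obtain C where C: "\<And>B. B \<in> sets M \<Longrightarrow> \<bar>\<nu> B\<bar> \<le> C" using signed_bounded by blast
  have "pos_var (space M) \<le> ennreal C"
    unfolding pos_var_def using C by (intro SUP_least ennreal_leI) (auto simp: abs_le_iff)
  then have "pos_var (space M) < \<infinity>" using ennreal_less_top[of C] by (simp add: le_less_trans)
  then show "emeasure (positive_variation M \<nu>) (space (positive_variation M \<nu>)) \<noteq> \<infinity>"
    by (simp add: emeasure_positive_variation space_positive_variation)
qed

lemma measure_positive_variation_upper:
  assumes "A \<in> sets M" "B \<in> sets M" "B \<subseteq> A"
  shows "\<nu> B \<le> measure (positive_variation M \<nu>) A"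
proof -
  have "ennreal (\<nu> B) \<le> emeasure (positive_variation M \<nu>) A"
    using assms by (simp add: emeasure_positive_variation pos_var_upper)
  then have "ennreal (\<nu> B) \<le> ennreal (measure (positive_variation M \<nu>) A)"
    by (simp add: finite_measure.emeasure_eq_measure[OF finite_positive_variation])
  then show ?thesis by (subst (asm) ennreal_le_iff[OF measure_nonneg])
qed

lemma measure_positive_variation_approx:
  assumes "A \<in> sets M" "0 < e"
  shows "\<exists>B\<in>sets M. B \<subseteq> A \<and> measure (positive_variation M \<nu>) A - e < \<nu> B"
proof (rule ccontr)
  let ?m = "measure (positive_variation M \<nu>) A"
  assume "\<not> ?thesis"
  then have le: "\<nu> B \<le> ?m - e" if "B \<in> sets M" "B \<subseteq> A" for B using that by force
  from le[of "{}"] have m: "0 \<le> ?m - e" by (simp add: signed_empty)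
  have "pos_var A \<le> ennreal (?m - e)"
    unfolding pos_var_def using le by (intro SUP_least ennreal_leI) auto
  then have "ennreal ?m \<le> ennreal (?m - e)"
    using assms by (simp add: emeasure_positive_variation[symmetric] finite_measure.emeasure_eq_measure[OF finite_positive_variation])
  then show False using m assms(2) by (simp add: ennreal_le_iff)
qed

lemma positive_variation_null:
  assumes "A \<in> sets M" "\<And>B. B \<in> sets M \<Longrightarrow> B \<subseteq> A \<Longrightarrow> \<nu> B = 0"
  shows "emeasure (positive_variation M \<nu>) A = 0"
proof -
  have "pos_var A = 0"
    unfolding pos_var_def by (rule SUP_eq_const) (auto simp: assms(2))
  then show ?thesis using assms by (simp add: emeasure_positive_variation)
qed

end

lemma signed_measure_on_uminus: "signed_measure_on M \<nu> \<Longrightarrow> signed_measure_on M (\<lambda>A. - \<nu> A)"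
  by (auto simp: signed_measure_on_def intro!: sums_minus)

text \<open>Choosing \<open>B\<close> nearly optimal for \<open>\<nu>\<close> inside \<open>A\<close> makes \<open>A - B\<close> nearly optimal for \<open>- \<nu>\<close>, because
\<open>\<nu> (A - B) = \<nu> A - \<nu> B\<close>.\<close>

lemma jordan_decomposition:
  assumes \<nu>: "signed_measure_on M \<nu>" and A: "A \<in> sets M"
  shows "\<nu> A = measure (positive_variation M \<nu>) A - measure (positive_variation M (\<lambda>A. - \<nu> A)) A"
proof -
  note \<nu>' = signed_measure_on_uminus[OF \<nu>]
  let ?p = "measure (positive_variation M \<nu>) A" and ?n = "measure (positive_variation M (\<lambda>A. - \<nu> A)) A"
  have 1: "?p - ?n \<le> \<nu> A + e" if e: "e > 0" for e
  proof -
    obtain B where B: "B \<in> sets M" "B \<subseteq> A" "?p - e < \<nu> B"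
      using measure_positive_variation_approx[OF \<nu> A e] by blast
    have "- \<nu> (A - B) \<le> ?n"
      using A B by (intro measure_positive_variation_upper[OF \<nu>']) auto
    then show ?thesis using B(3) signed_Diff[OF \<nu> A B(1,2)] by linarith
  qed
  have 2: "\<nu> A \<le> (?p - ?n) + e" if e: "e > 0" for e
  proof -
    obtain B where B: "B \<in> sets M" "B \<subseteq> A" "?n - e < - \<nu> B"
      using measure_positive_variation_approx[OF \<nu>' A e] by blast
    have "\<nu> (A - B) \<le> ?p"
      using A B by (intro measure_positive_variation_upper[OF \<nu>]) auto
    then show ?thesis using B(3) signed_Diff[OF \<nu> A B(1,2)] by linarith
  qed
  show ?thesis using field_le_epsilon[OF 1] field_le_epsilon[OF 2] by linarith
qed

section \<open>Integration against a complex measure\<close>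

definition bounded_measurable :: "'a measure \<Rightarrow> ('a \<Rightarrow> complex) \<Rightarrow> bool" where
  "bounded_measurable M f \<longleftrightarrow> f \<in> borel_measurable M \<and> (\<exists>K. \<forall>x\<in>space M. norm (f x) \<le> K)"

lemma bounded_measurable_add:
  "bounded_measurable M f \<Longrightarrow> bounded_measurable M g \<Longrightarrow> bounded_measurable M (\<lambda>x. f x + g x)"
  unfolding bounded_measurable_def by (auto intro: order_trans[OF norm_triangle_ineq add_mono])

lemma bounded_measurable_scale:
  "bounded_measurable M f \<Longrightarrow> bounded_measurable M (\<lambda>x. c * f x)"
  unfolding bounded_measurable_def norm_mult
  by (auto intro!: mult_left_mono exI[of _ "norm c * _"])

lemma bounded_measurable_sum:
  assumes "\<And>i. i \<in> I \<Longrightarrow> bounded_measurable M (f i)"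
  shows "bounded_measurable M (\<lambda>x. \<Sum>i\<in>I. c i * f i x)"
proof (cases "finite I")
  case True
  then show ?thesis using assms
  proof (induction I)
    case empty
    then show ?case by (auto simp: bounded_measurable_def)
  next
    case (insert i I)
    then show ?case by (simp add: bounded_measurable_add bounded_measurable_scale)
  qed
qed (auto simp: bounded_measurable_def)

lemma integrable_positive_variation:
  assumes \<nu>: "signed_measure_on M \<nu>" and f: "bounded_measurable M f"
  shows "integrable (positive_variation M \<nu>) f"
proof -
  obtain K where "\<And>x. x \<in> space M \<Longrightarrow> norm (f x) \<le> K" using f by (auto simp: bounded_measurable_def)
  then show ?thesis
    using f by (intro finite_measure.integrable_const_bound[OF finite_positive_variation[OF \<nu>], of _ K])
      (auto simp: bounded_measurable_def space_positive_variation[OF \<nu>]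
         cong: measurable_cong_sets[OF sets_positive_variation[OF \<nu>] refl])
qed

lemma norm_integral_positive_variation_le:
  assumes \<nu>: "signed_measure_on M \<nu>" and f: "bounded_measurable M f"
    and E: "E \<in> sets M" "\<And>B. B \<in> sets M \<Longrightarrow> B \<inter> E = {} \<Longrightarrow> \<nu> B = 0"
    and le: "\<And>x. x \<in> E \<Longrightarrow> norm (f x) \<le> e"
  shows "norm (LINT x|positive_variation M \<nu>. f x) \<le> e * measure (positive_variation M \<nu>) (space M)"
proof -
  let ?P = "positive_variation M \<nu>"
  have int: "integrable ?P f" by (rule integrable_positive_variation[OF \<nu> f])
  have "emeasure ?P (space M - E) = 0"
    using E by (intro positive_variation_null[OF \<nu>]) auto
  then have "AE x in ?P. x \<notin> space M - E"
    using E by (intro AE_not_in null_setsI) (auto simp: sets_positive_variation[OF \<nu>])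
  then have AE: "AE x in ?P. norm (f x) \<le> e"
    using AE_space by eventually_elim (auto simp: space_positive_variation[OF \<nu>] le)
  have "norm (LINT x|?P. f x) \<le> (LINT x|?P. norm (f x))" by simp
  also have "\<dots> \<le> (LINT x|?P. e)"
    by (intro integral_mono_AE integrable_norm int AE
        finite_measure.integrable_const[OF finite_positive_variation[OF \<nu>]])
  also have "\<dots> = e * measure ?P (space M)"
    by (simp add: space_positive_variation[OF \<nu>])
  finally show ?thesis .
qed

context
  fixes M :: "'a measure" and \<mu> :: "'a set \<Rightarrow> complex"
  assumes \<mu>: "complex_measure_on M \<mu>"
begin

lemma signed_parts:
  "signed_measure_on M (\<lambda>A. Re (\<mu> A))" "signed_measure_on M (\<lambda>A. - Re (\<mu> A))"
  "signed_measure_on M (\<lambda>A. Im (\<mu> A))" "signed_measure_on M (\<lambda>A. - Im (\<mu> A))"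
proof -
  show R: "signed_measure_on M (\<lambda>A. Re (\<mu> A))" and I: "signed_measure_on M (\<lambda>A. Im (\<mu> A))"
    using \<mu> by (auto simp: signed_measure_on_def complex_measure_on_def intro: sums_Re sums_Im)
  show "signed_measure_on M (\<lambda>A. - Re (\<mu> A))" "signed_measure_on M (\<lambda>A. - Im (\<mu> A))"
    by (rule signed_measure_on_uminus[OF R], rule signed_measure_on_uminus[OF I])
qed

definition total_mass :: real where
  "total_mass = measure (positive_variation M (\<lambda>A. Re (\<mu> A))) (space M)
     + measure (positive_variation M (\<lambda>A. - Re (\<mu> A))) (space M)
     + measure (positive_variation M (\<lambda>A. Im (\<mu> A))) (space M)
     + measure (positive_variation M (\<lambda>A. - Im (\<mu> A))) (space M)"

lemma total_mass_nonneg: "0 \<le> total_mass"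
  unfolding total_mass_def by (intro add_nonneg_nonneg measure_nonneg)

lemma complex_measure_integral_add:
  assumes "bounded_measurable M f" "bounded_measurable M g"
  shows "complex_measure_integral M \<mu> (\<lambda>x. f x + g x)
    = complex_measure_integral M \<mu> f + complex_measure_integral M \<mu> g"
proof -
  note i = integrable_positive_variation[OF _ assms(1)] integrable_positive_variation[OF _ assms(2)]
  show ?thesis
    using i[OF signed_parts(1)] i[OF signed_parts(2)] i[OF signed_parts(3)] i[OF signed_parts(4)]
    unfolding complex_measure_integral_def by (simp add: algebra_simps)
qed

lemma complex_measure_integral_scale:
  "complex_measure_integral M \<mu> (\<lambda>x. c * f x) = c * complex_measure_integral M \<mu> f"
  unfolding complex_measure_integral_def by (simp add: algebra_simps)

lemma complex_measure_integral_sum: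
  assumes "\<And>i. i \<in> I \<Longrightarrow> bounded_measurable M (f i)"
  shows "complex_measure_integral M \<mu> (\<lambda>x. \<Sum>i\<in>I. c i * f i x)
    = (\<Sum>i\<in>I. c i * complex_measure_integral M \<mu> (f i))"
proof (cases "finite I")
  case True
  then show ?thesis using assms
  proof (induction I)
    case empty
    then show ?case by (simp add: complex_measure_integral_def)
  next
    case (insert i I)
    then have "bounded_measurable M (\<lambda>x. c i * f i x)" "bounded_measurable M (\<lambda>x. \<Sum>i\<in>I. c i * f i x)"
      by (auto intro: bounded_measurable_scale bounded_measurable_sum)
    then show ?case using insert
      by (simp add: complex_measure_integral_add complex_measure_integral_scale)
  qed
qed (simp add: complex_measure_integral_def)

text \<open>Each of the four variation measures is concentrated on \<open>E\<close>, so only the values of \<open>f\<close> there count.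
Their masses are simply added up, which may exceed the total variation; a finite constant is enough
for all later estimates.\<close>

lemma norm_complex_measure_integral_le:
  assumes f: "bounded_measurable M f"
    and E: "E \<in> sets M" "\<And>B. B \<in> sets M \<Longrightarrow> B \<inter> E = {} \<Longrightarrow> \<mu> B = 0"
    and le: "\<And>x. x \<in> E \<Longrightarrow> norm (f x) \<le> e"
  shows "norm (complex_measure_integral M \<mu> f) \<le> e * total_mass"
proof -
  have "norm ((a - b) + \<i> * (c - d)) \<le> norm a + norm b + norm c + norm d" for a b c d :: complex
  proof -
    have "norm ((a - b) + \<i> * (c - d)) \<le> norm (a - b) + norm (c - d)"
      using norm_triangle_ineq[of "a - b" "\<i> * (c - d)"] by (simp add: norm_mult)
    then show ?thesis using norm_triangle_ineq4[of a b] norm_triangle_ineq4[of c d] by linarith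
  qed
  then have "norm (complex_measure_integral M \<mu> f) \<le>
      norm (LINT x|positive_variation M (\<lambda>A. Re (\<mu> A)). f x) + norm (LINT x|positive_variation M (\<lambda>A. - Re (\<mu> A)). f x)
    + norm (LINT x|positive_variation M (\<lambda>A. Im (\<mu> A)). f x) + norm (LINT x|positive_variation M (\<lambda>A. - Im (\<mu> A)). f x)"
    unfolding complex_measure_integral_def .
  also have "\<dots> \<le> e * total_mass"
    unfolding total_mass_def distrib_left
    by (intro add_mono norm_integral_positive_variation_le[OF _ f E(1)] signed_parts le) (simp_all add: E(2))
  finally show ?thesis .
qed

end

section \<open>Complex measures on the circle\<close>

lemma measurable_circle:
  "continuous_on circle f \<Longrightarrow> f \<in> borel_measurable circle_borel" for f :: "complex \<Rightarrow> 'b::topological_space"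
  by (rule borel_measurable_continuous_on_restrict)

lemma space_circle_borel [simp]: "space circle_borel = circle"
  by (simp add: space_restrict_space)

lemma bounded_measurable_continuous:
  assumes "continuous_on circle f"
  shows "bounded_measurable circle_borel f"
proof -
  have "bounded (f ` circle)"
    using assms by (intro compact_imp_bounded compact_continuous_image) auto
  then show ?thesis
    using measurable_circle[OF assms] by (auto simp: bounded_measurable_def bounded_iff)
qed

lemma bounded_measurable_powi: "bounded_measurable circle_borel (\<lambda>z. z powi n)"
  by (intro bounded_measurable_continuous continuous_intros) auto

lemma trig_poly_bounded_measurable: "trig_poly p \<Longrightarrow> bounded_measurable circle_borel p"
  by (induction rule: trig_poly.induct)
     (auto intro: bounded_measurable_add bounded_measurable_scale bounded_measurable_powi)

lemma complex_measure_integral_trig_poly_0: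
  assumes \<mu>: "complex_measure_on circle_borel \<mu>" and z: "\<And>n. fourier_coeff_measure \<mu> n = 0"
    and p: "trig_poly p"
  shows "complex_measure_integral circle_borel \<mu> p = 0"
  using p
proof induction
  case (monomial c n)
  have "complex_measure_integral circle_borel \<mu> (\<lambda>x. x powi n) = 0"
    using z[of "-n"] by (simp add: fourier_coeff_measure_def)
  then show ?case by (simp add: complex_measure_integral_scale[OF \<mu>])
next
  case (add f g)
  then show ?case
    by (simp add: complex_measure_integral_add[OF \<mu>] trig_poly_bounded_measurable)
qed

text \<open>The functions \<open>max 0 (1 - n dist(x, C))\<close> decrease to the indicator of a closed set \<open>C\<close>, so the measures
agree on closed sets, which form a generator stable under intersection.\<close>

lemma finite_measures_eq_by_continuous:
  assumes P: "finite_measure P" "sets P = sets circle_borel"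
    and Q: "finite_measure Q" "sets Q = sets circle_borel"
    and eq: "\<And>f :: complex \<Rightarrow> real. continuous_on UNIV f \<Longrightarrow> (\<And>x. 0 \<le> f x \<and> f x \<le> 1) \<Longrightarrow> (LINT x|P. f x) = (LINT x|Q. f x)"
    and A: "A \<in> sets circle_borel"
  shows "measure P A = measure Q A"
proof -
  define P' where "P' = distr P borel (\<lambda>x. x)"
  define Q' where "Q' = distr Q borel (\<lambda>x. x)"
  have idm: "(\<lambda>x. x) \<in> R \<rightarrow>\<^sub>M borel" if "sets R = sets circle_borel" for R :: "complex measure"
    using that measurable_restrict_space1[of "\<lambda>x::complex. x" borel borel circle]
    by (simp cong: measurable_cong_sets)
  have spP: "space P = circle" and spQ: "space Q = circle"
    using sets_eq_imp_space_eq[OF P(2)] sets_eq_imp_space_eq[OF Q(2)] by simp_all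
  have closed_lim: "(\<lambda>n. LINT x|R. max 0 (1 - real n * infdist x C)) \<longlonglongrightarrow> measure R (C \<inter> circle)"
    if R: "finite_measure R" "sets R = sets circle_borel" and C: "closed C" "C \<noteq> {}" for R and C :: "complex set"
  proof -
    have sp: "space R = circle" using sets_eq_imp_space_eq[OF R(2)] by simp
    have m: "f \<in> borel_measurable R" if "continuous_on UNIV f" for f :: "complex \<Rightarrow> real"
      using measurable_circle[of f] continuous_on_subset[OF that] R(2) by (simp cong: measurable_cong_sets)
    have CR: "C \<inter> circle \<in> sets R"
      using C by (auto simp: R(2) sets_restrict_space intro!: image_eqI[of _ _ C])
    have "(\<lambda>n. LINT x|R. max 0 (1 - real n * infdist x C)) \<longlonglongrightarrow> (LINT x|R. indicator (C \<inter> circle) x)"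
    proof (rule integral_dominated_convergence[where w="\<lambda>_. 1"])
      show "indicator (C \<inter> circle) \<in> borel_measurable R" using CR by simp
      show "(\<lambda>x. max 0 (1 - real n * infdist x C)) \<in> borel_measurable R" for n
        by (intro m continuous_intros)
      show "integrable R (\<lambda>_. 1::real)" by (rule finite_measure.integrable_const[OF R(1)])
      show "AE x in R. norm (max 0 (1 - real n * infdist x C)) \<le> 1" for n
        by (auto simp: infdist_nonneg)
      show "AE x in R. (\<lambda>n. max 0 (1 - real n * infdist x C)) \<longlonglongrightarrow> indicator (C \<inter> circle) x"
      proof (rule AE_I2)
        fix x assume x: "x \<in> space R"
        show "(\<lambda>n. max 0 (1 - real n * infdist x C)) \<longlonglongrightarrow> indicator (C \<inter> circle) x"
        proof (cases "x \<in> C")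
          case True
          then show ?thesis using x sp by simp
        next
          case False
          then have d: "0 < infdist x C"
            using C infdist_pos_not_in_closed by blast
          obtain N :: nat where N: "1 < real N * infdist x C" using reals_Archimedean3[OF d] by blast
          have "max 0 (1 - real n * infdist x C) = 0" if "n \<ge> N" for n
          proof -
            have "real N * infdist x C \<le> real n * infdist x C" using that d by (intro mult_right_mono) auto
            then show ?thesis using N by simp
          qed
          then have "eventually (\<lambda>n. max 0 (1 - real n * infdist x C) = 0) sequentially"
            by (auto simp: eventually_sequentially)
          then have "(\<lambda>n. max 0 (1 - real n * infdist x C)) \<longlonglongrightarrow> 0" by (rule tendsto_eventually)
          then show ?thesis using False by simp
        qed
      qed
    qed
    then show ?thesis using CR by (simp add: sp Int_absorb2)
  qed
  have closed_eq: "emeasure P' C = emeasure Q' C" if C: "closed C" for C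
  \<comment> \<open>By convention the distance to the empty set is zero, so the approximating functions do not serve
    there.\<close>
  proof (cases "C = {}")
    case False
    have "measure P (C \<inter> circle) = measure Q (C \<inter> circle)"
    proof (rule LIMSEQ_unique[OF closed_lim[OF P C False]])
      have "(LINT x|P. max 0 (1 - real n * infdist x C)) = (LINT x|Q. max 0 (1 - real n * infdist x C))" for n
        by (rule eq) (auto intro!: continuous_intros simp: infdist_nonneg)
      then show "(\<lambda>n. LINT x|P. max 0 (1 - real n * infdist x C)) \<longlonglongrightarrow> measure Q (C \<inter> circle)"
        using closed_lim[OF Q C False] by simp
    qed
    then show ?thesis
      using C by (simp add: P'_def Q'_def emeasure_distr idm P Q spP spQ finite_measure.emeasure_eq_measure)
  qed simp
  have "P' = Q'"
  proof (rule measure_eqI_generator_eq[of "Collect closed" UNIV _ _ "\<lambda>_. UNIV"])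
    show "Int_stable (Collect (closed :: complex set \<Rightarrow> bool))" by (auto simp: Int_stable_def)
    show "sets P' = sigma_sets UNIV (Collect closed)" "sets Q' = sigma_sets UNIV (Collect closed)"
      by (simp_all add: P'_def Q'_def borel_eq_closed)
    show "emeasure P' UNIV \<noteq> \<infinity>" for i :: nat
      using P by (simp add: P'_def emeasure_distr idm finite_measure.emeasure_eq_measure)
  qed (auto simp: closed_eq)
  moreover have Ab: "A \<in> sets borel" "A \<subseteq> circle"
    using A by (auto simp: sets_restrict_space)
  ultimately have "emeasure P' A = emeasure Q' A" by simp
  then show ?thesis
    using Ab by (simp add: P'_def Q'_def emeasure_distr idm P Q spP spQ finite_measure.emeasure_eq_measure Int_absorb2)
qed

text \<open>Trigonometric polynomials are dense, so the integral of every continuous real function vanishes. Real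
and imaginary parts separate, and the positive and negative variations coincide.\<close>

lemma complex_measure_uniqueness:
  assumes \<mu>: "complex_measure_on circle_borel \<mu>" and z: "\<And>n. fourier_coeff_measure \<mu> n = 0"
    and A: "A \<in> sets circle_borel"
  shows "\<mu> A = 0"
proof -
  let ?T = "complex_measure_integral circle_borel \<mu>"
  let ?P1 = "positive_variation circle_borel (\<lambda>A. Re (\<mu> A))"
  let ?P2 = "positive_variation circle_borel (\<lambda>A. - Re (\<mu> A))"
  let ?P3 = "positive_variation circle_borel (\<lambda>A. Im (\<mu> A))"
  let ?P4 = "positive_variation circle_borel (\<lambda>A. - Im (\<mu> A))"
  note sp = signed_parts[OF \<mu>]
  have T0: "?T (\<lambda>x. of_real (f x)) = 0" if f: "continuous_on circle f" for f
  proof -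
    have bm: "bounded_measurable circle_borel (\<lambda>x. of_real (f x))"
      using f by (intro bounded_measurable_continuous continuous_intros)
    have "norm (?T (\<lambda>x. of_real (f x))) \<le> e * total_mass circle_borel \<mu>" if e: "e > 0" for e
    proof -
      obtain p where p: "trig_poly p" "\<And>z. z \<in> circle \<Longrightarrow> norm (of_real (f z) - p z) < e"
        using trig_poly_dense[OF f e] by blast
      have pm: "bounded_measurable circle_borel (\<lambda>x. (-1) * p x)"
        by (intro bounded_measurable_scale trig_poly_bounded_measurable p)
      have "?T (\<lambda>x. of_real (f x)) = ?T (\<lambda>x. of_real (f x)) + ?T (\<lambda>x. (-1) * p x)"
        unfolding complex_measure_integral_scale[OF \<mu>]
        using complex_measure_integral_trig_poly_0[OF \<mu> z p(1)] by simp
      also have "\<dots> = ?T (\<lambda>x. of_real (f x) + (-1) * p x)"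
        by (rule complex_measure_integral_add[OF \<mu> bm pm, symmetric])
      also have "norm \<dots> \<le> e * total_mass circle_borel \<mu>"
      proof (rule norm_complex_measure_integral_le[OF \<mu> bounded_measurable_add[OF bm pm]])
        show "circle \<in> sets circle_borel" using sets.top[of circle_borel] by simp
        show "\<mu> B = 0" if "B \<in> sets circle_borel" "B \<inter> circle = {}" for B
        proof -
          have "B = {}" using that by (auto simp: sets_restrict_space)
          then show ?thesis using \<mu> by (simp add: complex_measure_on_def)
        qed
        show "norm (of_real (f x) + (-1) * p x) \<le> e" if "x \<in> circle" for x
          using p(2)[OF that] by simp
      qed
      finally show ?thesis .
    qed
    note bound = this
    have "norm (?T (\<lambda>x. of_real (f x))) \<le> 0 + e" if e: "e > 0" for e
    proof -
      let ?V = "total_mass circle_borel \<mu>"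
      have V: "0 \<le> ?V" by (rule total_mass_nonneg[OF \<mu>])
      have "e / (?V + 1) * ?V \<le> e" using V e by (simp add: field_simps)
      with bound[of "e / (?V + 1)"] show ?thesis using V e by simp
    qed
    from field_le_epsilon[OF this] show ?thesis by simp
  qed
  have parts: "(LINT x|?P1. f x) = (LINT x|?P2. f x) \<and> (LINT x|?P3. f x) = (LINT x|?P4. f x)"
    if "continuous_on UNIV f" for f :: "complex \<Rightarrow> real"
    using T0[OF continuous_on_subset[OF that subset_UNIV]]
    by (simp add: complex_measure_integral_def complex_eq_iff)
  have "measure ?P1 A = measure ?P2 A"
  proof (rule finite_measures_eq_by_continuous[OF _ _ _ _ _ A])
    show "(LINT x|?P1. f x) = (LINT x|?P2. f x)" if "continuous_on UNIV f" for f :: "complex \<Rightarrow> real"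
      using parts[OF that] by simp
  qed (intro finite_positive_variation sets_positive_variation sp)+
  moreover have "measure ?P3 A = measure ?P4 A"
  proof (rule finite_measures_eq_by_continuous[OF _ _ _ _ _ A])
    show "(LINT x|?P3. f x) = (LINT x|?P4. f x)" if "continuous_on UNIV f" for f :: "complex \<Rightarrow> real"
      using parts[OF that] by simp
  qed (intro finite_positive_variation sets_positive_variation sp)+
  ultimately show ?thesis
    using jordan_decomposition[OF sp(1) A] jordan_decomposition[OF sp(3) A] by (simp add: complex_eq_iff)
qed

text \<open>Points outside the support have null open neighbourhoods; by the Lindelof property countably many of
them cover \<open>B\<close>, and countable additivity applies after making them disjoint.\<close>

lemma null_off_support:
  assumes \<mu>: "complex_measure_on circle_borel \<mu>"
    and supp: "complex_measure_support circle_borel \<mu> \<subseteq> E" and E: "closed E"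
    and B: "B \<in> sets circle_borel" "B \<inter> E = {}"
  shows "\<mu> B = 0"
proof -
  let ?M = circle_borel
  define \<U> where "\<U> = {U. open U \<and> (\<forall>A\<in>sets ?M. A \<subseteq> U \<longrightarrow> \<mu> A = 0)}"
  have Bc: "B \<subseteq> circle" using B(1) by (auto simp: sets_restrict_space)
  have cover: "B \<subseteq> \<Union>\<U>"
  proof
    fix x assume x: "x \<in> B"
    then have "x \<notin> complex_measure_support ?M \<mu>" using supp B(2) by blast
    then obtain U where "open U" "x \<in> U" "\<not> (\<exists>A\<in>sets ?M. A \<subseteq> U \<and> \<mu> A \<noteq> 0)"
      using x Bc by (auto simp: complex_measure_support_def)
    then show "x \<in> \<Union>\<U>" unfolding \<U>_def by blast
  qed
  obtain \<V> where V: "\<V> \<subseteq> \<U>" "countable \<V>" "\<Union>\<V> = \<Union>\<U>"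
    using Lindelof[of \<U>] unfolding \<U>_def by blast
  show ?thesis
  proof (cases "\<V> = {}")
    case True
    then have "B = {}" using cover V by auto
    then show ?thesis using \<mu> by (simp add: complex_measure_on_def)
  next
    case False
    define u where "u = from_nat_into \<V>"
    have u: "u n \<in> \<U>" for n using V(1) from_nat_into[OF False] by (auto simp: u_def)
    have un: "(\<Union>n. u n) = \<Union>\<V>" using range_from_nat_into[OF False V(2)] by (simp add: u_def)
    define A where "A n = B \<inter> disjointed u n" for n
    have uo: "u n \<in> sets borel" for n using u[of n] by (simp add: \<U>_def)
    have dis: "disjointed u n \<in> sets borel" for n
      using uo by (intro sets.range_disjointed_sets[of u borel, THEN subsetD]) auto
    have "A n \<in> sets ?M" for n
    proof -
      have "A n \<in> sets borel" using B(1) dis[of n] by (auto simp: A_def sets_restrict_space)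
      moreover have "A n \<subseteq> circle" using Bc by (auto simp: A_def)
      ultimately show ?thesis by (auto simp: sets_restrict_space intro!: image_eqI[of _ _ "A n"])
    qed
    note As = this
    have dj: "disjoint_family A"
      using disjoint_family_disjointed[of u] by (auto simp: A_def disjoint_family_on_def)
    have "(\<lambda>n. \<mu> (A n)) sums \<mu> (\<Union>n. A n)"
      using \<mu> As dj unfolding complex_measure_on_def by blast
    moreover have "(\<Union>n. A n) = B"
    proof -
      have "(\<Union>n. A n) = B \<inter> (\<Union>n. disjointed u n)" by (auto simp: A_def)
      also have "\<dots> = B" using cover V(3) by (auto simp: UN_disjointed_eq un)
      finally show ?thesis .
    qed
    moreover have "\<mu> (A n) = 0" for n
    proof -
      have "A n \<subseteq> u n" using disjointed_subset[of u n] by (auto simp: A_def)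
      then show ?thesis using u[of n] As[of n] by (auto simp: \<U>_def)
    qed
    ultimately have "(\<lambda>n. 0) sums \<mu> B" by simp
    then show ?thesis using sums_unique2 sums_zero by blast
  qed
qed

text \<open>Since the coefficients are nonnegative and summable, the series for the tent converges uniformly, so
one finite index set works for all \<open>t\<close>. Working with a finite sum avoids interchanging series and
integrals against the measure.\<close>

section \<open>Flat kernels and the vanishing of summable coefficients\<close>

lemma tent_partial_sum_small:
  assumes b: "0 < b" "b \<le> 1/2" and e: "0 < e"
  obtains I where "finite I" "0 \<in> I"
    "\<And>t. t \<notin> near_int b \<Longrightarrow> norm (\<Sum>l\<in>I. of_real (tent_coeff b l) * turn (of_int l * t)) \<le> e"
proof -
  let ?c = "tent_coeff b"
  have hs: "(?c has_sum infsum ?c UNIV) UNIV"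
    by (rule has_sum_infsum[OF tent_coeff_summable[OF b(1)]])
  then have "eventually (\<lambda>X. dist (sum ?c X) (infsum ?c UNIV) < e) (finite_subsets_at_top UNIV)"
    unfolding has_sum_def using e by (rule tendstoD)
  then obtain X where X: "finite X" "\<And>Y. finite Y \<Longrightarrow> X \<subseteq> Y \<Longrightarrow> dist (sum ?c Y) (infsum ?c UNIV) < e"
    unfolding eventually_finite_subsets_at_top by auto
  define I where "I = insert 0 X"
  have I: "finite I" "0 \<in> I" using X(1) by (auto simp: I_def)
  have dI: "dist (sum ?c I) (infsum ?c UNIV) < e" using X by (auto simp: I_def)
  have "norm (\<Sum>l\<in>I. of_real (?c l) * turn (of_int l * t)) \<le> e" if t: "t \<notin> near_int b" for t
  proof -
    let ?g = "\<lambda>l. of_real (?c l) * turn (of_int l * t)"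
    have tail: "(?c has_sum (infsum ?c UNIV - sum ?c I)) (UNIV - I)"
      by (rule has_sum_Diff[OF hs has_sum_finite[OF I(1)]]) simp
    have "(?g has_sum (0 - sum ?g I)) (UNIV - I)"
      by (rule has_sum_Diff[OF tent_kernel(2)[OF b t] has_sum_finite[OF I(1)]]) simp
    then have "norm (0 - sum ?g I) \<le> infsum ?c UNIV - sum ?c I"
      by (rule norm_infsum_le[OF _ tail]) (simp add: norm_mult tent_coeff_nonneg)
    also have "\<dots> \<le> e" using dI by (simp add: dist_real_def)
    finally show ?thesis by simp
  qed
  then show thesis using that[OF I] by blast
qed

text \<open>Suppose \<open>m = (N + j) l = (N + i) l'\<close> with \<open>i \<noteq> j\<close>. Then \<open>(N + i) (l' - l) = (j - i) l\<close>, which forces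
\<open>N \<le> J |l|\<close>. So as soon as two multiples collide, all the colliding tent coefficients are in the
range where they are at most \<open>1 / J\<close>, and there are at most \<open>J\<close> of them.\<close>

lemma comb_multiplicity:
  fixes N J :: nat and b :: real and I :: "int set" and m :: int
  assumes b: "0 < b" and NJ: "1 \<le> N" "J ^ 3 \<le> (real N * b)\<^sup>2" and I: "finite I" "0 \<notin> I"
  defines "S \<equiv> {p \<in> {..<J} \<times> I. int (N + fst p) * snd p = m}"
  shows "(\<Sum>p\<in>S. tent_coeff b (snd p)) \<le> 1"
proof (cases "\<exists>p q. p \<in> S \<and> q \<in> S \<and> p \<noteq> q")
  case False
  have fin: "finite S" using I by (simp add: S_def)
  show ?thesis
  proof (cases "S = {}")
    case False
    then obtain p where "p \<in> S" by blast
    with \<open>\<not> (\<exists>p q. p \<in> S \<and> q \<in> S \<and> p \<noteq> q)\<close> have "S = {p}" by blast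
    then show ?thesis by (simp add: tent_coeff_le_1)
  qed simp
next
  case True
  have fin: "finite S" using I by (simp add: S_def)
  have inj: "inj_on fst S"
  proof (rule inj_onI)
    fix p q assume pq: "p \<in> S" "q \<in> S" "fst p = fst q"
    then have "int (N + fst p) * snd p = int (N + fst p) * snd q" by (simp add: S_def)
    then have "snd p = snd q" using NJ by simp
    then show "p = q" using pq(3) by (simp add: prod_eq_iff)
  qed
  have card: "card S \<le> J"
  proof -
    have "card S = card (fst ` S)" using inj by (simp add: card_image)
    also have "\<dots> \<le> card {..<J}" by (rule card_mono) (auto simp: S_def)
    finally show ?thesis by simp
  qed
  have J0: "J > 0" using True by (auto simp: S_def)
  have "tent_coeff b (snd p) \<le> 1 / real J" if p: "p \<in> S" for p
  proof -
    obtain q where q: "q \<in> S" "q \<noteq> p" using True p by metis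
    define j i l l' where "j = int (fst p)" and "i = int (fst q)" and "l = snd p" and "l' = snd q"
    have ij: "i \<noteq> j" using inj_onD[OF inj _ q(1) p] q(2) by (auto simp: i_def j_def)
    have l0: "l \<noteq> 0" using p I by (auto simp: S_def l_def)
    have "(int N + j) * l = (int N + i) * l'" using p q by (simp add: S_def j_def i_def l_def l'_def)
    then have eq: "(int N + i) * (l' - l) = (j - i) * l" by (simp add: algebra_simps)
    have "(j - i) * l \<noteq> 0" using ij l0 by simp
    then have "l' - l \<noteq> 0" using eq by auto
    then have "1 \<le> \<bar>l' - l\<bar>" by linarith
    have ge: "0 \<le> i" "0 \<le> j" "i < int J" "j < int J" using p q by (auto simp: S_def i_def j_def)
    have "int N * 1 \<le> (int N + i) * \<bar>l' - l\<bar>"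
      using \<open>1 \<le> \<bar>l' - l\<bar>\<close> ge by (intro mult_mono) auto
    also have "\<dots> = \<bar>(int N + i) * (l' - l)\<bar>" using ge by (simp add: abs_mult)
    also have "\<dots> = \<bar>j - i\<bar> * \<bar>l\<bar>" unfolding eq by (simp add: abs_mult)
    also have "\<dots> \<le> int J * \<bar>l\<bar>" using ge by (intro mult_right_mono) auto
    finally have "int N \<le> int J * \<bar>l\<bar>" by simp
    then have "real_of_int (int N) \<le> real_of_int (int J * \<bar>l\<bar>)" by (simp only: of_int_le_iff)
    then have NJl: "real N \<le> real J * \<bar>of_int l\<bar>" by simp
    have "real J ^ 3 \<le> (real N * b)\<^sup>2" using NJ(2) by simp
    also have "\<dots> \<le> (real J * \<bar>of_int l\<bar> * b)\<^sup>2"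
      using NJl b by (intro power_mono mult_right_mono) auto
    also have "\<dots> = real J ^ 2 * (of_int l * b)\<^sup>2" by (simp add: power_mult_distrib)
    finally have "real J ^ 2 * real J \<le> real J ^ 2 * (of_int l * b)\<^sup>2"
      by (simp add: power2_eq_square power3_eq_cube)
    then have "real J \<le> (of_int l * b)\<^sup>2" using J0 by simp
    moreover from this have "0 < (of_int l * b)\<^sup>2" using J0 by linarith
    ultimately have "1 / (of_int l * b)\<^sup>2 \<le> 1 / real J" using J0 by (intro divide_left_mono mult_pos_pos) auto
    then show ?thesis using tent_coeff_le[OF b l0] unfolding l_def by linarith
  qed
  then have "(\<Sum>p\<in>S. tent_coeff b (snd p)) \<le> (\<Sum>p\<in>S. 1 / real J)" by (intro sum_mono) auto
  also have "\<dots> = real (card S) / real J" by simp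
  also have "\<dots> \<le> 1" using card J0 by simp
  finally show ?thesis .
qed

text \<open>The pointwise inequality \<open>a \<le> \<tau> + \<tau> powr (1 - q) * a powr q\<close> separates small from large values. The small
ones are paid by the sum of the tent coefficients, at most \<open>1 / b\<close>; the large ones are regrouped by the
frequency \<open>m\<close>, where the multiplicity bound saves the factor \<open>1 / J\<close>.\<close>

lemma flat_average_bound:
  fixes N J :: nat and b \<tau> q A :: real and a :: "int \<Rightarrow> real"
  assumes b: "0 < b" "b \<le> 1/2" and NJ: "1 \<le> N" "J ^ 3 \<le> (real N * b)\<^sup>2" "J > 0"
    and I: "finite I" "0 \<notin> I" and \<tau>: "0 < \<tau>" and q: "1 \<le> q"
    and a: "\<And>n. 0 \<le> a n" "\<And>X. finite X \<Longrightarrow> (\<Sum>n\<in>X. a n powr q) \<le> A"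
  shows "(\<Sum>j<J. \<Sum>l\<in>I. tent_coeff b l * a (n - int (N + j) * l)) / real J
      \<le> \<tau> / b + \<tau> powr (1 - q) * A / real J"
proof -
  let ?c = "tent_coeff b" and ?\<theta> = "\<tau> powr (1 - q)"
  let ?S = "{..<J} \<times> I" and ?g = "\<lambda>p. int (N + fst p) * snd p"
  have pt: "a m \<le> \<tau> + ?\<theta> * a m powr q" for m
  proof (cases "a m \<le> \<tau>")
    case True
    then show ?thesis by (simp add: add_increasing2)
  next
    case False
    then have am: "a m > 0" using \<tau> by linarith
    have "a m = a m powr (1 - q) * a m powr q" using am by (simp flip: powr_add)
    also have "\<dots> \<le> ?\<theta> * a m powr q"
      using False q \<tau> by (intro mult_right_mono powr_mono2') auto
    finally show ?thesis using \<tau> by linarith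
  qed
  have "(\<Sum>j<J. \<Sum>l\<in>I. ?c l * a (n - int (N + j) * l))
      \<le> (\<Sum>j<J. \<Sum>l\<in>I. ?c l * (\<tau> + ?\<theta> * a (n - int (N + j) * l) powr q))"
    by (intro sum_mono mult_left_mono pt tent_coeff_nonneg)
  also have "\<dots> = (\<Sum>j<J. \<tau> * (\<Sum>l\<in>I. ?c l)) + ?\<theta> * (\<Sum>j<J. \<Sum>l\<in>I. ?c l * a (n - int (N + j) * l) powr q)"
    by (simp add: distrib_left sum.distrib sum_distrib_left mult_ac)
  also have "(\<Sum>j<J. \<tau> * (\<Sum>l\<in>I. ?c l)) \<le> (\<Sum>j<J. \<tau> * (1 / b))"
    using \<tau> tent_kernel(1)[OF b I(1)] by (intro sum_mono mult_left_mono) auto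
  also have "(\<Sum>j<J. \<tau> * (1 / b)) = real J * (\<tau> / b)" by simp
  also have "(\<Sum>j<J. \<Sum>l\<in>I. ?c l * a (n - int (N + j) * l) powr q) \<le> A"
  proof -
    have "(\<Sum>j<J. \<Sum>l\<in>I. ?c l * a (n - int (N + j) * l) powr q) = (\<Sum>p\<in>?S. ?c (snd p) * a (n - ?g p) powr q)"
      by (simp add: sum.cartesian_product split_beta)
    also have "\<dots> = (\<Sum>m\<in>?g ` ?S. \<Sum>p\<in>{p \<in> ?S. ?g p = m}. ?c (snd p) * a (n - ?g p) powr q)"
      by (rule sum.image_gen) (use I in auto)
    also have "\<dots> = (\<Sum>m\<in>?g ` ?S. a (n - m) powr q * (\<Sum>p\<in>{p \<in> ?S. ?g p = m}. ?c (snd p)))"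
      by (intro sum.cong refl) (simp add: sum_distrib_left mult.commute)
    also have "\<dots> \<le> (\<Sum>m\<in>?g ` ?S. a (n - m) powr q * 1)"
      using comb_multiplicity[OF b(1) NJ(1,2) I] by (intro sum_mono mult_left_mono) auto
    also have "\<dots> = (\<Sum>m\<in>(\<lambda>m. n - m) ` ?g ` ?S. a m powr q)"
      by (subst sum.reindex) (auto simp: inj_on_def)
    also have "\<dots> \<le> A" using I by (intro a(2)) auto
    finally show ?thesis .
  qed
  finally have "(\<Sum>j<J. \<Sum>l\<in>I. ?c l * a (n - int (N + j) * l)) \<le> real J * (\<tau> / b) + ?\<theta> * A"
    by (simp add: mult_left_mono)
  then show ?thesis using NJ(3) by (simp add: field_simps)
qed

text \<open>Integrate against \<open>\<mu>\<close> the kernel that is small on \<open>E\<close>: the term \<open>l = 0\<close> reproduces the coefficient at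
\<open>n\<close>, and the others are bounded by \<open>flat_average_bound\<close>.\<close>

lemma fourier_coeff_measure_flat_bound:
  fixes N J :: nat and b \<tau> q A :: real
  assumes \<mu>: "complex_measure_on circle_borel \<mu>"
    and E: "E \<in> sets circle_borel" "\<And>B. B \<in> sets circle_borel \<Longrightarrow> B \<inter> E = {} \<Longrightarrow> \<mu> B = 0"
    and EN: "\<And>z. z \<in> E \<Longrightarrow> \<exists>t. z = turn t \<and> t \<notin> comb N J b"
    and b: "0 < b" "b \<le> 1/2" and NJ: "1 \<le> N" "J ^ 3 \<le> (real N * b)\<^sup>2" "J > 0"
    and \<tau>: "0 < \<tau>" and q: "1 \<le> q"
    and A: "\<And>X. finite X \<Longrightarrow> (\<Sum>n\<in>X. norm (fourier_coeff_measure \<mu> n) powr q) \<le> A"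
  shows "norm (fourier_coeff_measure \<mu> n) \<le> \<tau> / b + \<tau> powr (1 - q) * A / real J"
proof -
  let ?a = "\<lambda>n. norm (fourier_coeff_measure \<mu> n)" and ?c = "tent_coeff b"
  let ?V = "total_mass circle_borel \<mu>" and ?R = "\<tau> / b + \<tau> powr (1 - q) * A / real J"
  have V: "0 \<le> ?V" by (rule total_mass_nonneg[OF \<mu>])
  have main: "?a n \<le> ?R + e * ?V" if e: "e > 0" for e
  proof -
    obtain I where I: "finite I" "0 \<in> I"
      "\<And>t. t \<notin> near_int b \<Longrightarrow> norm (\<Sum>l\<in>I. of_real (?c l) * turn (of_int l * t)) \<le> e"
      using tent_partial_sum_small[OF b e] by blast
    let ?S = "{..<J} \<times> I"
    let ?w = "\<lambda>p. of_real (?c (snd p) / real J) :: complex"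
    let ?f = "\<lambda>p z. z powi (- (n - int (N + fst p) * snd p))"
    define \<kappa> where "\<kappa> z = (\<Sum>p\<in>?S. ?w p * ?f p z)" for z :: complex
    have bm: "bounded_measurable circle_borel \<kappa>"
      unfolding \<kappa>_def by (intro bounded_measurable_sum bounded_measurable_powi)
    have T\<kappa>: "complex_measure_integral circle_borel \<mu> \<kappa>
        = (\<Sum>p\<in>?S. ?w p * fourier_coeff_measure \<mu> (n - int (N + fst p) * snd p))"
      unfolding \<kappa>_def fourier_coeff_measure_def
      by (rule complex_measure_integral_sum[OF \<mu>]) (rule bounded_measurable_powi)
    have "norm (\<kappa> z) \<le> e" if z: "z \<in> E" for z
    proof -
      obtain t where t: "z = turn t" "t \<notin> comb N J b" using EN[OF z] by blast
      have "?w p * ?f p z = turn (- (of_int n * t)) * (of_real (?c (snd p)) * turn (of_int (snd p) * (real (N + fst p) * t)) / of_nat J)" for p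
      proof -
        have "?f p z = turn (- (of_int n * t)) * turn (of_int (snd p) * (real (N + fst p) * t))"
          unfolding t(1) turn_powi turn_add[symmetric] by (rule arg_cong[of _ _ turn]) (simp add: algebra_simps)
        then show ?thesis by simp
      qed
      then have "\<kappa> z = turn (- (of_int n * t)) *
          ((\<Sum>p\<in>?S. of_real (?c (snd p)) * turn (of_int (snd p) * (real (N + fst p) * t))) / of_nat J)"
        unfolding \<kappa>_def by (simp only: sum_distrib_left sum_divide_distrib)
      also have "(\<Sum>p\<in>?S. of_real (?c (snd p)) * turn (of_int (snd p) * (real (N + fst p) * t)))
          = (\<Sum>j<J. \<Sum>l\<in>I. of_real (?c l) * turn (of_int l * (real (N + j) * t)))"
        by (simp add: sum.cartesian_product split_beta)
      finally have "norm (\<kappa> z) = norm (\<Sum>j<J. \<Sum>l\<in>I. of_real (?c l) * turn (of_int l * (real (N + j) * t))) / real J"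
        by (simp add: norm_mult norm_divide)
      also have "\<dots> \<le> (\<Sum>j<J. e) / real J"
      proof (intro divide_right_mono sum_norm_le)
        fix j assume "j \<in> {..<J}"
        then have "real (N + j) * t \<notin> near_int b" using t(2) by (auto simp: comb_def)
        then show "norm (\<Sum>l\<in>I. of_real (?c l) * turn (of_int l * (real (N + j) * t))) \<le> e" by (rule I(3))
      qed simp
      also have "\<dots> = e" using NJ(3) by simp
      finally show ?thesis .
    qed
    then have T: "norm (complex_measure_integral circle_borel \<mu> \<kappa>) \<le> e * ?V"
      by (intro norm_complex_measure_integral_le[OF \<mu> bm E]) auto
    let ?I = "I - {0}"
    let ?h = "\<lambda>p. ?w p * fourier_coeff_measure \<mu> (n - int (N + fst p) * snd p)"
    have "(\<Sum>p\<in>?S. ?h p) = (\<Sum>j<J. \<Sum>l\<in>I. ?h (j, l))"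
      by (simp add: sum.cartesian_product split_beta)
    also have "\<dots> = (\<Sum>j<J. ?h (j, 0) + (\<Sum>l\<in>?I. ?h (j, l)))"
      using I by (intro sum.cong refl sum.remove) auto
    also have "\<dots> = (\<Sum>j<J. ?h (j, 0)) + (\<Sum>j<J. \<Sum>l\<in>?I. ?h (j, l))" by (simp only: sum.distrib)
    also have "(\<Sum>j<J. ?h (j, 0)) = fourier_coeff_measure \<mu> n"
    proof -
      have "?h (j, 0) = fourier_coeff_measure \<mu> n / of_nat J" for j
        by (simp add: tent_coeff_0)
      then have "(\<Sum>j<J. ?h (j, 0)) = (\<Sum>j<J. fourier_coeff_measure \<mu> n / of_nat J)"
        by (rule sum.cong[OF refl])
      also have "\<dots> = fourier_coeff_measure \<mu> n" using NJ(3) by simp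
      finally show ?thesis .
    qed
    finally have eq: "complex_measure_integral circle_borel \<mu> \<kappa>
        = fourier_coeff_measure \<mu> n + (\<Sum>j<J. \<Sum>l\<in>?I. ?h (j, l))"
      by (rule trans[OF T\<kappa>])
    have "norm x \<le> norm y + norm r" if "y = x + r" for x y r :: complex
      using norm_triangle_ineq4[of y r] that by simp
    from this[OF eq]
    have "?a n \<le> norm (complex_measure_integral circle_borel \<mu> \<kappa>) + norm (\<Sum>j<J. \<Sum>l\<in>?I. ?h (j, l))" .
    also have "norm (\<Sum>j<J. \<Sum>l\<in>?I. ?h (j, l)) \<le> (\<Sum>j<J. \<Sum>l\<in>?I. ?c l / real J * ?a (n - int (N + j) * l))"
      by (intro sum_norm_le) (simp add: norm_mult norm_divide tent_coeff_nonneg)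
    also have "\<dots> = (\<Sum>j<J. \<Sum>l\<in>?I. ?c l * ?a (n - int (N + j) * l)) / real J"
      by (simp add: sum_divide_distrib)
    also have "\<dots> \<le> ?R"
      by (rule flat_average_bound[OF b NJ _ _ \<tau> q _ A]) (use I in auto)
    finally show ?thesis using T by simp
  qed
  have "?a n \<le> ?R + e" if e: "e > 0" for e
  proof -
    have "e / (?V + 1) * ?V \<le> e" using V e by (simp add: field_simps)
    with main[of "e / (?V + 1)"] show ?thesis using V e by simp
  qed
  from field_le_epsilon[OF this] show ?thesis .
qed

text \<open>With \<open>\<tau> = 1 / D ^ (k + 2)\<close> the first term of the bound is \<open>1 / D\<close>, and the second is \<open>A\<close> times a power of
\<open>D\<close> with exponent \<open>2 (q - 1) - k (2 - q)\<close>, which is at most \<open>-1\<close> for large \<open>k\<close>.\<close>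

lemma fourier_coeff_measure_vanish:
  fixes q A :: real
  assumes \<mu>: "complex_measure_on circle_borel \<mu>"
    and E: "E \<in> sets circle_borel" "\<And>B. B \<in> sets circle_borel \<Longrightarrow> B \<inter> E = {} \<Longrightarrow> \<mu> B = 0"
    and EN: "\<And>z. z \<in> E \<Longrightarrow> \<exists>t. z = turn t \<and> (\<forall>k. t \<notin> stage_comb k (D k))"
    and D: "\<And>k. k + 2 \<le> D k"
    and q: "1 \<le> q" "q < 2"
    and A: "\<And>X. finite X \<Longrightarrow> (\<Sum>n\<in>X. norm (fourier_coeff_measure \<mu> n) powr q) \<le> A"
  shows "fourier_coeff_measure \<mu> n = 0"
proof -
  let ?a = "norm (fourier_coeff_measure \<mu> n)"
  have A0: "0 \<le> A" using A[of "{}"] by simp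
  have bound: "?a \<le> (1 + A) / real (D k)" if k: "3 / (2 - q) \<le> real k" for k
  proof -
    define d where "d = real (D k)"
    have d2: "2 \<le> d" using D[of k] by (simp add: d_def)
    have "?a \<le> (1 / d ^ (k + 2)) / (1 / d ^ (k + 1)) + (1 / d ^ (k + 2)) powr (1 - q) * A / real (D k ^ k)"
    proof (rule fourier_coeff_measure_flat_bound[OF \<mu> E, where N = "D k ^ (3 * k + 2)"])
      show "\<exists>t. z = turn t \<and> t \<notin> comb (D k ^ (3 * k + 2)) (D k ^ k) (1 / d ^ (k + 1))" if "z \<in> E" for z
        using EN[OF that] by (auto simp: stage_comb_def d_def)
      have "2 * 1 \<le> d * d ^ k" using d2 by (intro mult_mono one_le_power) auto
      then show "1 / d ^ (k + 1) \<le> 1 / 2" using d2 by (intro divide_left_mono) auto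
      have "real (D k ^ (3 * k + 2)) * (1 / d ^ (k + 1)) = d ^ (2 * k + 1)"
      proof -
        have "d ^ (3 * k + 2) = d ^ (2 * k + 1) * d ^ (k + 1)"
          unfolding power_add[symmetric] by (rule arg_cong[of _ _ "power d"]) simp
        then show ?thesis using d2 by (simp add: d_def)
      qed
      moreover have "real (D k ^ k) ^ 3 \<le> (d ^ (2 * k + 1))\<^sup>2"
        unfolding d_def of_nat_power power_mult[symmetric] using d2 by (intro power_increasing) (auto simp: d_def)
      ultimately show "real ((D k ^ k) ^ 3) \<le> (real (D k ^ (3 * k + 2)) * (1 / d ^ (k + 1)))\<^sup>2" by simp
    qed (use d2 q A in \<open>auto simp: d_def\<close>)
    also have "(1 / d ^ (k + 2)) / (1 / d ^ (k + 1)) = 1 / d"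
      using d2 by (simp add: field_simps)
    also have "(1 / d ^ (k + 2)) powr (1 - q) * A / real (D k ^ k) \<le> A / d"
    proof -
      have "1 / d ^ (k + 2) = d powr (- real (k + 2))"
        using d2 powr_realpow[of d "k + 2"] by (simp only: powr_minus_divide)
      then have e1: "(1 / d ^ (k + 2)) powr (1 - q) = d powr (real (k + 2) * (q - 1))"
        by (simp add: powr_powr algebra_simps)
      have e2: "1 / real (D k ^ k) = d powr (- real k)"
        using d2 by (subst powr_minus_divide) (simp add: powr_realpow d_def)
      have "3 \<le> real k * (2 - q)" using k q by (simp add: field_simps)
      then have "real (k + 2) * (q - 1) + - real k \<le> - 1" using q by (simp add: algebra_simps)
      then have "d powr (real (k + 2) * (q - 1) + - real k) \<le> d powr (- 1)"
        using d2 by (intro powr_mono) auto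
      also have "\<dots> = 1 / d" using d2 by (simp add: powr_minus_divide)
      finally have "d powr (real (k + 2) * (q - 1)) * d powr (- real k) \<le> 1 / d"
        unfolding powr_add .
      then have "(d powr (real (k + 2) * (q - 1)) * d powr (- real k)) * A \<le> 1 / d * A"
        using A0 by (rule mult_right_mono)
      moreover have "(1 / d ^ (k + 2)) powr (1 - q) * A / real (D k ^ k)
          = (d powr (real (k + 2) * (q - 1)) * d powr (- real k)) * A"
        unfolding e1 e2[symmetric] by simp
      ultimately show ?thesis by simp
    qed
    finally show ?thesis by (simp add: d_def add_divide_distrib)
  qed
  have "?a \<le> 0 + e" if e: "e > 0" for e
  proof -
    obtain k :: nat where k: "max (3 / (2 - q)) ((1 + A) / e) \<le> real k" using real_arch_simple by blast
    have "?a \<le> (1 + A) / real (D k)" using k by (intro bound) simp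
    also have "\<dots> \<le> e"
    proof -
      have "(1 + A) / e \<le> real (D k)" using k D[of k] by simp
      then show ?thesis using e D[of k] by (simp add: field_simps)
    qed
    finally show ?thesis by simp
  qed
  from field_le_epsilon[OF this] show ?thesis by simp
qed

section \<open>Return to the circle\<close>

lemma Arg_borel_measurable [measurable]: "Arg \<in> borel_measurable borel"
proof (rule measurable_piecewise_restrict[of "{{0}, \<real>\<^sub>\<le>\<^sub>0 - {0}, - \<real>\<^sub>\<le>\<^sub>0}"])
  fix \<Omega> :: "complex set" assume \<Omega>: "\<Omega> \<in> {{0}, \<real>\<^sub>\<le>\<^sub>0 - {0}, - \<real>\<^sub>\<le>\<^sub>0}"
  have "closed (\<real>\<^sub>\<le>\<^sub>0 :: complex set)" by simp
  then show "\<Omega> \<inter> space borel \<in> sets borel" using \<Omega> by auto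
  have "continuous_on (\<real>\<^sub>\<le>\<^sub>0 - {0}) Arg"
  proof (rule continuous_on_eq[of _ "\<lambda>_. pi"])
    show "pi = Arg z" if "z \<in> \<real>\<^sub>\<le>\<^sub>0 - {0}" for z
    proof -
      have "Re z < 0 \<and> Im z = 0"
        using that by (auto simp: complex_nonpos_Reals_iff complex_eq_iff)
      then show ?thesis by (simp only: Arg_eq_pi[symmetric])
    qed
  qed simp
  moreover have "continuous_on (- \<real>\<^sub>\<le>\<^sub>0) Arg"
    using continuous_at_Arg by (intro continuous_at_imp_continuous_on) auto
  ultimately show "Arg \<in> borel_measurable (restrict_space borel \<Omega>)"
    using \<Omega> by (intro borel_measurable_continuous_on_restrict) auto
qed auto

lemma circle_measure_turn: "circle_measure = distr unit_leb circle_borel turn"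
  by (simp add: circle_measure_def turn_def[abs_def])

lemma turn_measurable_circle: "turn \<in> unit_leb \<rightarrow>\<^sub>M circle_borel"
  by (intro measurable_restrict_space2 measurable_restrict_space1 measurable_turn) auto

lemma fourier_coeff_on_line:
  assumes f: "bounded_periodic A f"
  shows "fourier_coeff (\<lambda>z. f (Arg z / (2 * pi))) n = fcoeff f n"
proof -
  have [measurable]: "f \<in> borel_measurable borel" and per: "\<And>t. f (t + 1) = f t"
    using f by (auto simp: bounded_periodic_def)
  have m: "(\<lambda>z. f (Arg z / (2 * pi)) * z powi (- n)) \<in> borel_measurable circle_borel"
  proof (rule borel_measurable_times)
    show "(\<lambda>z. f (Arg z / (2 * pi))) \<in> borel_measurable circle_borel"
      by (intro measurable_restrict_space1) measurable
    show "(\<lambda>z. z powi (- n)) \<in> borel_measurable circle_borel"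
      using bounded_measurable_powi[of "-n"] by (simp add: bounded_measurable_def)
  qed
  show ?thesis
    unfolding fourier_coeff_def circle_measure_turn integral_distr[OF turn_measurable_circle m] fcoeff_def
    by (simp add: periodic_Arg[of f, OF per] turn_powi)
qed

text \<open>Coefficients are bounded, so summability of a small power implies summability of every larger one,
and \<open>q\<close> may be assumed at least \<open>3 / 2\<close>.\<close>

lemma fourier_coeffs_not_summable:
  fixes q :: real
  assumes \<mu>: "complex_measure_on circle_borel \<mu>" and nz: "\<exists>A\<in>sets circle_borel. \<mu> A \<noteq> 0"
    and supp: "complex_measure_support circle_borel \<mu> \<subseteq> E"
    and E: "closed E" "E \<subseteq> circle"
    and EN: "\<And>z. z \<in> E \<Longrightarrow> \<exists>t. z = turn t \<and> (\<forall>k. t \<notin> stage_comb k (D k))"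
    and D: "\<And>k. k + 2 \<le> D k"
    and q: "0 < q" "q < 2"
  shows "(\<Sum>\<^sub>\<infinity>n\<in>(UNIV :: int set). ennreal (norm (fourier_coeff_measure \<mu> n) powr q)) = \<infinity>"
proof (rule ccontr)
  let ?a = "\<lambda>n. norm (fourier_coeff_measure \<mu> n)"
  assume fin: "\<not> ?thesis"
  have null: "\<mu> B = 0" if "B \<in> sets circle_borel" "B \<inter> E = {}" for B
    by (rule null_off_support[OF \<mu> supp E(1) that])
  have Es: "E \<in> sets circle_borel"
    using E by (auto simp: sets_restrict_space intro!: image_eqI[of _ _ E])
  define S where "S = enn2real (\<Sum>\<^sub>\<infinity>n\<in>(UNIV :: int set). ennreal (?a n powr q))"
  have S: "(\<Sum>n\<in>X. ?a n powr q) \<le> S" if X: "finite X" for X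
  proof -
    have "ennreal (\<Sum>n\<in>X. ?a n powr q) = (\<Sum>n\<in>X. ennreal (?a n powr q))"
      by (rule sum_ennreal[symmetric]) simp
    also have "\<dots> = (\<Sum>\<^sub>\<infinity>n\<in>X. ennreal (?a n powr q))" using X by simp
    also have "\<dots> \<le> (\<Sum>\<^sub>\<infinity>n\<in>(UNIV :: int set). ennreal (?a n powr q))"
      by (rule infsum_mono_neutral) (auto intro: nonneg_summable_on_complete)
    also have "\<dots> = ennreal S"
      unfolding S_def using fin by (simp add: less_top)
    finally show ?thesis by (subst (asm) ennreal_le_iff) (auto simp: S_def)
  qed
  define V where "V = max 1 (total_mass circle_borel \<mu>)"
  have aV: "?a n \<le> V" for n
  proof -
    have "?a n \<le> 1 * total_mass circle_borel \<mu>"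
      unfolding fourier_coeff_measure_def
    proof (rule norm_complex_measure_integral_le[OF \<mu> bounded_measurable_powi Es null])
      show "norm (z powi (- n)) \<le> 1" if "z \<in> E" for z
        using E(2) that by (auto simp: norm_power_int)
    qed
    then show ?thesis by (simp add: V_def)
  qed
  define q' where "q' = max q (3/2)"
  have q': "1 \<le> q'" "q' < 2" "q \<le> q'" using q by (auto simp: q'_def)
  have "(\<Sum>n\<in>X. ?a n powr q') \<le> V powr (q' - q) * S" if X: "finite X" for X
  proof -
    have "?a n powr q' \<le> V powr (q' - q) * ?a n powr q" for n
    proof -
      have "?a n powr q' = ?a n powr (q' - q) * ?a n powr q" by (simp flip: powr_add)
      also have "\<dots> \<le> V powr (q' - q) * ?a n powr q"
        using aV[of n] q' by (intro mult_right_mono powr_mono2) auto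
      finally show ?thesis .
    qed
    then have "(\<Sum>n\<in>X. ?a n powr q') \<le> (\<Sum>n\<in>X. V powr (q' - q) * ?a n powr q)" by (intro sum_mono)
    also have "\<dots> = V powr (q' - q) * (\<Sum>n\<in>X. ?a n powr q)" by (simp add: sum_distrib_left)
    also have "\<dots> \<le> V powr (q' - q) * S" using S[OF X] by (intro mult_left_mono) auto
    finally show ?thesis .
  qed
  then have "fourier_coeff_measure \<mu> n = 0" for n
    by (intro fourier_coeff_measure_vanish[OF \<mu> Es null EN D q'(1,2)]) auto
  then have "\<mu> A = 0" if "A \<in> sets circle_borel" for A
    using complex_measure_uniqueness[OF \<mu> _ that] by blast
  then show False using nz by blast
qed

theorem theorem1p1:
  fixes \<epsilon> :: real
  assumes "0 < \<epsilon>" and "\<epsilon> < 1"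
  shows "\<exists>E. compact E \<and> E \<subseteq> circle \<and> measure circle_measure E > 1 - \<epsilon> \<and>
    (\<forall>\<mu>. complex_measure_on circle_borel \<mu> \<longrightarrow>
         (\<exists>A\<in>sets circle_borel. \<mu> A \<noteq> 0) \<longrightarrow>
         complex_measure_support circle_borel \<mu> \<subseteq> E \<longrightarrow>
         (\<forall>q::real. 0 < q \<longrightarrow> q < 2 \<longrightarrow>
            (\<Sum>\<^sub>\<infinity>n\<in>(UNIV :: int set).
               ennreal (norm (fourier_coeff_measure \<mu> n) powr q)) = \<infinity>)) \<and>
    (\<exists>f\<in>L_infinity circle_measure.
         \<not> (AE z in circle_measure. f z = 0) \<and>
         (AE z in circle_measure. z \<notin> E \<longrightarrow> f z = 0) \<and>
         (\<forall>M::real. M > 0 \<longrightarrow>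
            (\<exists>C::real. C > 0 \<and>
               (\<forall>n::nat. n \<ge> 1 \<longrightarrow>
                  norm (fourier_coeff f (int n)) \<le> C * real n powr (- M)))))"
proof -
  obtain D f where D: "\<And>k. k + 2 \<le> D k"
    and small: "measure unit_leb ((\<Union>k. stage_comb k (D k)) \<inter> {0..<1}) < \<epsilon>"
    and f: "bounded_periodic 1 f" "\<And>k t. t \<in> stage_comb k (D k) \<Longrightarrow> f t = 0" "fcoeff f 0 \<noteq> 0"
    and decay: "\<And>k. \<exists>C>0. \<forall>n::nat. n \<ge> 1 \<longrightarrow> norm (fcoeff f (int n)) \<le> C / real n ^ k"
    using limit_function[OF assms] by blast
  define U where "U = (\<Union>k. stage_comb k (D k))"
  define E where "E = turn ` ({0..1} - U)"
  define F where "F z = f (Arg z / (2 * pi))" for z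
  have openU: "open U" unfolding U_def stage_comb_def by (intro open_UN ballI open_comb)
  have Uper: "t + 1 \<in> U \<longleftrightarrow> t \<in> U" for t by (simp add: U_def stage_comb_def comb_add_1)
  have compE: "compact E"
    unfolding E_def
    by (intro compact_continuous_image continuous_intros compact_diff openU compact_Icc)
  have Esub: "E \<subseteq> circle" by (auto simp: E_def)
  have Es: "E \<in> sets circle_borel"
    using compact_imp_closed[OF compE] Esub by (auto simp: sets_restrict_space intro!: image_eqI[of _ _ E])
  \<comment> \<open>Periodicity of the deleted set makes membership in E a condition on t alone.\<close>
  have notU_E: "turn t \<in> E" if "t \<notin> U" for t
  proof -
    have "frac t \<notin> U" using periodic_frac[of "\<lambda>t. t \<in> U" t, OF Uper] that by simp
    moreover have "turn (frac t) = turn t"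
      by (rule periodic_frac) (simp add: turn_add)
    moreover have "frac t \<in> {0..1}" using frac_lt_1[of t] by (simp add: less_imp_le)
    ultimately show ?thesis unfolding E_def by (metis DiffI image_eqI)
  qed
  have meas: "measure circle_measure E > 1 - \<epsilon>"
  proof -
    have Us: "U \<inter> {0..<1} \<in> sets unit_leb"
      using openU by (auto simp: sets_restrict_space intro!: image_eqI[of _ _ U])
    have sp: "space unit_leb = {0..<1}" by (simp add: space_restrict_space)
    have "1 - \<epsilon> < measure unit_leb (space unit_leb - U \<inter> {0..<1})"
      using small finite_measure.finite_measure_compl[OF finite_measure_unit_leb Us]
      by (simp add: U_def)
    also have "\<dots> \<le> measure unit_leb (turn -` E \<inter> space unit_leb)"
      by (rule finite_measure.finite_measure_mono[OF finite_measure_unit_leb])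
         (use notU_E sp measurable_sets[OF turn_measurable_circle Es] in auto)
    also have "\<dots> = measure circle_measure E"
      unfolding circle_measure_turn by (rule measure_distr[OF turn_measurable_circle Es, symmetric])
    finally show ?thesis .
  qed
  have part1: "(\<Sum>\<^sub>\<infinity>n\<in>(UNIV :: int set). ennreal (norm (fourier_coeff_measure \<mu> n) powr q)) = \<infinity>"
    if "complex_measure_on circle_borel \<mu>" "\<exists>A\<in>sets circle_borel. \<mu> A \<noteq> 0"
      "complex_measure_support circle_borel \<mu> \<subseteq> E" "0 < q" "q < 2" for \<mu> and q :: real
    by (rule fourier_coeffs_not_summable[OF that(1,2,3) compact_imp_closed[OF compE] Esub _ D that(4,5)])
       (auto simp: E_def U_def)
  have fm: "f \<in> borel_measurable borel" using f(1) by (simp add: bounded_periodic_def)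
  have F0: "F z = 0" if z: "z \<in> circle" "z \<notin> E" for z
  proof -
    have "Arg z / (2 * pi) \<in> U" using notU_E[of "Arg z / (2 * pi)"] z turn_Arg[OF z(1)] by auto
    then show ?thesis using f(2) by (auto simp: F_def U_def)
  qed
  have spc: "space circle_measure = circle" by (simp add: circle_measure_turn)
  have fcF: "fourier_coeff F n = fcoeff f n" for n
    unfolding F_def by (rule fourier_coeff_on_line[OF f(1)])
  have Finf: "F \<in> L_infinity circle_measure"
  proof -
    have "F \<in> borel_measurable circle_borel"
      unfolding F_def by (intro measurable_restrict_space1) (use fm in measurable)
    then have "F \<in> borel_measurable circle_measure" by (simp add: circle_measure_turn)
    moreover have "norm (F z) \<le> 1" for z using f(1) by (simp add: F_def bounded_periodic_def)
    ultimately show ?thesis by (auto simp: L_infinity_def intro!: exI[of _ 1])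
  qed
  have Fnz: "\<not> (AE z in circle_measure. F z = 0)"
  proof
    assume "AE z in circle_measure. F z = 0"
    then have "fourier_coeff F 0 = 0"
      unfolding fourier_coeff_def by (intro integral_eq_zero_AE) auto
    then show False using f(3) fcF by simp
  qed
  have Fdecay: "\<exists>C>0. \<forall>n::nat. n \<ge> 1 \<longrightarrow> norm (fourier_coeff F (int n)) \<le> C * real n powr (- M)"
    if M: "M > 0" for M
  proof -
    obtain k :: nat where k: "M \<le> real k" using real_arch_simple by blast
    obtain C where C: "C > 0" "\<forall>n::nat. n \<ge> 1 \<longrightarrow> norm (fcoeff f (int n)) \<le> C / real n ^ k"
      using decay[of k] by blast
    have "norm (fourier_coeff F (int n)) \<le> C * real n powr (- M)" if n: "n \<ge> 1" for n :: nat
    proof -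
      have "norm (fourier_coeff F (int n)) \<le> C / real n ^ k" using C n by (simp add: fcF)
      also have "\<dots> = C * real n powr (- real k)"
        using n by (simp add: powr_minus_divide powr_realpow)
      also have "\<dots> \<le> C * real n powr (- M)"
        using n k C by (intro mult_left_mono powr_mono) auto
      finally show ?thesis .
    qed
    then show ?thesis using C(1) by blast
  qed
  have AEF: "AE z in circle_measure. z \<notin> E \<longrightarrow> F z = 0"
    using F0 spc by (intro AE_I2) auto
  show ?thesis
    using compE Esub meas part1 Finf Fnz AEF Fdecay
    by (intro exI[of _ E] conjI allI impI bexI[of _ F]) blast+
qed

end
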